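(* Let $x\in\mathbb{R}^n$ and let $\gamma>0$ be a constant. There exists a randomized algorithm that performs $\mathcal{O}((k/\epsilon)\log\log(\epsilon n/k))$ adaptive linear measurements on $x$ in $\mathcal{O}(\log^* k\cdot\log\log(\epsilon n/k))$ rounds, and outputs a vector $\hat x\in\mathbb{R}^n$ such that $\|x-\hat x\|_2^2\leq(1+\epsilon)\|x_{-k}\|_2^2$. The algorithm fails with probability at most $\exp(-k^{1-\gamma})$.
   Context: $x_{-k}$ is the vector obtained from $x$ by zeroing out its $k$ largest coordinates in magnitude (ties broken arbitrarily). An adaptive linear measurement of $x$ is a value $\langle a,x\rangle$ where the vector $a$ may be chosen (randomly) depending on the outcomes of previous measurements; measurements are organized in rounds, where the measurement vectors of a round may depend only on the outcomes of earlier rounds. $\log^*$ denotes the iterated logarithm.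
   Formalization: Stated for 1 ≤ k ≤ n and 0 < ε ≤ 1 (for unbounded ε the claim fails: exact recovery of k-sparse x needs k measurements), and with log log(εn/k) and log* k read as at least 1, since the literal bounds vanish or are undefined for small εn/k or k = 1. *)

theory Defs
  imports "HOL-Probability.Probability"
begin

text \<open>
  A vector of \<open>\<real>\<^sup>n\<close> is a function of type \<^typ>\<open>nat \<Rightarrow> real\<close> of which only the values at
  indices \<open>i < n\<close> are ever used (the implied constants have to be uniform in \<open>n\<close>, so \<open>n\<close> cannot
  be a type).
\<close>

definition inner_prod :: "nat \<Rightarrow> (nat \<Rightarrow> real) \<Rightarrow> (nat \<Rightarrow> real) \<Rightarrow> real" where
  "inner_prod n a x = (\<Sum>i<n. a i * x i)"

abbreviation norm2 :: "nat \<Rightarrow> (nat \<Rightarrow> real) \<Rightarrow> real" where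
  "norm2 n x \<equiv> L2_set x {..<n}"

text \<open>
  \<open>is_tail n k x z\<close> says that \<open>z\<close> is a possible value of \<open>x\<^bsub>-k\<^esub>\<close>; there is one such \<open>z\<close> for
  every way of breaking ties.
\<close>

definition is_tail :: "nat \<Rightarrow> nat \<Rightarrow> (nat \<Rightarrow> real) \<Rightarrow> (nat \<Rightarrow> real) \<Rightarrow> bool" where
  "is_tail n k x z \<longleftrightarrow>
     (\<exists>S \<subseteq> {..<n}. card S = k \<and> (\<forall>i\<in>S. \<forall>j\<in>{..<n} - S. \<bar>x j\<bar> \<le> \<bar>x i\<bar>) \<and>
        z = (\<lambda>i. if i \<in> S then 0 else x i))"

definition log_star :: "real \<Rightarrow> nat" where
  "log_star t = (LEAST i. (log 2 ^^ i) t \<le> 1)"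

text \<open>
  \<open>log log t\<close>, with the usual convention inside \<open>O(\<cdot>)\<close> that it is read as \<open>1\<close> when it would
  be smaller than \<open>1\<close> or undefined, that is, for \<open>t \<le> 4\<close>.
\<close>

definition loglog :: "real \<Rightarrow> real" where
  "loglog t = log 2 (log 2 (max 4 t))"

text \<open>
  A history maps \<open>(r, j)\<close> to the outcome of the \<open>j\<close>-th measurement of round \<open>r\<close>, and is \<open>0\<close> at
  all \<open>(r, j)\<close> for which no measurement has been made.
\<close>

type_synonym history = "nat \<times> nat \<Rightarrow> real"

abbreviation history_space :: "history measure" where
  "history_space \<equiv> (\<Pi>\<^sub>M _\<in>UNIV. borel)"

text \<open>
  All internal randomness is the seed \<open>\<omega>\<close>, drawn from \<open>seed_space\<close> before the first round. In
  round \<open>r\<close>, \<open>round_size r \<omega> h\<close> is the number of measurements and \<open>meas_vec r j \<omega> h\<close> is the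
  \<open>j\<close>-th measurement vector, where \<open>h\<close> is the history of the rounds before \<open>r\<close>.
\<close>

record 's adaptive_algorithm =
  seed_space :: "'s measure"
  num_rounds :: nat
  round_size :: "nat \<Rightarrow> 's \<Rightarrow> history \<Rightarrow> nat"
  meas_vec :: "nat \<Rightarrow> nat \<Rightarrow> 's \<Rightarrow> history \<Rightarrow> nat \<Rightarrow> real"
  estimate :: "'s \<Rightarrow> history \<Rightarrow> nat \<Rightarrow> real"

text \<open>
  Joint measurability in the seed and the history is part of the notion of a randomized algorithm.
  It is not enough to ask, for each input separately, that the failure event be measurable: then
  Fubini's theorem is not available and, under the continuum hypothesis, there are pathological
  strategies that recover every input almost surely from a single measurement.
\<close>

definition randomized_algorithm :: "nat \<Rightarrow> 's adaptive_algorithm \<Rightarrow> bool" where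
  "randomized_algorithm n A \<longleftrightarrow>
     prob_space (seed_space A) \<and>
     (\<forall>r. (\<lambda>(\<omega>, h). round_size A r \<omega> h)
            \<in> measurable (seed_space A \<Otimes>\<^sub>M history_space) (count_space UNIV)) \<and>
     (\<forall>r j. \<forall>i<n. (\<lambda>(\<omega>, h). meas_vec A r j \<omega> h i)
            \<in> borel_measurable (seed_space A \<Otimes>\<^sub>M history_space)) \<and>
     (\<forall>i<n. (\<lambda>(\<omega>, h). estimate A \<omega> h i)
            \<in> borel_measurable (seed_space A \<Otimes>\<^sub>M history_space))"

primrec run :: "nat \<Rightarrow> 's adaptive_algorithm \<Rightarrow> (nat \<Rightarrow> real) \<Rightarrow> 's \<Rightarrow> nat \<Rightarrow> history" where
  "run n A x \<omega> 0 = (\<lambda>_. 0)"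
| "run n A x \<omega> (Suc r) =
     (\<lambda>(s, j). if s = r \<and> j < round_size A r \<omega> (run n A x \<omega> r)
               then inner_prod n (meas_vec A r j \<omega> (run n A x \<omega> r)) x
               else run n A x \<omega> r (s, j))"

definition num_measurements :: "nat \<Rightarrow> 's adaptive_algorithm \<Rightarrow> (nat \<Rightarrow> real) \<Rightarrow> 's \<Rightarrow> nat" where
  "num_measurements n A x \<omega> = (\<Sum>r<num_rounds A. round_size A r \<omega> (run n A x \<omega> r))"

definition recovered :: "nat \<Rightarrow> 's adaptive_algorithm \<Rightarrow> (nat \<Rightarrow> real) \<Rightarrow> 's \<Rightarrow> nat \<Rightarrow> real" where
  "recovered n A x \<omega> = estimate A \<omega> (run n A x \<omega> (num_rounds A))"

definition failure_event ::
  "nat \<Rightarrow> 's adaptive_algorithm \<Rightarrow> real \<Rightarrow> (nat \<Rightarrow> real) \<Rightarrow> (nat \<Rightarrow> real) \<Rightarrow> 's set" where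
  "failure_event n A \<epsilon> x z =
     {\<omega> \<in> space (seed_space A).
        \<not> (norm2 n (\<lambda>i. x i - recovered n A x \<omega> i))\<^sup>2 \<le> (1 + \<epsilon>) * (norm2 n z)\<^sup>2}"

lemma run_measurable:
  assumes "randomized_algorithm n A"
  shows "(\<lambda>\<omega>. run n A x \<omega> r) \<in> measurable (seed_space A) history_space"
proof (induction r)
  case 0
  show ?case by (auto intro!: measurable_PiM_single')
next
  case (Suc r)
  have pair: "(\<lambda>\<omega>. (\<omega>, run n A x \<omega> r)) \<in> measurable (seed_space A) (seed_space A \<Otimes>\<^sub>M history_space)"
    using Suc by measurable
  have size: "(\<lambda>\<omega>. round_size A r \<omega> (run n A x \<omega> r)) \<in> measurable (seed_space A) (count_space UNIV)"
    using assms measurable_compose[OF pair, of "\<lambda>(\<omega>, h). round_size A r \<omega> h"]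
    by (simp add: randomized_algorithm_def)
  have vec: "(\<lambda>\<omega>. meas_vec A r j \<omega> (run n A x \<omega> r) i) \<in> borel_measurable (seed_space A)"
    if "i < n" for i j
    using assms that measurable_compose[OF pair, of "\<lambda>(\<omega>, h). meas_vec A r j \<omega> h i"]
    by (simp add: randomized_algorithm_def)
  have comp: "(\<lambda>\<omega>. run n A x \<omega> r p) \<in> borel_measurable (seed_space A)" for p
    using measurable_compose[OF Suc measurable_component_singleton[of p UNIV]] by simp
  have inner: "(\<lambda>\<omega>. inner_prod n (meas_vec A r j \<omega> (run n A x \<omega> r)) x)
      \<in> borel_measurable (seed_space A)" for j
    unfolding inner_prod_def using vec by (intro borel_measurable_sum borel_measurable_times) auto
  have "(\<lambda>\<omega>. run n A x \<omega> (Suc r) (s, j)) \<in> borel_measurable (seed_space A)" for s j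
  proof (cases "s = r")
    case True
    have "Measurable.pred (seed_space A) (\<lambda>\<omega>. j < round_size A r \<omega> (run n A x \<omega> r))"
      using size by measurable
    then show ?thesis using True inner[of j] comp[of "(s, j)"] by simp
  next
    case False
    then show ?thesis using comp[of "(s, j)"] by simp
  qed
  then show ?case
    by (intro measurable_PiM_single') (auto simp del: run.simps)
qed

lemma failure_event_measurable:
  assumes "randomized_algorithm n A"
  shows "failure_event n A \<epsilon> x z \<in> sets (seed_space A)"
proof -
  have pair: "(\<lambda>\<omega>. (\<omega>, run n A x \<omega> (num_rounds A)))
      \<in> measurable (seed_space A) (seed_space A \<Otimes>\<^sub>M history_space)"
    using run_measurable[OF assms] by measurable
  have "(\<lambda>\<omega>. recovered n A x \<omega> i) \<in> borel_measurable (seed_space A)" if "i < n" for i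
    unfolding recovered_def
    using assms that measurable_compose[OF pair, of "\<lambda>(\<omega>, h). estimate A \<omega> h i"]
    by (simp add: randomized_algorithm_def)
  then have "(\<lambda>\<omega>. (norm2 n (\<lambda>i. x i - recovered n A x \<omega> i))\<^sup>2) \<in> borel_measurable (seed_space A)"
    unfolding L2_set_def
    by (intro borel_measurable_power borel_measurable_sqrt borel_measurable_sum
        borel_measurable_diff measurable_compose[OF _ borel_measurable_sqrt]) auto
  then show ?thesis
    unfolding failure_event_def by measurable
qed

end

theory Submission
  imports Defs
begin

text \<open>
  Coordinates can be read exactly once their indices are known, so it suffices to find a set of
  \<open>O(k/\<epsilon>)\<close> indices that misses energy at most \<open>\<epsilon> \<parallel>x\<^bsub>-k\<^esub>\<parallel>\<^sup>2\<close> of the top \<open>k\<close> coordinates;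
  superfluous indices only help. In each of \<open>O(log\<^sup>* k)\<close> stages the remaining coordinates are hashed,
  in \<open>R\<close> independent repetitions, into \<open>B\<close> buckets. A heavy coordinate that dominates its bucket is
  isolated in \<open>O(log log(\<epsilon>n/k))\<close> rounds of two measurements each: with random signs \<open>\<sigma>\<close>
  and random labels \<open>g\<close>, the quotient of \<open>\<Sum> \<sigma>\<^sub>j g\<^sub>j x\<^sub>j\<close> and \<open>\<Sum> \<sigma>\<^sub>j x\<^sub>j\<close> rounds to the label of the
  dominant coordinate; discarding all other labels improves the signal-to-noise ratio, so that the
  number of labels can be squared every few rounds.

  Failures of different coordinates in one repetition behave as if they were independent, hence \<open>m\<close>
  given coordinates all fail in all repetitions with probability at most \<open>128\<^sup>-\<^sup>m\<^sup>R\<close>, and a union bound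
  over the sets of \<open>m\<close> coordinates applies. When \<open>t = k (z\<^sub>0/z)\<^sup>a\<close> coordinates remain, the budget allows
  \<open>R = z\<^sup>a\<^sup>-\<^sup>8\<close> repetitions with \<open>B = t z\<^sup>7/\<epsilon>\<close> buckets, after which the parameter \<open>z\<close> can be replaced by
  \<open>2\<^sup>z\<close>, as long as a failure probability below \<open>exp(-k\<^sup>1\<^sup>-\<^sup>\<gamma>)\<close> leaves room for that much progress, and
  by \<open>z k\<^bsup>\<gamma>/(2a)\<^esup>\<close> otherwise; the second case occurs only \<open>O(1/\<gamma>)\<close> times.
\<close>

section \<open>Finite product distributions\<close>

text \<open>All distributions of the analysis have finite support, so expectations are finite sums
  and no integrability condition survives.\<close>

lemma expectation_pair_pmf:
  fixes f :: "'a \<times> 'b \<Rightarrow> real"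
  assumes "finite (set_pmf p)" "finite (set_pmf q)"
  shows "measure_pmf.expectation (pair_pmf p q) f =
         measure_pmf.expectation p (\<lambda>a. measure_pmf.expectation q (\<lambda>b. f (a, b)))"
proof -
  have "measure_pmf.expectation (pair_pmf p q) f =
      (\<Sum>z\<in>set_pmf p \<times> set_pmf q. f z * pmf (pair_pmf p q) z)"
    using assms by (intro integral_measure_pmf_real) auto
  also have "\<dots> = (\<Sum>a\<in>set_pmf p. \<Sum>b\<in>set_pmf q. f (a, b) * (pmf p a * pmf q b))"
    by (simp add: sum.cartesian_product) (auto intro!: sum.cong simp: pmf_pair)
  also have "\<dots> = (\<Sum>a\<in>set_pmf p. (\<Sum>b\<in>set_pmf q. f (a, b) * pmf q b) * pmf p a)"
    by (simp add: sum_distrib_left sum_distrib_right mult_ac)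
  also have "\<dots> = (\<Sum>a\<in>set_pmf p. measure_pmf.expectation q (\<lambda>b. f (a, b)) * pmf p a)"
    using assms by (intro sum.cong refl arg_cong2[where f="(*)"] integral_measure_pmf_real[symmetric]) auto
  also have "\<dots> = measure_pmf.expectation p (\<lambda>a. measure_pmf.expectation q (\<lambda>b. f (a, b)))"
    using assms by (intro integral_measure_pmf_real[symmetric]) auto
  finally show ?thesis .
qed

lemma prob_eq_expectation_indicator:
  "measure_pmf.prob p S = measure_pmf.expectation p (indicator S)"
  by simp

lemma prob_pair_pmf:
  assumes "finite (set_pmf p)" "finite (set_pmf q)"
  shows "measure_pmf.prob (pair_pmf p q) S =
         measure_pmf.expectation p (\<lambda>a. measure_pmf.prob q {b. (a, b) \<in> S})"
proof -
  have "measure_pmf.prob (pair_pmf p q) S = measure_pmf.expectation p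
      (\<lambda>a. measure_pmf.expectation q (\<lambda>b. indicator S (a, b)))"
    unfolding prob_eq_expectation_indicator by (rule expectation_pair_pmf[OF assms])
  also have "\<dots> = measure_pmf.expectation p (\<lambda>a. measure_pmf.prob q {b. (a, b) \<in> S})"
    unfolding prob_eq_expectation_indicator
    by (intro Bochner_Integration.integral_cong refl) (auto simp: indicator_def)
  finally show ?thesis .
qed

lemma expectation_pmf_mono:
  fixes f g :: "'a \<Rightarrow> real"
  assumes "finite (set_pmf p)" "\<And>a. a \<in> set_pmf p \<Longrightarrow> f a \<le> g a"
  shows "measure_pmf.expectation p f \<le> measure_pmf.expectation p g"
  using assms by (intro integral_mono_AE integrable_measure_pmf_finite) (auto simp: AE_measure_pmf_iff)

lemma finite_set_Pi_pmf:
  assumes "finite A" "\<And>a. a \<in> A \<Longrightarrow> finite (set_pmf (p a))"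
  shows "finite (set_pmf (Pi_pmf A d p))"
  using assms by (auto simp: set_Pi_pmf)

text \<open>Here the new coordinate is drawn first and the others are averaged inside. This order
  suits a process whose first round is split off; \<open>prob_Pi_pmf_insert_last\<close> is the
  order for splitting off the last stage.\<close>

lemma prob_Pi_pmf_insert:
  assumes "finite A" "a \<notin> A" "finite (set_pmf (p a))" "\<And>a. a \<in> A \<Longrightarrow> finite (set_pmf (p a))"
  shows "measure_pmf.prob (Pi_pmf (insert a A) d p) S =
         measure_pmf.expectation (p a) (\<lambda>y. measure_pmf.prob (Pi_pmf A d p) {f. f(a := y) \<in> S})"
proof -
  have "measure_pmf.prob (Pi_pmf (insert a A) d p) S =
      measure_pmf.prob (pair_pmf (p a) (Pi_pmf A d p)) ((\<lambda>(y, f). f(a := y)) -` S)"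
    using assms by (simp add: Pi_pmf_insert)
  then show ?thesis
    using assms by (simp add: prob_pair_pmf finite_set_Pi_pmf)
qed

lemma expectation_Pi_pmf_insert:
  fixes h :: "('a \<Rightarrow> 'b) \<Rightarrow> real"
  assumes "finite A" "a \<notin> A" "finite (set_pmf (p a))" "\<And>a. a \<in> A \<Longrightarrow> finite (set_pmf (p a))"
  shows "measure_pmf.expectation (Pi_pmf (insert a A) d p) h =
         measure_pmf.expectation (Pi_pmf A d p) (\<lambda>f. measure_pmf.expectation (p a) (\<lambda>y. h (f(a := y))))"
proof -
  have "measure_pmf.expectation (Pi_pmf (insert a A) d p) h =
      measure_pmf.expectation (pair_pmf (p a) (Pi_pmf A d p)) (\<lambda>(y, f). h (f(a := y)))"
    using assms by (simp add: Pi_pmf_insert case_prod_unfold)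
  also have "\<dots> = measure_pmf.expectation (pair_pmf (Pi_pmf A d p) (p a)) (\<lambda>(f, y). h (f(a := y)))"
    by (subst pair_commute_pmf) (simp add: case_prod_unfold)
  finally show ?thesis
    using assms by (simp add: expectation_pair_pmf finite_set_Pi_pmf)
qed

lemma prob_Pi_pmf_insert_last:
  assumes "finite A" "a \<notin> A" "finite (set_pmf (p a))" "\<And>a. a \<in> A \<Longrightarrow> finite (set_pmf (p a))"
  shows "measure_pmf.prob (Pi_pmf (insert a A) d p) S =
         measure_pmf.expectation (Pi_pmf A d p) (\<lambda>f. measure_pmf.prob (p a) {y. f(a := y) \<in> S})"
proof -
  have "measure_pmf.prob (Pi_pmf (insert a A) d p) S = measure_pmf.expectation (Pi_pmf A d p)
      (\<lambda>f. measure_pmf.expectation (p a) (\<lambda>y. indicator S (f(a := y))))"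
    unfolding prob_eq_expectation_indicator by (rule expectation_Pi_pmf_insert) (use assms in auto)
  also have "\<dots> = measure_pmf.expectation (Pi_pmf A d p) (\<lambda>f. measure_pmf.prob (p a) {y. f(a := y) \<in> S})"
    unfolding prob_eq_expectation_indicator
    by (intro Bochner_Integration.integral_cong refl) (auto simp: indicator_def)
  finally show ?thesis .
qed

section \<open>Random signs and random labels\<close>

definition signs_pmf :: "nat \<Rightarrow> (nat \<Rightarrow> real) pmf" where
  "signs_pmf n = Pi_pmf {..<n} 0 (\<lambda>_. pmf_of_set {- 1, 1})"

text \<open>Serves both for the bucket of a coordinate and for its label inside a bucket.\<close>

definition hash_pmf :: "nat set \<Rightarrow> nat \<Rightarrow> (nat \<Rightarrow> nat) pmf" where
  "hash_pmf I D = Pi_pmf I 0 (\<lambda>_. pmf_of_set {..<D})"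

lemma finite_signs_pmf [simp]: "finite (set_pmf (signs_pmf n))"
  unfolding signs_pmf_def by (intro finite_set_Pi_pmf) auto

lemma finite_hash_pmf [simp]: "finite I \<Longrightarrow> D > 0 \<Longrightarrow> finite (set_pmf (hash_pmf I D))"
  unfolding hash_pmf_def by (intro finite_set_Pi_pmf) (auto simp: set_pmf_of_set lessThan_empty_iff)

lemma hash_pmf_less:
  assumes "finite I" "D > 0" "g \<in> set_pmf (hash_pmf I D)" "i \<in> I"
  shows "g i < D"
  using assms by (auto simp: hash_pmf_def set_Pi_pmf PiE_dflt_def set_pmf_of_set lessThan_empty_iff)

text \<open>Signs are independent with mean zero, so averaging over one of them removes its cross
  terms.\<close>

lemma expectation_sign_sum_squared:
  assumes "finite A"
  shows "measure_pmf.expectation (Pi_pmf A 0 (\<lambda>_. pmf_of_set {- 1, 1}))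
           (\<lambda>\<sigma>. (a + (\<Sum>j\<in>A. \<sigma> j * c j))\<^sup>2) = a\<^sup>2 + (\<Sum>j\<in>A. (c j)\<^sup>2 :: real)"
  using assms
proof (induction A arbitrary: a rule: finite_induct)
  case empty
  then show ?case by simp
next
  case (insert i A)
  have eq: "(a + (\<Sum>j\<in>insert i A. (\<sigma>(i := y)) j * c j))\<^sup>2 = (a + (\<Sum>j\<in>A. \<sigma> j * c j) + y * c i)\<^sup>2" for y \<sigma>
  proof -
    have "(\<Sum>j\<in>A. (\<sigma>(i := y)) j * c j) = (\<Sum>j\<in>A. \<sigma> j * c j)"
      using insert.hyps by (intro sum.cong) auto
    then show ?thesis using insert.hyps by (simp add: algebra_simps)
  qed
  have avg: "measure_pmf.expectation (pmf_of_set {- 1, 1}) (\<lambda>y. (s + y * c i)\<^sup>2) = s\<^sup>2 + (c i)\<^sup>2" for s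
    by (simp add: integral_pmf_of_set power2_eq_square algebra_simps)
  have "measure_pmf.expectation (Pi_pmf (insert i A) 0 (\<lambda>_. pmf_of_set {- 1, 1}))
           (\<lambda>\<sigma>. (a + (\<Sum>j\<in>insert i A. \<sigma> j * c j))\<^sup>2) =
      measure_pmf.expectation (Pi_pmf A 0 (\<lambda>_. pmf_of_set {- 1, 1}))
        (\<lambda>\<sigma>. (a + (\<Sum>j\<in>A. \<sigma> j * c j))\<^sup>2 + (c i)\<^sup>2)"
    using insert.hyps
    by (subst expectation_Pi_pmf_insert) (simp_all only: eq avg, auto)
  also have "\<dots> = a\<^sup>2 + (\<Sum>j\<in>A. (c j)\<^sup>2) + (c i)\<^sup>2"
    using insert.hyps
    by (subst Bochner_Integration.integral_add)
      (auto intro!: integrable_measure_pmf_finite finite_set_Pi_pmf simp: insert.IH)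
  finally show ?case
    using insert.hyps by simp
qed

lemma expectation_signs_pmf_square:
  assumes "A \<subseteq> {..<n}"
  shows "measure_pmf.expectation (signs_pmf n) (\<lambda>\<sigma>. (\<Sum>j\<in>A. \<sigma> j * c j)\<^sup>2) = (\<Sum>j\<in>A. (c j)\<^sup>2)"
proof -
  \<comment> \<open>Padding with zero coefficients turns a sum over \<open>A\<close> into a sum over
    all drawn signs.\<close>
  have "(\<Sum>j\<in>A. \<sigma> j * c j) = 0 + (\<Sum>j<n. \<sigma> j * (if j \<in> A then c j else 0))" for \<sigma>
    using assms by (simp add: if_distrib sum.If_cases Int_absorb1 cong: if_cong)
  then have "measure_pmf.expectation (signs_pmf n) (\<lambda>\<sigma>. (\<Sum>j\<in>A. \<sigma> j * c j)\<^sup>2) =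
      0\<^sup>2 + (\<Sum>j<n. (if j \<in> A then c j else 0)\<^sup>2)"
    unfolding signs_pmf_def by (simp only: expectation_sign_sum_squared finite_lessThan)
  also have "\<dots> = (\<Sum>j\<in>A. (c j)\<^sup>2)"
    using assms by (simp add: if_distrib[of "\<lambda>t. t\<^sup>2"] sum.If_cases Int_absorb1 cong: if_cong)
  finally show ?thesis .
qed

text \<open>Once the value at \<open>j\<close> is fixed, the value at \<open>i\<close> is still
  uniform on \<open>D\<close> values.\<close>

lemma prob_hash_collision:
  assumes "finite I" "D > 0" "i \<in> I" "j \<in> I" "i \<noteq> j"
  shows "measure_pmf.prob (hash_pmf I D) {g. g j = g i} = 1 / D"
proof -
  define I' where "I' = I - {j}"
  have I: "I = insert j I'" "j \<notin> I'" "finite I'" "i \<in> I'"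
    using assms by (auto simp: I'_def)
  have ne: "{..<D} \<noteq> {}" using assms by (auto simp: lessThan_empty_iff)
  have "measure_pmf.prob (hash_pmf I D) {g. g j = g i} =
      measure_pmf.expectation (pmf_of_set {..<D}) (\<lambda>y. measure_pmf.prob (hash_pmf I' D) {f. f i = y})"
    unfolding hash_pmf_def I(1) using I ne \<open>i \<noteq> j\<close>
    by (subst prob_Pi_pmf_insert) (auto intro!: Bochner_Integration.integral_cong arg_cong2[where f=measure])
  also have "\<dots> = measure_pmf.expectation (pmf_of_set {..<D}) (\<lambda>y. 1 / D)"
  proof (intro integral_cong_AE)
    have "measure_pmf.prob (hash_pmf I' D) {f. f i = y} = 1 / D" if "y < D" for y
    proof -
      have "measure_pmf.prob (hash_pmf I' D) {f. f i = y} =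
          measure_pmf.prob (map_pmf (\<lambda>f. f i) (hash_pmf I' D)) {y}"
        by (simp add: vimage_def)
      also have "\<dots> = pmf (pmf_of_set {..<D}) y"
        using I by (simp add: hash_pmf_def Pi_pmf_component measure_pmf_single)
      finally show ?thesis using that ne by (simp add: pmf_of_set)
    qed
    then show "AE y in measure_pmf (pmf_of_set {..<D}). measure_pmf.prob (hash_pmf I' D) {f. f i = y} = 1 / D"
      using ne by (simp add: AE_measure_pmf_iff set_pmf_of_set)
  qed auto
  finally show ?thesis by simp
qed

section \<open>Isolating a dominant coordinate\<close>

text \<open>\<open>u\<close> is the signed sum and \<open>v\<close> the same sum weighted by labels.
  Division by zero gives the label \<open>0\<close>, so a cell with vanishing signed sum is decoded
  too.\<close>

definition decode_label :: "real \<Rightarrow> real \<Rightarrow> int" where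
  "decode_label u v = round (v / u)"

definition cell_step :: "(nat \<Rightarrow> real) \<Rightarrow> (nat \<Rightarrow> real) \<times> (nat \<Rightarrow> nat) \<Rightarrow> nat set \<Rightarrow> nat set" where
  "cell_step x c C = {j \<in> C. int (snd c j) =
     decode_label (\<Sum>j\<in>C. fst c j * x j) (\<Sum>j\<in>C. fst c j * real (snd c j) * x j)}"

definition cell_run ::
  "(nat \<Rightarrow> real) \<Rightarrow> (nat \<Rightarrow> (nat \<Rightarrow> real) \<times> (nat \<Rightarrow> nat)) \<Rightarrow> nat list \<Rightarrow> nat set \<Rightarrow> nat set" where
  "cell_run x c ls C = foldl (\<lambda>C l. cell_step x (c l) C) C ls"

definition round_pmf :: "nat \<Rightarrow> nat \<Rightarrow> ((nat \<Rightarrow> real) \<times> (nat \<Rightarrow> nat)) pmf" where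
  "round_pmf n D = pair_pmf (signs_pmf n) (hash_pmf {..<n} D)"

definition cell_pmf ::
  "nat \<Rightarrow> (nat \<Rightarrow> nat) \<Rightarrow> nat set \<Rightarrow> (nat \<Rightarrow> (nat \<Rightarrow> real) \<times> (nat \<Rightarrow> nat)) pmf" where
  "cell_pmf n D I = Pi_pmf I undefined (\<lambda>l. round_pmf n (D l))"

lemma finite_round_pmf [simp]: "D > 0 \<Longrightarrow> finite (set_pmf (round_pmf n D))"
  by (simp add: round_pmf_def)

lemma finite_cell_pmf [simp]:
  "finite I \<Longrightarrow> (\<And>l. D l > 0) \<Longrightarrow> finite (set_pmf (cell_pmf n D I))"
  unfolding cell_pmf_def by (intro finite_set_Pi_pmf) auto

text \<open>The quotient is \<open>m + W / u\<close> with \<open>u = \<sigma> * y + U\<close>. Both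
  \<open>U\<close> and \<open>W\<close> are below a quarter of \<open>y\<close> in magnitude, so
  \<open>u\<close> exceeds twice \<open>W\<close> and the error is below 1/2.\<close>

lemma decode_label_correct:
  fixes W U :: real
  assumes "\<bar>\<sigma>\<bar> = 1" and small: "16 * (U\<^sup>2 + W\<^sup>2) < y\<^sup>2"
  shows "decode_label (\<sigma> * y + U) (real m * (\<sigma> * y + U) + W) = int m"
proof -
  have sq: "(4 * r)\<^sup>2 = 16 * r\<^sup>2" for r :: real by (simp add: power_mult_distrib)
  have "(4 * U)\<^sup>2 < y\<^sup>2"
    unfolding sq by (rule le_less_trans[OF _ small]) simp
  then have U: "\<bar>4 * U\<bar> < \<bar>y\<bar>" by (metis abs_le_square_iff not_le)
  have "(4 * W)\<^sup>2 < y\<^sup>2"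
    unfolding sq by (rule le_less_trans[OF _ small]) simp
  then have W: "\<bar>4 * W\<bar> < \<bar>y\<bar>" by (metis abs_le_square_iff not_le)
  define u where "u = \<sigma> * y + U"
  have "\<bar>\<sigma> * y\<bar> = \<bar>y\<bar>" using assms(1) by (simp add: abs_mult)
  then have u: "\<bar>u\<bar> > 2 * \<bar>W\<bar>" using U W unfolding u_def by linarith
  then have u': "u \<noteq> 0" by auto
  have "(real m * u + W) / u - real m = W / u" using u' by (simp add: field_simps)
  moreover have "\<bar>W / u\<bar> < 1 / 2" using u u' by (simp add: abs_divide field_simps)
  ultimately have "\<bar>(real m * u + W) / u - of_int (int m)\<bar> < 1 / 2" by simp
  then have "round ((real m * u + W) / u) = int m" by (rule round_unique')
  then show ?thesis by (simp add: decode_label_def u_def)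
qed

text \<open>Taking labels relative to \<open>g i\<close> removes the dominant coordinate from the
  second noise term and gives the form of \<open>decode_label_correct\<close>.\<close>

lemma cell_step_correct:
  assumes "finite C" "i \<in> C" "\<bar>\<sigma> i\<bar> = 1"
    and "16 * ((\<Sum>j\<in>C - {i}. \<sigma> j * x j)\<^sup>2 + (\<Sum>j\<in>C - {i}. \<sigma> j * ((real (g j) - real (g i)) * x j))\<^sup>2) < (x i)\<^sup>2"
  shows "cell_step x (\<sigma>, g) C = {j \<in> C. g j = g i}"
proof -
  let ?U = "\<Sum>j\<in>C - {i}. \<sigma> j * x j" and ?W = "\<Sum>j\<in>C - {i}. \<sigma> j * ((real (g j) - real (g i)) * x j)"
  have u: "(\<Sum>j\<in>C. \<sigma> j * x j) = \<sigma> i * x i + ?U"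
    using assms by (simp add: sum.remove)
  have "(\<Sum>j\<in>C. \<sigma> j * real (g j) * x j) = \<sigma> i * real (g i) * x i + (\<Sum>j\<in>C - {i}. \<sigma> j * real (g j) * x j)"
    using assms by (simp add: sum.remove)
  also have "(\<Sum>j\<in>C - {i}. \<sigma> j * real (g j) * x j) = real (g i) * ?U + ?W"
    by (simp add: sum_distrib_left algebra_simps flip: sum.distrib)
  finally have v: "(\<Sum>j\<in>C. \<sigma> j * real (g j) * x j) = real (g i) * (\<sigma> i * x i + ?U) + ?W"
    by (simp add: algebra_simps)
  have "decode_label (\<Sum>j\<in>C. \<sigma> j * x j) (\<Sum>j\<in>C. \<sigma> j * real (g j) * x j) = int (g i)"
    unfolding u v by (rule decode_label_correct) (use assms in auto)
  then show ?thesis by (auto simp: cell_step_def)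
qed

text \<open>For \<open>x i \<noteq> 0\<close> the first summand is at least 1 whenever
  \<open>cell_step_correct\<close> does not apply, so its mean bounds the failure probability as in
  Markov's inequality. The second summand is a potential of the other candidates sharing the label
  of \<open>i\<close>. The two noise terms contribute at most \<open>16 * D^2\<close> times the
  energy each, and every candidate keeps its place with probability \<open>1 / D\<close>.\<close>

lemma expectation_cell_step_potential:
  fixes a b :: real
  assumes C: "C \<subseteq> {..<n}" "i \<in> C" and D: "D > 0"
  shows "measure_pmf.expectation (round_pmf n D) (\<lambda>(\<sigma>, g).
      16 * ((\<Sum>j\<in>C - {i}. \<sigma> j * x j)\<^sup>2 + (\<Sum>j\<in>C - {i}. \<sigma> j * ((real (g j) - real (g i)) * x j))\<^sup>2) / (x i)\<^sup>2
      + (\<Sum>j\<in>C - {i}. (a * (x j)\<^sup>2 + b) * of_bool (g j = g i)))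
    \<le> (32 * (real D)\<^sup>2 / (x i)\<^sup>2 + a / D) * (\<Sum>j\<in>C - {i}. (x j)\<^sup>2) + b / D * real (card (C - {i}))"
proof -
  let ?N = "\<Sum>j\<in>C - {i}. (x j)\<^sup>2"
  have sub: "C - {i} \<subseteq> {..<n}" using C by auto
  have inner: "measure_pmf.expectation (signs_pmf n) (\<lambda>\<sigma>.
      16 * ((\<Sum>j\<in>C - {i}. \<sigma> j * x j)\<^sup>2 + (\<Sum>j\<in>C - {i}. \<sigma> j * ((real (g j) - real (g i)) * x j))\<^sup>2) / (x i)\<^sup>2
      + (\<Sum>j\<in>C - {i}. (a * (x j)\<^sup>2 + b) * of_bool (g j = g i)))
    = 16 * (?N + (\<Sum>j\<in>C - {i}. ((real (g j) - real (g i)) * x j)\<^sup>2)) / (x i)\<^sup>2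
      + (\<Sum>j\<in>C - {i}. (a * (x j)\<^sup>2 + b) * of_bool (g j = g i))" for g
    by (simp add: integrable_measure_pmf_finite expectation_signs_pmf_square[OF sub])
  have coll: "measure_pmf.expectation (hash_pmf {..<n} D) (\<lambda>g. of_bool (g j = g i)) = 1 / D"
    if "j \<in> C - {i}" for j
  proof -
    have "measure_pmf.expectation (hash_pmf {..<n} D) (\<lambda>g. of_bool (g j = g i)) =
        measure_pmf.prob (hash_pmf {..<n} D) {g. g j = g i}"
      unfolding prob_eq_expectation_indicator
      by (intro Bochner_Integration.integral_cong refl) (auto simp: indicator_def)
    also have "\<dots> = 1 / D" using that C D by (intro prob_hash_collision) auto
    finally show ?thesis .
  qed
  have bound: "16 * (?N + (\<Sum>j\<in>C - {i}. ((real (g j) - real (g i)) * x j)\<^sup>2)) / (x i)\<^sup>2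
      \<le> 32 * (real D)\<^sup>2 / (x i)\<^sup>2 * ?N" if g: "g \<in> set_pmf (hash_pmf {..<n} D)" for g
  proof -
    have "((real (g j) - real (g i)) * x j)\<^sup>2 \<le> (real D)\<^sup>2 * (x j)\<^sup>2" if "j \<in> C" for j
    proof -
      have "g j < D" "g i < D" using that C by (auto intro: hash_pmf_less[OF _ D g])
      then have "\<bar>real (g j) - real (g i)\<bar> \<le> \<bar>real D\<bar>" by linarith
      then have "(real (g j) - real (g i))\<^sup>2 \<le> (real D)\<^sup>2" by (simp only: abs_le_square_iff)
      then show ?thesis by (simp add: power_mult_distrib mult_right_mono)
    qed
    then have "(\<Sum>j\<in>C - {i}. ((real (g j) - real (g i)) * x j)\<^sup>2) \<le> (real D)\<^sup>2 * ?N"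
      unfolding sum_distrib_left by (intro sum_mono) auto
    moreover have "?N \<le> (real D)\<^sup>2 * ?N"
    proof -
      have "1 * ?N \<le> (real D)\<^sup>2 * ?N"
        using D by (intro mult_right_mono sum_nonneg one_le_power) auto
      then show ?thesis by simp
    qed
    ultimately have "16 * (?N + (\<Sum>j\<in>C - {i}. ((real (g j) - real (g i)) * x j)\<^sup>2)) \<le> 32 * (real D)\<^sup>2 * ?N"
      by (simp add: algebra_simps)
    then have "16 * (?N + (\<Sum>j\<in>C - {i}. ((real (g j) - real (g i)) * x j)\<^sup>2)) / (x i)\<^sup>2
        \<le> 32 * (real D)\<^sup>2 * ?N / (x i)\<^sup>2"
      by (rule divide_right_mono) simp
    then show ?thesis by simp
  qed
  \<comment> \<open>Swapping the pair lets the signs be averaged first, with the labels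
    fixed.\<close>
  have "measure_pmf.expectation (round_pmf n D) (\<lambda>(\<sigma>, g).
      16 * ((\<Sum>j\<in>C - {i}. \<sigma> j * x j)\<^sup>2 + (\<Sum>j\<in>C - {i}. \<sigma> j * ((real (g j) - real (g i)) * x j))\<^sup>2) / (x i)\<^sup>2
      + (\<Sum>j\<in>C - {i}. (a * (x j)\<^sup>2 + b) * of_bool (g j = g i)))
    = measure_pmf.expectation (pair_pmf (hash_pmf {..<n} D) (signs_pmf n)) (\<lambda>(g, \<sigma>).
      16 * ((\<Sum>j\<in>C - {i}. \<sigma> j * x j)\<^sup>2 + (\<Sum>j\<in>C - {i}. \<sigma> j * ((real (g j) - real (g i)) * x j))\<^sup>2) / (x i)\<^sup>2
      + (\<Sum>j\<in>C - {i}. (a * (x j)\<^sup>2 + b) * of_bool (g j = g i)))"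
    unfolding round_pmf_def by (subst pair_commute_pmf) (simp add: case_prod_unfold)
  also have "\<dots> = measure_pmf.expectation (hash_pmf {..<n} D) (\<lambda>g.
      16 * (?N + (\<Sum>j\<in>C - {i}. ((real (g j) - real (g i)) * x j)\<^sup>2)) / (x i)\<^sup>2
      + (\<Sum>j\<in>C - {i}. (a * (x j)\<^sup>2 + b) * of_bool (g j = g i)))"
    using D by (subst expectation_pair_pmf)
      (simp_all only: prod.case inner finite_hash_pmf finite_signs_pmf finite_lessThan)
  also have "\<dots> \<le> measure_pmf.expectation (hash_pmf {..<n} D) (\<lambda>g.
      32 * (real D)\<^sup>2 / (x i)\<^sup>2 * ?N + (\<Sum>j\<in>C - {i}. (a * (x j)\<^sup>2 + b) * of_bool (g j = g i)))"
    using D by (intro expectation_pmf_mono add_right_mono bound) auto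
  also have "\<dots> = 32 * (real D)\<^sup>2 / (x i)\<^sup>2 * ?N + (\<Sum>j\<in>C - {i}. (a * (x j)\<^sup>2 + b) * (1 / D))"
    using D by (simp add: integrable_measure_pmf_finite coll)
  also have "\<dots> = (32 * (real D)\<^sup>2 / (x i)\<^sup>2 + a / D) * ?N + b / D * real (card (C - {i}))"
    using D by (simp add: sum.distrib sum_distrib_left field_simps flip: sum_divide_distrib)
  finally show ?thesis .
qed

text \<open>
  Isolating a coordinate that dominates its cell: \<open>X\<close> and \<open>K\<close> are potentials for the energy and
  the number of the other candidates; each round divides both, in expectation, by the size of its
  label alphabet.
\<close>

lemma prob_cell_run_fails:
  fixes X K :: "nat \<Rightarrow> real"
  assumes D: "\<And>l. D l > 0" and X: "\<And>l. 0 \<le> X l" "\<And>l. 32 * (real (D l))\<^sup>2 + X (Suc l) / D l \<le> X l"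
    and K: "\<And>l. l < L \<Longrightarrow> K (Suc l) / D l \<le> K l" "K L = 1"
    and xi: "x i \<noteq> 0" and le: "l \<le> L" and C: "C \<subseteq> {..<n}" "i \<in> C"
  shows "measure_pmf.prob (cell_pmf n D {l..<L}) {c. cell_run x c [l..<L] C \<noteq> {i}}
    \<le> X l / (x i)\<^sup>2 * (\<Sum>j\<in>C - {i}. (x j)\<^sup>2) + K l * real (card (C - {i}))"
  using le C
proof (induction "L - l" arbitrary: l C)
  case 0
  then have [simp]: "l = L" by simp
  have finC: "finite C" using "0.prems" finite_subset by blast
  \<comment> \<open>With no round left, failure means that some other candidate is present; then the
    term with \<open>K L = 1\<close> is already at least 1.\<close>
  show ?case
  proof (cases "C = {i}")
    case True
    then show ?thesis by (simp add: cell_run_def)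
  next
    case False
    then have "C - {i} \<noteq> {}" using "0.prems" by auto
    then have "1 \<le> real (card (C - {i}))" using finC by (simp add: Suc_leI card_gt_0_iff)
    moreover have "0 \<le> X L / (x i)\<^sup>2 * (\<Sum>j\<in>C - {i}. (x j)\<^sup>2)"
      using X(1) by (intro mult_nonneg_nonneg divide_nonneg_nonneg sum_nonneg) auto
    ultimately show ?thesis using K(2) False by (simp add: cell_run_def)
  qed
next
  case (Suc d)
  then have lL: "l < L" by simp
  then have ivl: "{l..<L} = insert l {Suc l..<L}" "[l..<L] = l # [Suc l..<L]"
    by (auto simp: upt_conv_Cons)
  have finC: "finite C" using Suc.prems finite_subset by blast
  define F where "F = (\<lambda>\<sigma> (g :: nat \<Rightarrow> nat). 16 * ((\<Sum>j\<in>C - {i}. \<sigma> j * x j)\<^sup>2 +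
      (\<Sum>j\<in>C - {i}. \<sigma> j * ((real (g j) - real (g i)) * x j))\<^sup>2) / (x i)\<^sup>2)"
  define P where "P = (\<lambda>g :: nat \<Rightarrow> nat. \<Sum>j\<in>C - {i}. (X (Suc l) / (x i)\<^sup>2 * (x j)\<^sup>2 + K (Suc l)) * of_bool (g j = g i))"
  have step: "measure_pmf.prob (cell_pmf n D {Suc l..<L}) {c. cell_run x c [Suc l..<L] (cell_step x (\<sigma>, g) C) \<noteq> {i}}
      \<le> F \<sigma> g + P g" if sg: "(\<sigma>, g) \<in> set_pmf (round_pmf n (D l))" for \<sigma> g
  \<comment> \<open>If \<open>F\<close> is at least 1 the bound is trivial. Otherwise decoding is
    correct, and the induction hypothesis applies to the candidates that share the label of
    \<open>i\<close>.\<close>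
  proof (cases "F \<sigma> g < 1")
    case True
    have "\<bar>\<sigma> i\<bar> = 1"
      using sg Suc.prems by (auto simp: round_pmf_def signs_pmf_def set_Pi_pmf PiE_dflt_def)
    moreover have "16 * ((\<Sum>j\<in>C - {i}. \<sigma> j * x j)\<^sup>2 +
      (\<Sum>j\<in>C - {i}. \<sigma> j * ((real (g j) - real (g i)) * x j))\<^sup>2) < (x i)\<^sup>2"
      using True xi by (simp add: F_def field_simps)
    ultimately have st: "cell_step x (\<sigma>, g) C = {j \<in> C. g j = g i}"
      using finC Suc.prems by (intro cell_step_correct) auto
    have eq: "{j \<in> C. g j = g i} - {i} = {j \<in> C - {i}. g j = g i}" by auto
    have "measure_pmf.prob (cell_pmf n D {Suc l..<L}) {c. cell_run x c [Suc l..<L] (cell_step x (\<sigma>, g) C) \<noteq> {i}}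
      \<le> X (Suc l) / (x i)\<^sup>2 * (\<Sum>j\<in>{j \<in> C. g j = g i} - {i}. (x j)\<^sup>2) + K (Suc l) * real (card ({j \<in> C. g j = g i} - {i}))"
      unfolding st using Suc.prems Suc.hyps(2) lL by (intro Suc.hyps(1)) auto
    also have "\<dots> = P g"
    proof -
      have "P g = (\<Sum>j\<in>{j \<in> C - {i}. g j = g i}. X (Suc l) / (x i)\<^sup>2 * (x j)\<^sup>2 + K (Suc l))"
        unfolding P_def using finC by (subst sum.inter_filter[of "C - {i}"]) (simp, rule sum.cong, simp_all)
      then show ?thesis by (simp add: eq sum.distrib sum_distrib_left)
    qed
    finally show ?thesis
      by (rule order_trans) (simp add: F_def)
  next
    case False
    have Kpos: "0 \<le> K (Suc l)"
    proof -
      have "0 \<le> K l'" if "l' \<le> L" for l'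
        using that
      proof (induction rule: inc_induct)
        case base
        then show ?case by (simp add: K)
      next
        case (step m)
        then have "0 \<le> K (Suc m) / D m" by (intro divide_nonneg_nonneg) auto
        also have "\<dots> \<le> K m" using step by (intro K(1)) auto
        finally show ?case .
      qed
      then show ?thesis using lL by simp
    qed
    have "0 \<le> P g" unfolding P_def using X(1) Kpos by (intro sum_nonneg) auto
    then show ?thesis using False by (intro order_trans[OF measure_pmf.prob_le_1]) linarith
  qed
  \<comment> \<open>Condition on round \<open>l\<close>: the later rounds are independent of it and
    start from the filtered cell.\<close>
  have "measure_pmf.prob (cell_pmf n D {l..<L}) {c. cell_run x c [l..<L] C \<noteq> {i}} =
    measure_pmf.expectation (round_pmf n (D l)) (\<lambda>y. measure_pmf.prob (cell_pmf n D {Suc l..<L})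
       {c. cell_run x c [Suc l..<L] (cell_step x y C) \<noteq> {i}})"
  proof -
    have "cell_run x (c(l := y)) [l..<L] C = cell_run x c [Suc l..<L] (cell_step x y C)" for c y
      unfolding cell_run_def ivl by (simp, intro foldl_cong) auto
    then show ?thesis
      unfolding cell_pmf_def ivl(1) using D by (subst prob_Pi_pmf_insert) auto
  qed
  also have "\<dots> \<le> measure_pmf.expectation (round_pmf n (D l)) (\<lambda>(\<sigma>, g). F \<sigma> g + P g)"
    using D step by (intro expectation_pmf_mono) auto
  also have "\<dots> \<le> (32 * (real (D l))\<^sup>2 / (x i)\<^sup>2 + (X (Suc l) / (x i)\<^sup>2) / D l) * (\<Sum>j\<in>C - {i}. (x j)\<^sup>2)
      + K (Suc l) / D l * real (card (C - {i}))"
    unfolding F_def P_def using Suc.prems D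
    by (intro expectation_cell_step_potential) auto
  also have "\<dots> \<le> X l / (x i)\<^sup>2 * (\<Sum>j\<in>C - {i}. (x j)\<^sup>2) + K l * real (card (C - {i}))"
  proof (intro add_mono mult_right_mono K lL sum_nonneg)
    have "32 * (real (D l))\<^sup>2 / (x i)\<^sup>2 + (X (Suc l) / (x i)\<^sup>2) / D l =
        (32 * (real (D l))\<^sup>2 + X (Suc l) / D l) / (x i)\<^sup>2"
      by (simp add: add_divide_distrib)
    also have "\<dots> \<le> X l / (x i)\<^sup>2" by (intro divide_right_mono X) auto
    finally show "32 * (real (D l))\<^sup>2 / (x i)\<^sup>2 + (X (Suc l) / (x i)\<^sup>2) / D l \<le> X l / (x i)\<^sup>2" .
  qed auto
  finally show ?case .
qed

section \<open>Hashing into buckets\<close>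

text \<open>\<open>Z\<close> stands for the buckets spoiled by coordinates outside
  \<open>W\<close>.\<close>

definition isolated :: "('a \<Rightarrow> 'b) \<Rightarrow> 'b set \<Rightarrow> 'a set \<Rightarrow> 'a set" where
  "isolated f Z W = {i \<in> W. f i \<notin> Z \<and> (\<forall>j\<in>W - {i}. f j \<noteq> f i)}"

text \<open>In a fresh bucket \<open>w\<close> becomes isolated itself and contributes a factor
  \<open>p\<close>. In a spoiled or occupied bucket it can destroy at most one isolated element, the
  one living there, which costs a factor \<open>1 / p\<close>.\<close>

lemma power_isolated_insert:
  fixes p :: real
  assumes "finite W" "w \<notin> W" "0 < p" "p \<le> 1"
  shows "p ^ card (isolated (f(w := y)) Z (insert w W))
    \<le> p ^ card (isolated f Z W) * (p + of_bool (y \<in> Z \<union> f ` W) / p)"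
proof (cases "y \<in> Z \<union> f ` W")
  case False
  then have "isolated (f(w := y)) Z (insert w W) = insert w (isolated f Z W)"
    using assms(2) by (auto simp: isolated_def)
  moreover have "w \<notin> isolated f Z W" "finite (isolated f Z W)"
    using assms by (auto simp: isolated_def)
  ultimately show ?thesis using False by simp
next
  case True
  have fin: "finite (isolated f Z W)" "finite (isolated (f(w := y)) Z (insert w W))"
    using assms by (auto simp: isolated_def)
  have "finite {i \<in> isolated f Z W. f i = y}" using fin by simp
  then have one: "card {i \<in> isolated f Z W. f i = y} \<le> Suc 0"
    by (subst card_le_Suc0_iff_eq) (auto simp: isolated_def)
  have "isolated f Z W \<subseteq> isolated (f(w := y)) Z (insert w W) \<union> {i \<in> isolated f Z W. f i = y}"
    using assms(2) by (auto simp: isolated_def)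
  then have "card (isolated f Z W) \<le> card (isolated (f(w := y)) Z (insert w W)) + card {i \<in> isolated f Z W. f i = y}"
    by (intro order_trans[OF card_mono card_Un_le]) (use fin in auto)
  then have le: "card (isolated f Z W) \<le> Suc (card (isolated (f(w := y)) Z (insert w W)))"
    using one by linarith
  have "p * p ^ card (isolated (f(w := y)) Z (insert w W)) \<le> p ^ card (isolated f Z W)"
    using power_decreasing[OF le, of p] assms by simp
  then have "p ^ card (isolated (f(w := y)) Z (insert w W)) \<le> p ^ card (isolated f Z W) / p"
    using assms by (simp add: field_simps)
  also have "\<dots> \<le> p ^ card (isolated f Z W) * (p + of_bool (y \<in> Z \<union> f ` W) / p)"
    using True assms by (simp add: algebra_simps)
  finally show ?thesis .
qed

text \<open>Hash the elements of \<open>W\<close> one at a time. Spoiled and occupied buckets are at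
  most a fraction \<open>p^2\<close> of all, so the factor of \<open>power_isolated_insert\<close>
  has mean at most \<open>p + p^2 / p = 2 * p\<close>. Since \<open>Z\<close> depends only on the
  hash values on \<open>V\<close>, it stays fixed meanwhile.\<close>

lemma expectation_power_isolated:
  fixes p :: real and Z :: "(nat \<Rightarrow> nat) \<Rightarrow> nat set"
  assumes fin: "finite V" "finite W" and disj: "V \<inter> W = {}" and B: "B > 0" and p: "0 < p" "p \<le> 1"
    and local: "\<And>f w y. w \<notin> V \<Longrightarrow> Z (f(w := y)) = Z f"
    and Zfin: "\<And>f. finite (Z f)"
    and few: "\<And>f. real (card (Z f)) + real (card W) \<le> p\<^sup>2 * real B"
  shows "measure_pmf.expectation (hash_pmf (V \<union> W) B) (\<lambda>f. p ^ card (isolated f (Z f) W)) \<le> (2 * p) ^ card W"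
  using fin(2) disj few
proof (induction W rule: finite_induct)
  case empty
  then show ?case by (simp add: isolated_def)
next
  case (insert w W)
  have ne: "{..<B} \<noteq> {}" using B by (auto simp: lessThan_empty_iff)
  have wV: "w \<notin> V" using insert.prems(1) by auto
  have few': "real (card (Z f)) + real (card W) \<le> p\<^sup>2 * real B" for f
    using insert.prems(2)[of f] insert.hyps by simp
  have inner: "measure_pmf.expectation (pmf_of_set {..<B})
        (\<lambda>y. p ^ card (isolated (f(w := y)) (Z f) (insert w W)))
      \<le> 2 * p * p ^ card (isolated f (Z f) W)" for f
  proof -
    let ?c = "p ^ card (isolated f (Z f) W)" and ?Z = "Z f \<union> f ` W"
    have fZ: "finite ?Z" using insert.hyps Zfin by auto
    have "(\<Sum>y<B. of_bool (y \<in> ?Z)) = real (card ({..<B} \<inter> ?Z))"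
      by (simp add: sum.If_cases of_bool_def Int_def)
    also have "\<dots> \<le> real (card ?Z)" using fZ by (simp add: card_mono)
    also have "\<dots> \<le> real (card (Z f)) + real (card W)"
    proof -
      have "card ?Z \<le> card (Z f) + card (f ` W)" by (rule card_Un_le)
      also have "\<dots> \<le> card (Z f) + card W" using card_image_le[OF insert.hyps(1)] by simp
      finally show ?thesis by linarith
    qed
    also have "\<dots> \<le> p\<^sup>2 * real B" by (rule few')
    finally have cnt: "(\<Sum>y<B. of_bool (y \<in> ?Z)) \<le> p\<^sup>2 * real B" .
    have "(\<Sum>y<B. p ^ card (isolated (f(w := y)) (Z f) (insert w W)))
        \<le> (\<Sum>y<B. ?c * (p + of_bool (y \<in> ?Z) / p))"
      using insert.hyps p by (intro sum_mono power_isolated_insert) auto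
    also have "\<dots> = ?c * (p * real B + (\<Sum>y<B. of_bool (y \<in> ?Z)) / p)"
      by (simp add: sum.distrib flip: sum_distrib_left sum_divide_distrib)
    also have "\<dots> \<le> ?c * (p * real B + p\<^sup>2 * real B / p)"
      using cnt p by (intro mult_left_mono add_left_mono divide_right_mono) auto
    also have "\<dots> = 2 * p * ?c * real B"
      using p by (simp add: power2_eq_square algebra_simps)
    finally show ?thesis
      using B ne by (simp add: integral_pmf_of_set field_simps)
  qed
  have "measure_pmf.expectation (hash_pmf (V \<union> insert w W) B) (\<lambda>f. p ^ card (isolated f (Z f) (insert w W))) =
    measure_pmf.expectation (hash_pmf (V \<union> W) B) (\<lambda>f. measure_pmf.expectation (pmf_of_set {..<B})
        (\<lambda>y. p ^ card (isolated (f(w := y)) (Z f) (insert w W))))"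
  proof -
    have "V \<union> insert w W = insert w (V \<union> W)" by auto
    then show ?thesis
      unfolding hash_pmf_def using fin(1) insert.hyps wV ne local
      by (simp add: expectation_Pi_pmf_insert)
  qed
  also have "\<dots> \<le> measure_pmf.expectation (hash_pmf (V \<union> W) B) (\<lambda>f. 2 * p * p ^ card (isolated f (Z f) W))"
    using inner B fin(1) insert.hyps by (intro expectation_pmf_mono) auto
  also have "\<dots> = 2 * p * measure_pmf.expectation (hash_pmf (V \<union> W) B) (\<lambda>f. p ^ card (isolated f (Z f) W))"
    by simp
  also have "\<dots> \<le> 2 * p * (2 * p) ^ card W"
    using insert.prems(1) few' p by (intro mult_left_mono insert.IH) auto
  finally show ?case using insert.hyps by simp
qed

text \<open>Markov's inequality over the buckets. The product form \<open>M * \<theta>\<close>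
  instead of a quotient covers \<open>\<theta> = 0\<close>, which occurs when the tail of the vector
  vanishes.\<close>

lemma card_heavy_buckets:
  fixes w :: "nat \<Rightarrow> real"
  assumes "finite A" "\<And>j. j \<in> A \<Longrightarrow> 0 \<le> w j" "0 \<le> r" "0 \<le> \<theta>" "0 \<le> M" "(\<Sum>j\<in>A. w j) * r \<le> M * \<theta>"
  shows "real (card {b \<in> {..<B::nat}. \<theta> < (\<Sum>j | j \<in> A \<and> h j = b. w j) * r}) \<le> M"
proof -
  let ?H = "{b \<in> {..<B}. \<theta> < (\<Sum>j | j \<in> A \<and> h j = b. w j) * r}"
  have fin: "finite ?H" by auto
  have total: "(\<Sum>b\<in>?H. \<Sum>j | j \<in> A \<and> h j = b. w j) \<le> (\<Sum>j\<in>A. w j)"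
  proof -
    have "(\<Sum>b\<in>?H. \<Sum>j | j \<in> A \<and> h j = b. w j) = (\<Sum>j\<in>(\<Union>b\<in>?H. {j. j \<in> A \<and> h j = b}). w j)"
      using assms(1) fin by (intro sum.UNION_disjoint[symmetric]) auto
    also have "\<dots> \<le> (\<Sum>j\<in>A. w j)" using assms by (intro sum_mono2) auto
    finally show ?thesis .
  qed
  show ?thesis
  proof (cases "?H = {}")
    case True
    then show ?thesis using assms by (metis card.empty of_nat_0)
  next
    case False
    have "real (card ?H) * \<theta> = (\<Sum>b\<in>?H. \<theta>)" by simp
    also have "\<dots> < (\<Sum>b\<in>?H. (\<Sum>j | j \<in> A \<and> h j = b. w j) * r)"
      using False fin by (intro sum_strict_mono) auto
    also have "\<dots> = (\<Sum>b\<in>?H. \<Sum>j | j \<in> A \<and> h j = b. w j) * r"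
      by (simp add: sum_distrib_right)
    also have "\<dots> \<le> (\<Sum>j\<in>A. w j) * r" using total assms by (intro mult_right_mono) auto
    also have "\<dots> \<le> M * \<theta>" by fact
    finally show ?thesis using assms(4) by (auto simp: mult_less_cancel_right)
  qed
qed

definition rep_pmf :: "nat \<Rightarrow> nat \<Rightarrow> 'c pmf \<Rightarrow> ((nat \<Rightarrow> nat) \<times> (nat \<Rightarrow> 'c)) pmf" where
  "rep_pmf n B q = pair_pmf (hash_pmf {..<n} B) (Pi_pmf {..<B} undefined (\<lambda>_. q))"

text \<open>The isolation procedure is a parameter, because the hashing argument uses only its
  failure probability in a clean bucket. Removing \<open>S\<close> from the buckets keeps the
  coordinates already found from acting as noise.\<close>

definition rep_found ::
  "('c \<Rightarrow> nat set \<Rightarrow> nat set) \<Rightarrow> nat \<Rightarrow> nat \<Rightarrow> nat set \<Rightarrow> (nat \<Rightarrow> nat) \<times> (nat \<Rightarrow> 'c) \<Rightarrow> nat set" where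
  "rep_found isolate n B S r = {i. \<exists>b<B. isolate (snd r b) ({j. j < n \<and> fst r j = b} - S) = {i}}"

lemma finite_rep_pmf [simp]:
  "B > 0 \<Longrightarrow> finite (set_pmf q) \<Longrightarrow> finite (set_pmf (rep_pmf n B q))"
  by (simp add: rep_pmf_def finite_set_Pi_pmf)

text \<open>Given the hash function, the isolated elements of \<open>W\<close> lie in distinct clean
  buckets with independent seeds, so all of them fail with probability at most \<open>p\<close> to
  their number. Averaging over the hash function is \<open>expectation_power_isolated\<close>. In
  \<open>budget\<close>, one copy of \<open>card U\<close> pays for the buckets hit by
  \<open>U - W\<close> and the other for those hit by \<open>W\<close>.\<close>

lemma prob_rep_misses_all:
  fixes x :: "nat \<Rightarrow> real" and p :: real
  assumes q: "finite (set_pmf q)" and p: "0 < p" "p \<le> 1" and B: "B > 0"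
    and U: "U \<subseteq> {..<n} - S" and W: "W \<subseteq> U"
    and cell: "\<And>A i. A \<subseteq> {..<n} \<Longrightarrow> i \<in> A \<Longrightarrow> i \<in> U \<Longrightarrow> (\<Sum>j\<in>A - {i}. (x j)\<^sup>2) * r \<le> \<theta> \<Longrightarrow>
      real (card (A - {i})) \<le> \<Lambda> \<Longrightarrow> measure_pmf.prob q {c. isolate c A \<noteq> {i}} \<le> p"
    and noise: "(\<Sum>j\<in>{..<n} - S - U. (x j)\<^sup>2) * r \<le> M * \<theta>" "0 \<le> \<theta>" "0 \<le> M" "0 \<le> r"
    and size: "real n \<le> M' * \<Lambda>" "0 \<le> \<Lambda>" "0 \<le> M'"
    and budget: "M + M' + 2 * real (card U) \<le> p\<^sup>2 * real B"
  shows "measure_pmf.prob (rep_pmf n B q) {\<rho>. W \<inter> rep_found isolate n B S \<rho> = {}} \<le> (2 * p) ^ card W"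
proof -
  define V where "V = {..<n} - W"
  define rest where "rest = {..<n} - S - U"
  \<comment> \<open>A bucket is spoiled if it is too noisy, too full, or contains another member of
    \<open>U\<close>. Noise and size are counted outside \<open>W\<close> only, so that
    \<open>Z\<close> does not depend on the hash values of \<open>W\<close>.\<close>
  define Z where "Z = (\<lambda>h. {b \<in> {..<B}. \<theta> < (\<Sum>j | j \<in> rest \<and> h j = b. (x j)\<^sup>2) * r}
      \<union> {b \<in> {..<B}. \<Lambda> < (\<Sum>j | j \<in> V \<and> h j = b. 1) * 1} \<union> h ` (U - W))"
  have finU: "finite U" using U finite_subset by auto
  have finW: "finite W" using W finU finite_subset by auto
  have VW: "V \<union> W = {..<n}" "V \<inter> W = {}" "finite V" using U W by (auto simp: V_def)
  have restV: "rest \<subseteq> V" using W by (auto simp: rest_def V_def)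
  have finR: "finite rest" by (auto simp: rest_def)
  have cardZ: "real (card (Z h)) + real (card W) \<le> p\<^sup>2 * real B" for h
  proof -
    have 1: "real (card {b \<in> {..<B}. \<theta> < (\<Sum>j | j \<in> rest \<and> h j = b. (x j)\<^sup>2) * r}) \<le> M"
      using noise finR unfolding rest_def by (intro card_heavy_buckets) auto
    have 2: "real (card {b \<in> {..<B}. \<Lambda> < (\<Sum>j | j \<in> V \<and> h j = b. 1) * 1}) \<le> M'"
    proof (intro card_heavy_buckets)
      have "card V \<le> n" using card_mono[of "{..<n}" V] VW by auto
      then show "(\<Sum>j\<in>V. 1) * 1 \<le> M' * \<Lambda>" using size by simp
    qed (use VW size in auto)
    have 3: "real (card (h ` (U - W))) \<le> real (card U)"
      using card_image_le[of "U - W" h] card_mono[of U "U - W"] finU by auto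
    have "card (Z h) \<le> card {b \<in> {..<B}. \<theta> < (\<Sum>j | j \<in> rest \<and> h j = b. (x j)\<^sup>2) * r}
      + card {b \<in> {..<B}. \<Lambda> < (\<Sum>j | j \<in> V \<and> h j = b. 1) * 1} + card (h ` (U - W))"
      unfolding Z_def by (rule order_trans[OF card_Un_le add_right_mono[OF card_Un_le]])
    moreover have "real (card W) \<le> real (card U)" using W finU by (simp add: card_mono)
    ultimately show ?thesis using 1 2 3 budget by linarith
  qed
  have given_hash: "measure_pmf.prob (Pi_pmf {..<B} undefined (\<lambda>_. q)) {c. W \<inter> rep_found isolate n B S (h, c) = {}}
      \<le> p ^ card (isolated h (Z h) W)" if h: "h \<in> set_pmf (hash_pmf {..<n} B)" for h
  proof -
    define G where "G = isolated h (Z h) W"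
    have GW: "G \<subseteq> W" by (auto simp: G_def isolated_def)
    have inj: "inj_on h G" by (auto simp: inj_on_def G_def isolated_def)
    have hB: "h i < B" if "i < n" for i using hash_pmf_less[OF _ B h] that by auto
    define bucket where "bucket = (\<lambda>b. {j. j < n \<and> h j = b} - S)"
    \<comment> \<open>Only the buckets of isolated elements are constrained; all others contribute
      the factor 1 to the product.\<close>
    define E where "E = (\<lambda>b. if b \<in> h ` G then {c. isolate c (bucket b) \<noteq> {the_inv_into G h b}} else UNIV)"
    have "measure_pmf.prob (Pi_pmf {..<B} undefined (\<lambda>_. q)) {c. W \<inter> rep_found isolate n B S (h, c) = {}}
        \<le> measure_pmf.prob (Pi_pmf {..<B} undefined (\<lambda>_. q)) (Pi {..<B} E)"
    proof (intro measure_pmf.finite_measure_mono subsetI)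
      fix c assume "c \<in> {c. W \<inter> rep_found isolate n B S (h, c) = {}}"
      then have c: "W \<inter> rep_found isolate n B S (h, c) = {}" by simp
      have "isolate (c (h i)) (bucket (h i)) \<noteq> {i}" if "i \<in> G" for i
      proof
        assume "isolate (c (h i)) (bucket (h i)) = {i}"
        moreover have "i < n" using that GW W U by auto
        ultimately have "i \<in> rep_found isolate n B S (h, c)"
          using hB by (auto simp: rep_found_def bucket_def)
        then show False using that GW c by auto
      qed
      then show "c \<in> Pi {..<B} E"
        using inj by (auto simp: E_def the_inv_into_f_f)
    qed auto
    also have "\<dots> = (\<Prod>b<B. measure_pmf.prob q (E b))"
      by (rule measure_Pi_pmf_Pi) simp
    also have "\<dots> \<le> (\<Prod>b<B. if b \<in> h ` G then p else 1)"
    proof (intro prod_mono conjI)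
      fix b assume "b \<in> {..<B}"
      have "measure_pmf.prob q {c. isolate c (bucket (h i)) \<noteq> {i}} \<le> p" if i: "i \<in> G" for i
      proof (rule cell)
        have iso: "h i \<notin> Z h" "\<And>j. j \<in> W \<Longrightarrow> j \<noteq> i \<Longrightarrow> h j \<noteq> h i"
          using i by (auto simp: G_def isolated_def)
        have iU: "i < n" "i \<notin> S" "i \<in> W" using i GW W U by auto
        show "bucket (h i) \<subseteq> {..<n}" "i \<in> bucket (h i)" "i \<in> U"
          using iU W by (auto simp: bucket_def)
        \<comment> \<open>Besides \<open>i\<close> the bucket contains only noise: other members of
          \<open>W\<close> are excluded by isolation, members of \<open>U - W\<close> by the
          definition of \<open>Z\<close>.\<close>
        have noW: "bucket (h i) - {i} \<subseteq> {j. j \<in> rest \<and> h j = h i}"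
        proof
          fix j assume "j \<in> bucket (h i) - {i}"
          then have j: "j < n" "j \<notin> S" "j \<noteq> i" "h j = h i" by (auto simp: bucket_def)
          have "j \<notin> U"
          proof
            assume "j \<in> U"
            moreover have "j \<notin> W" using iso(2) j by blast
            ultimately have "h i \<in> h ` (U - W)" using j(4) by (metis DiffI imageI)
            then show False using iso(1) by (simp add: Z_def)
          qed
          then show "j \<in> {j. j \<in> rest \<and> h j = h i}" using j by (simp add: rest_def)
        qed
        have "(\<Sum>j\<in>bucket (h i) - {i}. (x j)\<^sup>2) * r \<le> (\<Sum>j | j \<in> rest \<and> h j = h i. (x j)\<^sup>2) * r"
          using noise(4) finR by (intro mult_right_mono sum_mono2 noW) auto
        also have "\<dots> \<le> \<theta>" using iso(1) hB[OF iU(1)] by (auto simp: Z_def not_less)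
        finally show "(\<Sum>j\<in>bucket (h i) - {i}. (x j)\<^sup>2) * r \<le> \<theta>" .
        have "card (bucket (h i) - {i}) \<le> card {j. j \<in> V \<and> h j = h i}"
          using noW restV VW by (intro card_mono) auto
        moreover have "real (card {j. j \<in> V \<and> h j = h i}) \<le> \<Lambda>"
          using iso(1) hB[OF iU(1)] by (auto simp: Z_def not_less)
        ultimately show "real (card (bucket (h i) - {i})) \<le> \<Lambda>" by linarith
      qed
      then show "measure_pmf.prob q (E b) \<le> (if b \<in> h ` G then p else 1)"
        using inj by (auto simp: E_def the_inv_into_f_f)
    qed auto
    also have "\<dots> = (\<Prod>b\<in>{..<B} \<inter> h ` G. p)"
      by (rule prod.inter_restrict[symmetric]) simp
    also have "{..<B} \<inter> h ` G = h ` G"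
      using hB GW W U by fastforce
    also have "(\<Prod>b\<in>h ` G. p) = p ^ card G"
      using inj by (simp add: card_image)
    finally show ?thesis by (simp add: G_def)
  qed
  have "measure_pmf.prob (rep_pmf n B q) {\<rho>. W \<inter> rep_found isolate n B S \<rho> = {}} =
      measure_pmf.expectation (hash_pmf {..<n} B) (\<lambda>h. measure_pmf.prob
        (Pi_pmf {..<B} undefined (\<lambda>_. q)) {c. W \<inter> rep_found isolate n B S (h, c) = {}})"
    unfolding rep_pmf_def using q B by (subst prob_pair_pmf) (auto intro!: finite_set_Pi_pmf)
  also have "\<dots> \<le> measure_pmf.expectation (hash_pmf {..<n} B) (\<lambda>h. p ^ card (isolated h (Z h) W))"
    using B given_hash by (intro expectation_pmf_mono) auto
  also have "\<dots> \<le> (2 * p) ^ card W"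
    unfolding VW(1)[symmetric]
  proof (rule expectation_power_isolated)
    fix h :: "nat \<Rightarrow> nat" and w y assume w: "w \<notin> V"
    have "{j. j \<in> A \<and> (h(w := y)) j = b} = {j. j \<in> A \<and> h j = b}" if "A \<subseteq> V" for A b
      using that w by auto
    moreover have "(h(w := y)) ` (U - W) = h ` (U - W)"
    proof -
      have "U - W \<subseteq> V" using U by (auto simp: V_def)
      then show ?thesis using w by (intro image_cong) auto
    qed
    ultimately show "Z (h(w := y)) = Z h"
      unfolding Z_def using restV by (simp only: subset_refl)
  qed (use VW finW B p cardZ finU in \<open>auto simp: Z_def\<close>)
  finally show ?thesis .
qed

section \<open>Union bound over sets of coordinates missed in all repetitions\<close>

lemma binomial_le_exp:
  fixes u m R :: nat and t :: real
  assumes "real u \<le> t" "t * exp (- real R) \<le> real m" "m > 0"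
  shows "real (u choose m) \<le> exp (real m * (real R + 1))"
proof -
  \<comment> \<open>\<open>m^m / m!\<close> is a single term of the series of \<open>exp m\<close>.
    With \<open>u \<le> m * exp R\<close>, this bounds \<open>u^m / m!\<close>, and hence the
    binomial coefficient.\<close>
  have fact: "real m ^ m \<le> exp (real m) * fact m"
  proof -
    have "real m ^ m / fact m \<le> (\<Sum>i. real m ^ i /\<^sub>R fact i)"
      using sum_le_suminf[OF summable_exp_generic[of "real m"], of "{m}"]
      by (simp add: divide_inverse mult.commute)
    then show ?thesis by (simp add: exp_def field_simps)
  qed
  have "real u \<le> real m * exp (real R)"
    using assms(1,2) by (simp add: exp_minus field_simps)
  then have "real u ^ m \<le> (real m * exp (real R)) ^ m" by (intro power_mono) auto
  also have "\<dots> = real m ^ m * exp (real m * real R)"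
    by (simp add: power_mult_distrib exp_of_nat_mult)
  also have "\<dots> \<le> exp (real m) * fact m * exp (real m * real R)"
    using fact by (intro mult_right_mono) auto
  also have "\<dots> = fact m * exp (real m * (real R + 1))"
    by (simp add: exp_add algebra_simps)
  finally have "real u ^ m \<le> fact m * exp (real m * (real R + 1))" .
  moreover have "real (u choose m) * fact m \<le> real u ^ m"
    using binomial_fact_pow[of u m] by (metis of_nat_fact of_nat_le_iff of_nat_mult of_nat_power)
  ultimately have "real (u choose m) * fact m \<le> fact m * exp (real m * (real R + 1))" by linarith
  then show ?thesis by (simp add: mult.commute)
qed

text \<open>A fixed set of \<open>m\<close> coordinates is missed by all \<open>R\<close>
  independent repetitions with probability at most \<open>128^(-m*R) \<le> exp (-4*m*R)\<close>.
  There are at most \<open>exp (m*(R+1)) \<le> exp (2*m*R)\<close> such sets.\<close>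

lemma prob_stage_misses_many:
  fixes q :: "'r pmf" and t :: real and found :: "'r \<Rightarrow> nat set"
  assumes U: "finite U" "real (card U) \<le> t" and m: "m > 0" "t * exp (- real R) \<le> real m" and R: "R > 0"
    and rep: "\<And>W. W \<subseteq> U \<Longrightarrow> measure_pmf.prob q {\<rho>. W \<inter> found \<rho> = {}} \<le> (1 / 128) ^ card W"
  shows "measure_pmf.prob (Pi_pmf {..<R} undefined (\<lambda>_. q))
      {\<rho>. m \<le> card (U - (\<Union>a<R. found (\<rho> a)))} \<le> exp (- 2 * real m * real R)"
proof -
  let ?P = "Pi_pmf {..<R} undefined (\<lambda>_. q)"
  let ?WW = "{W. W \<subseteq> U \<and> card W = m}"
  have finWW: "finite ?WW" using U(1) by simp
  have one: "measure_pmf.prob ?P {\<rho>. W \<inter> (\<Union>a<R. found (\<rho> a)) = {}} \<le> (1 / 128) ^ (m * R)" if "W \<in> ?WW" for W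
  proof -
    have "{\<rho>. W \<inter> (\<Union>a<R. found (\<rho> a)) = {}} = Pi {..<R} (\<lambda>_. {\<rho>. W \<inter> found \<rho> = {}})"
      by (auto simp: Pi_def)
    then have "measure_pmf.prob ?P {\<rho>. W \<inter> (\<Union>a<R. found (\<rho> a)) = {}} =
        (\<Prod>a<R. measure_pmf.prob q {\<rho>. W \<inter> found \<rho> = {}})"
      by (simp add: measure_Pi_pmf_Pi)
    also have "\<dots> \<le> (\<Prod>a<R. (1 / 128) ^ m)"
      using rep that by (intro prod_mono) auto
    finally show ?thesis by (simp add: power_mult)
  qed
  have "measure_pmf.prob ?P {\<rho>. m \<le> card (U - (\<Union>a<R. found (\<rho> a)))}
      \<le> measure_pmf.prob ?P (\<Union>W\<in>?WW. {\<rho>. W \<inter> (\<Union>a<R. found (\<rho> a)) = {}})"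
  proof (intro measure_pmf.finite_measure_mono subsetI)
    fix \<rho> assume "\<rho> \<in> {\<rho>. m \<le> card (U - (\<Union>a<R. found (\<rho> a)))}"
    then obtain W where "W \<subseteq> U - (\<Union>a<R. found (\<rho> a))" "card W = m"
      by (metis mem_Collect_eq obtain_subset_with_card_n)
    then show "\<rho> \<in> (\<Union>W\<in>?WW. {\<rho>. W \<inter> (\<Union>a<R. found (\<rho> a)) = {}})" by auto
  qed auto
  also have "\<dots> \<le> (\<Sum>W\<in>?WW. measure_pmf.prob ?P {\<rho>. W \<inter> (\<Union>a<R. found (\<rho> a)) = {}})"
    using finWW by (intro measure_pmf.finite_measure_subadditive_finite) auto
  also have "\<dots> \<le> (\<Sum>W\<in>?WW. (1 / 128) ^ (m * R))"
    by (intro sum_mono one)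
  also have "\<dots> = real (card U choose m) * (1 / 128) ^ (m * R)"
    using n_subsets[OF U(1), of m] by simp
  also have "\<dots> \<le> exp (real m * (real R + 1)) * exp (- 4 * real (m * R))"
  proof (intro mult_mono)
    show "real (card U choose m) \<le> exp (real m * (real R + 1))"
      using U m by (intro binomial_le_exp) auto
    \<comment> \<open>The constant 128 is chosen to exceed \<open>exp 4\<close>, which is at most
      81.\<close>
    have "exp (4::real) \<le> 3 ^ 4"
      using exp_le power_mono[of "exp 1" "3::real" 4] by (simp flip: exp_of_nat_mult)
    then have "1 / 128 \<le> exp (- 4 :: real)" by (simp add: exp_minus field_simps)
    then have "(1 / 128) ^ (m * R) \<le> exp (- 4 :: real) ^ (m * R)" by (intro power_mono) auto
    then show "(1 / 128) ^ (m * R) \<le> exp (- 4 * real (m * R))"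
      by (simp add: mult.commute flip: exp_of_nat_mult)
  qed auto
  also have "\<dots> = exp (real m * (real R + 1) - 4 * (real m * real R))"
    by (simp flip: exp_add)
  also have "\<dots> \<le> exp (- 2 * real m * real R)"
  proof -
    have "real m * 1 \<le> real m * real R" using R by (intro mult_left_mono) auto
    then show ?thesis by (simp add: algebra_simps)
  qed
  finally show ?thesis .
qed

section \<open>Adaptive algorithms with a discrete state\<close>

text \<open>Outcomes \<open>2 * q\<close> and \<open>2 * q + 1\<close> of a round are decoded into
  one integer label, and the machine sees nothing but labels. Real outcomes thus enter only through
  countably many values, which settles measurability.\<close>

primrec machine_state_of_history ::
  "(nat \<Rightarrow> nat) \<Rightarrow> (nat \<Rightarrow> 'a \<Rightarrow> 'st \<Rightarrow> (nat \<Rightarrow> int) \<Rightarrow> 'st) \<Rightarrow> 'st \<Rightarrow> 'a \<Rightarrow> history \<Rightarrow> nat \<Rightarrow> 'st" where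
  "machine_state_of_history Q upd init \<omega> h 0 = init"
| "machine_state_of_history Q upd init \<omega> h (Suc r) = upd r \<omega> (machine_state_of_history Q upd init \<omega> h r)
     (\<lambda>q. if q < Q r then decode_label (h (r, 2 * q)) (h (r, 2 * q + 1)) else 0)"

text \<open>The same machine driven by \<open>x\<close> directly instead of by a history; the
  analysis uses this form.\<close>

primrec machine_state ::
  "nat \<Rightarrow> (nat \<Rightarrow> nat) \<Rightarrow> (nat \<Rightarrow> 'a \<Rightarrow> 'st \<Rightarrow> nat \<Rightarrow> nat \<Rightarrow> real) \<Rightarrow> (nat \<Rightarrow> 'a \<Rightarrow> 'st \<Rightarrow> (nat \<Rightarrow> int) \<Rightarrow> 'st)
    \<Rightarrow> 'st \<Rightarrow> (nat \<Rightarrow> real) \<Rightarrow> 'a \<Rightarrow> nat \<Rightarrow> 'st" where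
  "machine_state n Q mv upd init x \<omega> 0 = init"
| "machine_state n Q mv upd init x \<omega> (Suc r) =
     upd r \<omega> (machine_state n Q mv upd init x \<omega> r)
     (\<lambda>q. if q < Q r then decode_label
         (inner_prod n (mv r \<omega> (machine_state n Q mv upd init x \<omega> r) (2 * q)) x)
         (inner_prod n (mv r \<omega> (machine_state n Q mv upd init x \<omega> r) (2 * q + 1)) x) else 0)"

lemma run_unmeasured: "r \<le> s \<Longrightarrow> run n A x \<omega> r (s, j) = 0"
  by (induction r) auto

lemma run_past:
  "s < r \<Longrightarrow> run n A x \<omega> r (s, j) =
     (if j < round_size A s \<omega> (run n A x \<omega> s) then inner_prod n (meas_vec A s j \<omega> (run n A x \<omega> s)) x else 0)"
proof (induction r)
  case (Suc r)
  then show ?case by (cases "s = r") (auto simp: run_unmeasured)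
qed simp

lemma measurable_map_list:
  fixes f :: "'q \<Rightarrow> 'a \<Rightarrow> 'b::countable"
  assumes "\<And>q. f q \<in> measurable M (count_space UNIV)"
  shows "(\<lambda>h. map (\<lambda>q. f q h) qs) \<in> measurable M (count_space UNIV)"
proof (induction qs)
  case (Cons q qs)
  have "(\<lambda>h. f q h # l) \<in> measurable M (count_space UNIV)" for l
    by (rule measurable_compose[OF assms]) simp
  from measurable_compose_countable[OF this Cons.IH] show ?case by simp
qed simp

lemma measurable_decode_label [measurable]:
  "(\<lambda>h. decode_label (h a) (h b)) \<in> measurable history_space (count_space UNIV)"
proof -
  have "(\<lambda>h::history. h b / h a + 1 / 2) \<in> borel_measurable history_space"
    by (intro borel_measurable_add borel_measurable_divide measurable_component_singleton) auto
  from measurable_compose[OF this measurable_real_floor]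
  show ?thesis by (simp add: decode_label_def round_def)
qed

lemma measurable_machine_state_of_history:
  "(\<lambda>h. machine_state_of_history Q upd init \<omega> h r) \<in> measurable history_space (count_space UNIV)"
proof (induction r)
  case (Suc r)
  \<comment> \<open>The labels of a round are packed into a list, since lists of integers form a
    countable type whereas functions from \<open>nat\<close> to \<open>int\<close> do not.\<close>
  define labels where "labels = (\<lambda>h::history. map (\<lambda>q. decode_label (h (r, 2 * q)) (h (r, 2 * q + 1))) [0..<Q r])"
  define next_state where "next_state = (\<lambda>ls h. upd r \<omega> (machine_state_of_history Q upd init \<omega> h r)
      (\<lambda>q. if q < Q r then ls ! q else (0::int)))"
  have labels: "labels \<in> measurable history_space (count_space UNIV)"
    unfolding labels_def by (rule measurable_map_list) (rule measurable_decode_label)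
  have "(\<lambda>h. next_state ls h) \<in> measurable history_space (count_space UNIV)" for ls
    unfolding next_state_def by (rule measurable_compose[OF Suc.IH]) simp
  from measurable_compose_countable[OF this labels]
  have "(\<lambda>h. next_state (labels h) h) \<in> measurable history_space (count_space UNIV)" .
  moreover have "machine_state_of_history Q upd init \<omega> h (Suc r) = next_state (labels h) h" for h
    unfolding next_state_def labels_def machine_state_of_history.simps
    by (intro arg_cong[where f="upd r \<omega> _"] ext) simp
  ultimately show ?case by simp
qed simp

section \<open>Encoding a discrete distribution as a seed space\<close>

definition natural_seeds :: "(nat \<Rightarrow> real) set" where
  "natural_seeds = range (\<lambda>m _. real m)"

text \<open>The support of \<open>p\<close> is enumerated and the number is stored as a constant
  function, to obtain seeds of type \<open>nat \<Rightarrow> real\<close>. On a countable seed space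
  with all sets measurable, joint measurability reduces to measurability in the history for each
  fixed seed.\<close>

definition seed_measure :: "'a pmf \<Rightarrow> (nat \<Rightarrow> real) measure" where
  "seed_measure p = distr (measure_pmf p) (count_space natural_seeds) (\<lambda>a _. real (to_nat_on (set_pmf p) a))"

definition decode_seed :: "'a pmf \<Rightarrow> (nat \<Rightarrow> real) \<Rightarrow> 'a" where
  "decode_seed p \<omega> = from_nat_into (set_pmf p) (nat \<lfloor>\<omega> 0\<rfloor>)"

lemma sets_seed_measure: "sets (seed_measure p) = sets (count_space natural_seeds)"
  by (simp add: seed_measure_def)

lemma space_seed_measure: "space (seed_measure p) = natural_seeds"
  by (simp add: seed_measure_def)

lemma prob_space_seed_measure: "prob_space (seed_measure p)"
  unfolding seed_measure_def by (rule measure_pmf.prob_space_distr) (auto simp: natural_seeds_def)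

lemma measure_seed_measure:
  "measure (seed_measure p) {\<omega> \<in> space (seed_measure p). P (decode_seed p \<omega>)} = measure_pmf.prob p {a. P a}"
proof -
  let ?e = "\<lambda>a (_::nat). real (to_nat_on (set_pmf p) a)"
  have "measure (seed_measure p) {\<omega> \<in> space (seed_measure p). P (decode_seed p \<omega>)}
      = measure_pmf.prob p (?e -` {\<omega> \<in> natural_seeds. P (decode_seed p \<omega>)} \<inter> space (measure_pmf p))"
    unfolding space_seed_measure unfolding seed_measure_def
    by (rule measure_distr) (auto simp: natural_seeds_def)
  also have "?e -` {\<omega> \<in> natural_seeds. P (decode_seed p \<omega>)} \<inter> space (measure_pmf p) =
      {a. P (from_nat_into (set_pmf p) (to_nat_on (set_pmf p) a))}"
    by (auto simp: natural_seeds_def decode_seed_def)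
  also have "measure_pmf.prob p \<dots> = measure_pmf.prob p (\<dots> \<inter> set_pmf p)"
    by (simp add: measure_Int_set_pmf)
  also have "{a. P (from_nat_into (set_pmf p) (to_nat_on (set_pmf p) a))} \<inter> set_pmf p = {a. P a} \<inter> set_pmf p"
    by (auto simp: countable_set_pmf)
  also have "measure_pmf.prob p \<dots> = measure_pmf.prob p {a. P a}"
    by (simp add: measure_Int_set_pmf)
  finally show ?thesis .
qed

lemma measurable_seed_measure_pair:
  assumes "\<And>\<omega>. f \<omega> \<in> measurable N K"
  shows "(\<lambda>(\<omega>, h). f \<omega> h) \<in> measurable (seed_measure p \<Otimes>\<^sub>M N) K"
proof -
  have "(\<lambda>(\<omega>, h). f \<omega> h) \<in> measurable (count_space natural_seeds \<Otimes>\<^sub>M N) K"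
    using assms by (intro measurable_pair_measure_countable1) (auto simp: natural_seeds_def)
  then show ?thesis
    using measurable_cong_sets[OF sets_pair_measure_cong[OF sets_seed_measure refl] refl] by blast
qed

text \<open>The rounds before \<open>N\<close> run the machine. Round \<open>N\<close> reads every
  coordinate of the output set exactly, with one unit vector each, and all other coordinates are
  estimated by 0. The squared error is therefore the energy outside the output set.\<close>

lemma machine_algorithm_exists:
  fixes p :: "'a pmf" and out :: "'st \<Rightarrow> nat set"
  assumes out: "\<And>x \<omega>. out (machine_state n Q mv upd init x \<omega> N) \<subseteq> {..<n}"
    and card_out: "\<And>x \<omega>. card (out (machine_state n Q mv upd init x \<omega> N)) \<le> M"
  obtains A :: "(nat \<Rightarrow> real) adaptive_algorithm" where
    "randomized_algorithm n A" "num_rounds A = Suc N"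
    "\<And>x \<omega>. \<omega> \<in> space (seed_space A) \<Longrightarrow> num_measurements n A x \<omega> \<le> (\<Sum>r<N. 2 * Q r) + M"
    "\<And>\<epsilon> x z. measure (seed_space A) (failure_event n A \<epsilon> x z) = measure_pmf.prob p
       {\<omega>. \<not> (\<Sum>i\<in>{..<n} - out (machine_state n Q mv upd init x \<omega> N). (x i)\<^sup>2) \<le> (1 + \<epsilon>) * (norm2 n z)\<^sup>2}"
proof -
  define st where "st = (\<lambda>\<omega> h r. machine_state_of_history Q upd init (decode_seed p \<omega>) h r)"
  define A where "A = \<lparr>seed_space = seed_measure p, num_rounds = Suc N,
    round_size = (\<lambda>r \<omega> h. if r < N then 2 * Q r else card (out (st \<omega> h N))),
    meas_vec = (\<lambda>r j \<omega> h. if r < N then mv r (decode_seed p \<omega>) (st \<omega> h r) j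
      else (\<lambda>i. if i = from_nat_into (out (st \<omega> h N)) j then 1 else 0)),
    estimate = (\<lambda>\<omega> h i. if i \<in> out (st \<omega> h N) then h (N, to_nat_on (out (st \<omega> h N)) i) else 0)\<rparr>"
  have A_simps: "seed_space A = seed_measure p" "num_rounds A = Suc N"
    "round_size A = (\<lambda>r \<omega> h. if r < N then 2 * Q r else card (out (st \<omega> h N)))"
    "meas_vec A = (\<lambda>r j \<omega> h. if r < N then mv r (decode_seed p \<omega>) (st \<omega> h r) j
      else (\<lambda>i. if i = from_nat_into (out (st \<omega> h N)) j then 1 else 0))"
    "estimate A = (\<lambda>\<omega> h i. if i \<in> out (st \<omega> h N) then h (N, to_nat_on (out (st \<omega> h N)) i) else 0)"
    by (simp_all add: A_def)
  have st: "(\<lambda>h. st \<omega> h r) \<in> measurable history_space (count_space UNIV)" for \<omega> r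
    unfolding st_def by (rule measurable_machine_state_of_history)
  have rand: "randomized_algorithm n A"
    unfolding randomized_algorithm_def A_simps(1)
  proof (intro conjI allI impI measurable_seed_measure_pair prob_space_seed_measure)
    fix r \<omega>
    show "(\<lambda>h. round_size A r \<omega> h) \<in> measurable history_space (count_space UNIV)"
      unfolding A_simps by (cases "r < N") (auto intro: measurable_compose[OF st])
  next
    fix r j i \<omega>
    show "(\<lambda>h. meas_vec A r j \<omega> h i) \<in> borel_measurable history_space"
    proof (cases "r < N")
      case True
      have "(\<lambda>h. mv r (decode_seed p \<omega>) (st \<omega> h r) j i) \<in> borel_measurable history_space"
        by (rule measurable_compose[OF st]) simp
      then show ?thesis using True by (simp add: A_simps)
    next
      case False
      have "(\<lambda>h. (if i = from_nat_into (out (st \<omega> h N)) j then 1 else 0) :: real) \<in> borel_measurable history_space"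
        by (rule measurable_compose[OF st]) simp
      then show ?thesis using False by (simp add: A_simps)
    qed
  next
    fix i \<omega>
    \<comment> \<open>Which entry of the history is looked up depends on the state, but there are
      only countably many possibilities.\<close>
    have "(\<lambda>h::history. if b then h (N, j) else 0) \<in> borel_measurable history_space" for b j
      by (cases b) (auto intro: measurable_component_singleton)
    then have "(\<lambda>h::history. case bj of (b, j) \<Rightarrow> if b then h (N, j) else 0) \<in> borel_measurable history_space"
      for bj by (cases bj) simp
    moreover have "(\<lambda>h. (i \<in> out (st \<omega> h N), to_nat_on (out (st \<omega> h N)) i)) \<in> measurable history_space (count_space UNIV)"
      by (rule measurable_compose[OF st]) simp
    ultimately have "(\<lambda>h. case (i \<in> out (st \<omega> h N), to_nat_on (out (st \<omega> h N)) i) of (b, j) \<Rightarrow>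
        if b then h (N, j) else 0) \<in> borel_measurable history_space"
      by (rule measurable_compose_countable)
    then show "(\<lambda>h. estimate A \<omega> h i) \<in> borel_measurable history_space"
      by (simp add: A_simps)
  qed
  \<comment> \<open>History entries are never overwritten, so any history of at least
    \<open>r\<close> rounds determines the state after \<open>r\<close> rounds.\<close>
  have state: "st \<omega> (run n A x \<omega> r') r = machine_state n Q mv upd init x (decode_seed p \<omega>) r"
    if "r \<le> r'" "r \<le> N" for x \<omega> r r'
    using that
  proof (induction r arbitrary: r')
    case 0
    then show ?case by (simp add: st_def)
  next
    case (Suc r)
    have IH: "st \<omega> (run n A x \<omega> r'') r = machine_state n Q mv upd init x (decode_seed p \<omega>) r" if "r \<le> r''" for r''
      using Suc that by auto
    have "run n A x \<omega> r' (r, j) = inner_prod n (mv r (decode_seed p \<omega>)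
        (machine_state n Q mv upd init x (decode_seed p \<omega>) r) j) x" if "j < 2 * Q r" for j
      using Suc.prems that IH by (subst run_past) (auto simp: A_simps)
    then show ?case
      using IH[of r'] Suc.prems unfolding st_def machine_state_of_history.simps machine_state.simps
      by (intro arg_cong2[where f="upd r (decode_seed p \<omega>)"] ext) auto
  qed
  have count: "num_measurements n A x \<omega> \<le> (\<Sum>r<N. 2 * Q r) + M" for x \<omega>
    using state[of N N \<omega> x] card_out[of x "decode_seed p \<omega>"]
    by (simp add: num_measurements_def A_simps)
  have recovered: "recovered n A x \<omega> i =
      (if i \<in> out (machine_state n Q mv upd init x (decode_seed p \<omega>) N) then x i else 0)" if "i < n" for x \<omega> i
  proof -
    define S where "S = out (machine_state n Q mv upd init x (decode_seed p \<omega>) N)"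
    have S: "out (st \<omega> (run n A x \<omega> (Suc N)) N) = S" "out (st \<omega> (run n A x \<omega> N) N) = S"
      using state[of N "Suc N" \<omega> x] state[of N N \<omega> x] by (simp_all add: S_def del: run.simps)
    have finS: "finite S" using out finite_subset unfolding S_def by blast
    have "run n A x \<omega> (Suc N) (N, to_nat_on S i) = x i" if "i \<in> S"
    proof -
      have "to_nat_on S i < card S"
        using bij_betwE[OF to_nat_on_finite[OF finS]] that by auto
      then have "run n A x \<omega> (Suc N) (N, to_nat_on S i) = inner_prod n (\<lambda>i'. if i' = i then 1 else 0) x"
        using that S finS by (subst run_past) (simp_all add: A_simps countable_finite)
      also have "\<dots> = x i"
        using \<open>i < n\<close> by (simp add: inner_prod_def if_distrib[of "\<lambda>t. t * _"] cong: if_cong)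
      finally show ?thesis .
    qed
    then show ?thesis by (simp add: recovered_def A_simps S flip: S_def del: run.simps)
  qed
  have error: "(norm2 n (\<lambda>i. x i - recovered n A x \<omega> i))\<^sup>2 =
      (\<Sum>i\<in>{..<n} - out (machine_state n Q mv upd init x (decode_seed p \<omega>) N). (x i)\<^sup>2)" for x \<omega>
  proof -
    let ?S = "out (machine_state n Q mv upd init x (decode_seed p \<omega>) N)"
    have "(norm2 n (\<lambda>i. x i - recovered n A x \<omega> i))\<^sup>2 = (\<Sum>i<n. (x i - recovered n A x \<omega> i)\<^sup>2)"
      by (simp add: L2_set_def sum_nonneg)
    also have "\<dots> = (\<Sum>i<n. if i \<in> ?S then 0 else (x i)\<^sup>2)"
      by (intro sum.cong) (auto simp: recovered)
    also have "\<dots> = (\<Sum>i\<in>{..<n} - ?S. (x i)\<^sup>2)"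
      by (simp add: sum.If_cases Diff_eq)
    finally show ?thesis .
  qed
  have "measure (seed_space A) (failure_event n A \<epsilon> x z) = measure_pmf.prob p
       {\<omega>. \<not> (\<Sum>i\<in>{..<n} - out (machine_state n Q mv upd init x \<omega> N). (x i)\<^sup>2) \<le> (1 + \<epsilon>) * (norm2 n z)\<^sup>2}" for \<epsilon> x z
    unfolding failure_event_def error A_simps(1) by (rule measure_seed_measure)
  then show ?thesis
    using rand count A_simps(2) by (intro that) auto
qed

section \<open>The multi-stage algorithm\<close>

type_synonym cell_seed = "nat \<Rightarrow> (nat \<Rightarrow> real) \<times> (nat \<Rightarrow> nat)"
type_synonym rep_seed = "(nat \<Rightarrow> nat) \<times> (nat \<Rightarrow> cell_seed)"
type_synonym full_seed = "nat \<Rightarrow> nat \<Rightarrow> rep_seed"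

text \<open>Every stage takes \<open>L\<close> rounds, and stage \<open>s\<close> uses
  \<open>R s\<close> repetitions with \<open>B s\<close> buckets. Round \<open>r\<close> is round
  \<open>r mod L\<close> of stage \<open>r div L\<close>; cell \<open>q\<close> is bucket
  \<open>q mod B s\<close> of repetition \<open>q div B s\<close>.\<close>

locale schedule =
  fixes n L :: nat and R B :: "nat \<Rightarrow> nat"
  assumes L_pos: "L > 0"
begin

definition cells :: "nat \<Rightarrow> nat" where
  "cells r = R (r div L) * B (r div L)"

definition bucket :: "nat \<Rightarrow> full_seed \<Rightarrow> nat \<Rightarrow> nat set" where
  "bucket s \<omega> q = {j. j < n \<and> fst (\<omega> s (q div B s)) j = q mod B s}"

definition cell_seed_of :: "nat \<Rightarrow> full_seed \<Rightarrow> nat \<Rightarrow> cell_seed" where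
  "cell_seed_of s \<omega> q = snd (\<omega> s (q div B s)) (q mod B s)"

text \<open>
  A state consists of the coordinates found in the completed stages and, for every cell \<open>q\<close> of
  the current stage, a filter \<open>F q\<close> for its remaining candidates.
\<close>

definition candidates :: "nat \<Rightarrow> full_seed \<Rightarrow> nat set \<times> (nat \<Rightarrow> nat set) \<Rightarrow> nat \<Rightarrow> nat set" where
  "candidates r \<omega> st q = (bucket (r div L) \<omega> q - fst st) \<inter> snd st q"

definition query :: "nat \<Rightarrow> full_seed \<Rightarrow> nat set \<times> (nat \<Rightarrow> nat set) \<Rightarrow> nat \<Rightarrow> nat \<Rightarrow> real" where
  "query r \<omega> st j i = (let q = j div 2; c = cell_seed_of (r div L) \<omega> q (r mod L) in
     if i \<in> candidates r \<omega> st q then fst c i * (if even j then 1 else real (snd c i)) else 0)"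

definition update ::
  "nat \<Rightarrow> full_seed \<Rightarrow> nat set \<times> (nat \<Rightarrow> nat set) \<Rightarrow> (nat \<Rightarrow> int) \<Rightarrow> nat set \<times> (nat \<Rightarrow> nat set)" where
  "update r \<omega> st lab =
     (let F = (\<lambda>q. {i \<in> candidates r \<omega> st q. int (snd (cell_seed_of (r div L) \<omega> q (r mod L)) i) = lab q})
      in if Suc r mod L = 0 then (fst st \<union> {i. \<exists>q<cells r. F q = {i}}, \<lambda>_. UNIV) else (fst st, F))"

abbreviation state :: "(nat \<Rightarrow> real) \<Rightarrow> full_seed \<Rightarrow> nat \<Rightarrow> nat set \<times> (nat \<Rightarrow> nat set)" where
  "state \<equiv> machine_state n cells query update ({}, \<lambda>_. UNIV)"

definition stage_found :: "(nat \<Rightarrow> real) \<Rightarrow> nat \<Rightarrow> (nat \<Rightarrow> rep_seed) \<Rightarrow> nat set \<Rightarrow> nat set" where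
  "stage_found x s \<rho> S = (\<Union>a<R s. rep_found (\<lambda>c. cell_run x c [0..<L]) n (B s) S (\<rho> a))"

primrec found :: "(nat \<Rightarrow> real) \<Rightarrow> full_seed \<Rightarrow> nat \<Rightarrow> nat set" where
  "found x \<omega> 0 = {}"
| "found x \<omega> (Suc s) = found x \<omega> s \<union> stage_found x s (\<omega> s) (found x \<omega> s)"

lemma cell_run_subset: "cell_run x c ls C \<subseteq> C"
proof (induction ls arbitrary: C)
  case (Cons l ls)
  have "cell_run x c (l # ls) C = cell_run x c ls (cell_step x (c l) C)" by (simp add: cell_run_def)
  also have "\<dots> \<subseteq> cell_step x (c l) C" by (rule Cons.IH)
  also have "\<dots> \<subseteq> C" by (auto simp: cell_step_def)
  finally show ?case .
qed (simp add: cell_run_def)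

lemma cell_run_snoc: "cell_run x c (ls @ [l]) C = cell_step x (c l) (cell_run x c ls C)"
  by (simp add: cell_run_def)

text \<open>Links the machine to the analysis: filtering by labels decoded from the two queries of a
  cell is one \<open>cell_step\<close>.\<close>

lemma update_labels:
  assumes "q < cells r"
  shows "{i \<in> candidates r \<omega> st q. int (snd (cell_seed_of (r div L) \<omega> q (r mod L)) i) =
      (if q < cells r then decode_label (inner_prod n (query r \<omega> st (2 * q)) x)
         (inner_prod n (query r \<omega> st (2 * q + 1)) x) else 0)} =
    cell_step x (cell_seed_of (r div L) \<omega> q (r mod L)) (candidates r \<omega> st q)"
proof -
  let ?C = "candidates r \<omega> st q" and ?c = "cell_seed_of (r div L) \<omega> q (r mod L)"
  have sub: "?C \<subseteq> {..<n}" by (auto simp: candidates_def bucket_def)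
  have *: "(\<Sum>i<n. (if i \<in> ?C then f i else 0) * x i) = (\<Sum>i\<in>?C. f i * x i)" for f
    using sub by (simp add: if_distrib[of "\<lambda>t. t * _"] sum.If_cases Int_absorb1 cong: if_cong)
  have "inner_prod n (query r \<omega> st (2 * q)) x = (\<Sum>i\<in>?C. fst ?c i * x i)"
  proof -
    have "query r \<omega> st (2 * q) = (\<lambda>i. if i \<in> ?C then fst ?c i else 0)"
      by (rule ext) (simp add: query_def Let_def)
    then show ?thesis using *[of "fst ?c"] by (simp only: inner_prod_def)
  qed
  moreover have "inner_prod n (query r \<omega> st (2 * q + 1)) x = (\<Sum>i\<in>?C. fst ?c i * real (snd ?c i) * x i)"
  proof -
    have "query r \<omega> st (2 * q + 1) = (\<lambda>i. if i \<in> ?C then fst ?c i * real (snd ?c i) else 0)"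
      by (rule ext) (simp add: query_def Let_def)
    then show ?thesis using *[of "\<lambda>i. fst ?c i * real (snd ?c i)"] by (simp only: inner_prod_def)
  qed
  ultimately show ?thesis using assms by (simp add: cell_step_def)
qed

lemma state_within_stage:
  assumes "state x \<omega> (s * L) = (S, \<lambda>_. UNIV)" "l < L"
  shows "fst (state x \<omega> (s * L + l)) = S \<and> (\<forall>q < R s * B s.
    candidates (s * L + l) \<omega> (state x \<omega> (s * L + l)) q =
      cell_run x (cell_seed_of s \<omega> q) [0..<l] (bucket s \<omega> q - S))"
  using assms(2)
proof (induction l)
  case 0
  then show ?case using assms(1) L_pos by (simp add: candidates_def cell_run_def)
next
  case (Suc l)
  let ?r = "s * L + l"
  have dm: "?r div L = s" "?r mod L = l" "Suc ?r div L = s" "Suc ?r mod L = Suc l"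
    using Suc.prems by (auto simp: div_nat_eqI)
  have IH: "fst (state x \<omega> ?r) = S"
    "\<And>q. q < R s * B s \<Longrightarrow> candidates ?r \<omega> (state x \<omega> ?r) q = cell_run x (cell_seed_of s \<omega> q) [0..<l] (bucket s \<omega> q - S)"
    using Suc by auto
  have fstS: "fst (state x \<omega> (Suc ?r)) = S"
    using dm IH by (simp add: update_def)
  moreover have "candidates (Suc ?r) \<omega> (state x \<omega> (Suc ?r)) q =
      cell_run x (cell_seed_of s \<omega> q) [0..<Suc l] (bucket s \<omega> q - S)" if q: "q < R s * B s" for q
  proof -
    have "snd (state x \<omega> (Suc ?r)) q = {i \<in> candidates ?r \<omega> (state x \<omega> ?r) q.
      int (snd (cell_seed_of (?r div L) \<omega> q (?r mod L)) i) =
      (if q < cells ?r then decode_label (inner_prod n (query ?r \<omega> (state x \<omega> ?r) (2 * q)) x)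
         (inner_prod n (query ?r \<omega> (state x \<omega> ?r) (2 * q + 1)) x) else 0)}"
      using dm by (simp only: machine_state.simps update_def Let_def) simp
    also have "\<dots> = cell_step x (cell_seed_of (?r div L) \<omega> q (?r mod L)) (candidates ?r \<omega> (state x \<omega> ?r) q)"
      using q dm by (intro update_labels) (simp add: cells_def)
    also have "\<dots> = cell_run x (cell_seed_of s \<omega> q) [0..<Suc l] (bucket s \<omega> q - S)"
      using IH(2)[OF q] dm by (simp add: cell_run_snoc)
    finally have "snd (state x \<omega> (Suc ?r)) q = cell_run x (cell_seed_of s \<omega> q) [0..<Suc l] (bucket s \<omega> q - S)" .
    moreover have "candidates (Suc ?r) \<omega> (state x \<omega> (Suc ?r)) q = (bucket s \<omega> q - S) \<inter> snd (state x \<omega> (Suc ?r)) q"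
      using fstS dm by (simp only: candidates_def)
    ultimately show ?thesis
      using cell_run_subset[of x "cell_seed_of s \<omega> q" "[0..<Suc l]" "bucket s \<omega> q - S"] by (simp only: Int_absorb1)
  qed
  ultimately show ?case by simp
qed

lemma stage_found_cells:
  "{i. \<exists>q < R s * B s. cell_run x (cell_seed_of s \<omega> q) [0..<L] (bucket s \<omega> q - S) = {i}} =
     stage_found x s (\<omega> s) S"
proof (intro equalityI subsetI)
  fix i assume "i \<in> {i. \<exists>q < R s * B s. cell_run x (cell_seed_of s \<omega> q) [0..<L] (bucket s \<omega> q - S) = {i}}"
  then obtain q where q: "q < R s * B s" "cell_run x (cell_seed_of s \<omega> q) [0..<L] (bucket s \<omega> q - S) = {i}"
    by blast
  have "B s > 0" using q(1) by (cases "B s") auto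
  then have "q div B s < R s" "q mod B s < B s"
    using q(1) by (auto simp: less_mult_imp_div_less)
  then show "i \<in> stage_found x s (\<omega> s) S"
    using q(2) by (auto simp: stage_found_def rep_found_def cell_seed_of_def bucket_def)
next
  fix i assume "i \<in> stage_found x s (\<omega> s) S"
  then obtain a b where ab: "a < R s" "b < B s"
    "cell_run x (snd (\<omega> s a) b) [0..<L] ({j. j < n \<and> fst (\<omega> s a) j = b} - S) = {i}"
    by (auto simp: stage_found_def rep_found_def)
  define q where "q = a * B s + b"
  have dm: "q div B s = a" "q mod B s = b" using ab by (auto simp: q_def div_nat_eqI)
  have "q < Suc a * B s" using ab by (simp add: q_def)
  also have "\<dots> \<le> R s * B s" using ab by (intro mult_right_mono) auto
  finally show "i \<in> {i. \<exists>q < R s * B s. cell_run x (cell_seed_of s \<omega> q) [0..<L] (bucket s \<omega> q - S) = {i}}"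
    using ab(3) dm by (auto simp: cell_seed_of_def bucket_def)
qed

lemma state_stage_end: "state x \<omega> (s * L) = (found x \<omega> s, \<lambda>_. UNIV)"
proof (induction s)
  case (Suc s)
  \<comment> \<open>The last round of a stage is treated apart, because there \<open>update\<close>
    collects the singletons and resets the filters instead of storing them.\<close>
  define l where "l = L - 1"
  let ?r = "s * L + l" and ?S = "found x \<omega> s"
  have l: "l < L" "Suc l = L" using L_pos by (auto simp: l_def)
  have dm: "?r div L = s" "?r mod L = l" using l by (auto simp: div_nat_eqI)
  have sm: "Suc ?r mod L = 0" using l by (metis add_Suc_right mod_mult_self2_is_0 mult_Suc add.commute mult.commute)
  have in_stage: "fst (state x \<omega> ?r) = ?S"
    "\<And>q. q < R s * B s \<Longrightarrow> candidates ?r \<omega> (state x \<omega> ?r) q = cell_run x (cell_seed_of s \<omega> q) [0..<l] (bucket s \<omega> q - ?S)"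
    using state_within_stage[OF Suc l(1)] by auto
  define F where "F = (\<lambda>q. {i \<in> candidates ?r \<omega> (state x \<omega> ?r) q.
      int (snd (cell_seed_of (?r div L) \<omega> q (?r mod L)) i) =
      (if q < cells ?r then decode_label (inner_prod n (query ?r \<omega> (state x \<omega> ?r) (2 * q)) x)
         (inner_prod n (query ?r \<omega> (state x \<omega> ?r) (2 * q + 1)) x) else 0)})"
  have "F q = cell_run x (cell_seed_of s \<omega> q) [0..<L] (bucket s \<omega> q - ?S)" if q: "q < R s * B s" for q
  proof -
    have "F q = cell_step x (cell_seed_of (?r div L) \<omega> q (?r mod L)) (candidates ?r \<omega> (state x \<omega> ?r) q)"
      unfolding F_def using q dm by (intro update_labels) (simp add: cells_def)
    also have "\<dots> = cell_run x (cell_seed_of s \<omega> q) ([0..<l] @ [l]) (bucket s \<omega> q - ?S)"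
      using in_stage(2)[OF q] dm by (simp add: cell_run_snoc)
    also have "[0..<l] @ [l] = [0..<L]" using l by (metis upt_Suc_append zero_le)
    finally show ?thesis .
  qed
  then have "{i. \<exists>q<cells ?r. F q = {i}} =
      {i. \<exists>q < R s * B s. cell_run x (cell_seed_of s \<omega> q) [0..<L] (bucket s \<omega> q - ?S) = {i}}"
    using dm by (auto simp: cells_def)
  also have "\<dots> = stage_found x s (\<omega> s) ?S" by (rule stage_found_cells)
  finally have new: "{i. \<exists>q<cells ?r. F q = {i}} = stage_found x s (\<omega> s) ?S" .
  have "Suc s * L = Suc ?r" using l by simp
  then have "state x \<omega> (Suc s * L) = state x \<omega> (Suc ?r)" by (simp only:)
  also have "\<dots> = (fst (state x \<omega> ?r) \<union> {i. \<exists>q<cells ?r. F q = {i}}, \<lambda>_. UNIV)"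
    using sm by (simp only: machine_state.simps update_def Let_def F_def if_True refl)
  finally show ?case using new in_stage(1) by simp
qed simp

lemma stage_found_subset: "stage_found x s \<rho> S \<subseteq> {..<n} - S"
proof
  fix i assume "i \<in> stage_found x s \<rho> S"
  then obtain a b where "cell_run x (snd (\<rho> a) b) [0..<L] ({j. j < n \<and> fst (\<rho> a) j = b} - S) = {i}"
    by (auto simp: stage_found_def rep_found_def)
  then show "i \<in> {..<n} - S"
    using cell_run_subset[of x "snd (\<rho> a) b" "[0..<L]" "{j. j < n \<and> fst (\<rho> a) j = b} - S"] by auto
qed

lemma found_subset: "found x \<omega> s \<subseteq> {..<n}"
  using stage_found_subset by (induction s) (simp, fastforce)

lemma card_stage_found: "card (stage_found x s (\<omega> s) S) \<le> R s * B s"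
proof -
  let ?f = "\<lambda>q. the_elem (cell_run x (cell_seed_of s \<omega> q) [0..<L] (bucket s \<omega> q - S))"
  have "stage_found x s (\<omega> s) S \<subseteq> ?f ` {..<R s * B s}"
    unfolding stage_found_cells[symmetric] by (auto simp: image_iff) (metis lessThan_iff the_elem_eq)
  then have "card (stage_found x s (\<omega> s) S) \<le> card (?f ` {..<R s * B s})" by (intro card_mono) auto
  also have "\<dots> \<le> R s * B s" using card_image_le[of "{..<R s * B s}" ?f] by simp
  finally show ?thesis .
qed

lemma card_found: "card (found x \<omega> s) \<le> (\<Sum>s'<s. R s' * B s')"
proof (induction s)
  case (Suc s)
  have "card (found x \<omega> (Suc s)) \<le> card (found x \<omega> s) + card (stage_found x s (\<omega> s) (found x \<omega> s))"
    by (simp add: card_Un_le)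
  then show ?case using Suc card_stage_found[of x s \<omega> "found x \<omega> s"] by simp
qed simp

text \<open>Each cell costs two measurements in each of the \<open>L\<close> rounds of its stage,
  and yields at most one coordinate to be read in the extra final round; hence the factor
  \<open>2 * L + 1\<close>.\<close>

lemma algorithm_exists:
  fixes p :: "full_seed pmf" and J :: nat
  obtains A :: "(nat \<Rightarrow> real) adaptive_algorithm" where
    "randomized_algorithm n A" "num_rounds A = Suc (J * L)"
    "\<And>x \<omega>. \<omega> \<in> space (seed_space A) \<Longrightarrow> num_measurements n A x \<omega> \<le> (2 * L + 1) * (\<Sum>s<J. R s * B s)"
    "\<And>\<epsilon> x z. measure (seed_space A) (failure_event n A \<epsilon> x z) = measure_pmf.prob p
       {\<omega>. \<not> (\<Sum>i\<in>{..<n} - found x \<omega> J. (x i)\<^sup>2) \<le> (1 + \<epsilon>) * (norm2 n z)\<^sup>2}"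
proof -
  have sum_cells: "(\<Sum>r<J * L. 2 * cells r) = 2 * L * (\<Sum>s<J. R s * B s)"
  proof -
    have "(\<Sum>r<J * L. 2 * cells r) = (\<Sum>s<J. \<Sum>r = s * L..<s * L + L. 2 * cells r)"
      by (rule sum.nat_group[symmetric])
    also have "\<dots> = (\<Sum>s<J. \<Sum>r = s * L..<s * L + L. 2 * (R s * B s))"
    proof (intro sum.cong refl)
      fix s r assume "r \<in> {s * L..<s * L + L}"
      then have "r div L = s" by (auto intro!: div_nat_eqI simp: mult.commute)
      then show "2 * cells r = 2 * (R s * B s)" by (simp add: cells_def)
    qed
    also have "\<dots> = 2 * L * (\<Sum>s<J. R s * B s)" by (simp add: sum_distrib_left mult_ac)
    finally show ?thesis .
  qed
  have final: "fst (state x \<omega> (J * L)) = found x \<omega> J" for x \<omega>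
    by (simp add: state_stage_end)
  have sub: "fst (state x \<omega> (J * L)) \<subseteq> {..<n}" for x \<omega>
    unfolding final by (rule found_subset)
  have card: "card (fst (state x \<omega> (J * L))) \<le> (\<Sum>s<J. R s * B s)" for x \<omega>
    unfolding final by (rule card_found)
  show ?thesis
  proof (rule machine_algorithm_exists[where out=fst and p=p, OF sub card])
    fix A :: "(nat \<Rightarrow> real) adaptive_algorithm"
    assume A: "randomized_algorithm n A" "num_rounds A = Suc (J * L)"
      "\<And>x \<omega>. \<omega> \<in> space (seed_space A) \<Longrightarrow>
         num_measurements n A x \<omega> \<le> (\<Sum>r<J * L. 2 * cells r) + (\<Sum>s<J. R s * B s)"
      "\<And>\<epsilon> x z. measure (seed_space A) (failure_event n A \<epsilon> x z) = measure_pmf.prob p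
         {\<omega>. \<not> (\<Sum>i\<in>{..<n} - fst (state x \<omega> (J * L)). (x i)\<^sup>2) \<le> (1 + \<epsilon>) * (norm2 n z)\<^sup>2}"
    have count: "num_measurements n A x \<omega> \<le> (2 * L + 1) * (\<Sum>s<J. R s * B s)" if "\<omega> \<in> space (seed_space A)" for x \<omega>
      using A(3)[OF that, of x] unfolding sum_cells by (simp add: algebra_simps)
    show ?thesis by (rule that[OF A(1,2) count A(4)[unfolded final]])
  qed
qed

end

section \<open>Growing label alphabets and the failure probability of one cell\<close>

definition alphabet :: "nat \<Rightarrow> nat \<Rightarrow> nat" where
  "alphabet z l = z ^ (2 * 2 ^ (l div 4))"

text \<open>The inverse of the noise-to-signal ratio tolerated before round \<open>l\<close>. With
  \<open>M = 2 ^ (l div 4)\<close> the exponents run through 4M, 5M, 6M, 7M and then 8M, the first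
  exponent of the next block; so four rounds prepare for squaring the alphabet.\<close>

definition noise_weight :: "nat \<Rightarrow> nat \<Rightarrow> real" where
  "noise_weight z l = 64 * real z ^ (2 ^ (l div 4) * (4 + l mod 4))"

text \<open>The alphabet is \<open>z^(2*M)\<close> but the exponent of the weight rises by only
  \<open>M\<close>, so dividing leaves a spare factor \<open>z^M \<ge> 2\<close>. Each of the two
  terms then takes at most half of the right-hand side.\<close>

lemma noise_weight_step:
  assumes z: "z \<ge> 2"
  shows "32 * (real (alphabet z l))\<^sup>2 + noise_weight z (Suc l) / alphabet z l \<le> noise_weight z l"
proof -
  define M j where "M = (2::nat) ^ (l div 4)" and "j = l mod 4"
  have M: "M \<ge> 1" by (simp add: M_def)
  have D: "real (alphabet z l) = real z ^ (2 * M)" by (simp add: alphabet_def M_def)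
  have zp: "real z > 0" "real z \<ge> 2" using z by auto
  obtain e where e: "noise_weight z (Suc l) = 64 * real z ^ (2 * M + e)" "e + M \<le> M * (4 + j)"
  proof (cases "j = 3")
    case True
    have "Suc l div 4 = Suc (l div 4)" "Suc l mod 4 = 0"
      using True by (simp_all add: div_Suc mod_Suc j_def)
    then have "noise_weight z (Suc l) = 64 * real z ^ (2 * M + 6 * M)"
      by (simp add: noise_weight_def M_def)
    then show ?thesis using True by (intro that[of "6 * M"]) auto
  next
    case False
    have "Suc l div 4 = l div 4" "Suc l mod 4 = Suc j"
      using False by (simp_all add: div_Suc mod_Suc j_def)
    then have "noise_weight z (Suc l) = 64 * real z ^ (2 * M + M * (3 + j))"
      by (simp add: noise_weight_def M_def algebra_simps)
    then show ?thesis by (intro that[of "M * (3 + j)"]) (auto simp: algebra_simps)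
  qed
  have "noise_weight z (Suc l) / alphabet z l = 64 * real z ^ e"
    using zp unfolding e(1) D by (simp add: power_add)
  also have "\<dots> \<le> 32 * (real z * real z ^ e)" using zp by simp
  also have "real z * real z ^ e = real z ^ (Suc e)" by simp
  also have "32 * \<dots> \<le> 32 * real z ^ (M * (4 + j))"
    using e(2) M zp by (intro mult_left_mono power_increasing) auto
  finally have 1: "noise_weight z (Suc l) / alphabet z l \<le> 32 * real z ^ (M * (4 + j))" .
  have "(real (alphabet z l))\<^sup>2 = real z ^ (M * 4)"
    unfolding D by (simp flip: power_mult add: mult.commute)
  also have "\<dots> \<le> real z ^ (M * (4 + j))" using zp by (intro power_increasing) auto
  finally have 2: "(real (alphabet z l))\<^sup>2 \<le> real z ^ (M * (4 + j))" .
  have "noise_weight z l = 64 * real z ^ (M * (4 + j))" by (simp add: noise_weight_def M_def j_def)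
  then show ?thesis using 1 2 by linarith
qed

text \<open>Energy and number of the competitors contribute at most 1/512 each. Round
  \<open>4 * m\<close>, the last one, has alphabet \<open>z^(2 * 2^m)\<close>, which alone
  outnumbers the competitors by the factor 512.\<close>

lemma prob_cell_fails:
  assumes z: "z \<ge> 2 ^ 15" and \<Lambda>: "512 * \<Lambda> \<le> real z ^ (2 * 2 ^ m)"
    and A: "A \<subseteq> {..<n}" "i \<in> A" and heavy: "\<theta> < (x i)\<^sup>2" "0 \<le> \<theta>"
    and noise: "(\<Sum>j\<in>A - {i}. (x j)\<^sup>2) * real z ^ 5 \<le> \<theta>" and size: "real (card (A - {i})) \<le> \<Lambda>"
  shows "measure_pmf.prob (cell_pmf n (alphabet z) {0..<4 * m + 1})
    {c. cell_run x c [0..<4 * m + 1] A \<noteq> {i}} \<le> 1 / 256"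
proof -
  let ?L = "4 * m + 1"
  \<comment> \<open>\<open>K l\<close> is the chance that a competitor agrees with the label of
    \<open>i\<close> in every round from \<open>l\<close> on.\<close>
  define K where "K = (\<lambda>l. 1 / (\<Prod>j\<in>{l..<?L}. real (alphabet z j)))"
  have z2: "z \<ge> 2" using z by simp
  then have zr: "real z > 0" "real z \<ge> 1" "real z \<ge> 2 ^ 15"
    using z by (simp_all add: numeral_power_le_of_nat_cancel_iff)
  have xi: "x i \<noteq> 0" using heavy by auto
  have "measure_pmf.prob (cell_pmf n (alphabet z) {0..<?L}) {c. cell_run x c [0..<?L] A \<noteq> {i}}
      \<le> noise_weight z 0 / (x i)\<^sup>2 * (\<Sum>j\<in>A - {i}. (x j)\<^sup>2) + K 0 * real (card (A - {i}))"
  proof (rule prob_cell_run_fails)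
    show "alphabet z l > 0" for l using z2 by (simp add: alphabet_def)
    show "0 \<le> noise_weight z l" for l by (simp add: noise_weight_def)
    show "32 * (real (alphabet z l))\<^sup>2 + noise_weight z (Suc l) / real (alphabet z l) \<le> noise_weight z l" for l
      by (rule noise_weight_step[OF z2])
    show "K (Suc l) / real (alphabet z l) \<le> K l" if "l < ?L" for l
    proof -
      have "(\<Prod>j\<in>{l..<?L}. real (alphabet z j)) = real (alphabet z l) * (\<Prod>j\<in>{Suc l..<?L}. real (alphabet z j))"
        by (rule prod.atLeast_Suc_lessThan[OF that])
      then show ?thesis by (simp only: K_def divide_divide_eq_left mult.commute order_refl)
    qed
  qed (use A xi in \<open>auto simp: K_def\<close>)
  also have "\<dots> \<le> 1 / 512 + 1 / 512"
  proof (rule add_mono)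
    let ?N = "\<Sum>j\<in>A - {i}. (x j)\<^sup>2"
    have "noise_weight z 0 / (x i)\<^sup>2 * ?N = 64 * real z ^ 4 * ?N / (x i)\<^sup>2"
      by (simp add: noise_weight_def)
    also have "\<dots> \<le> 1 / 512"
    proof -
      \<comment> \<open>The assumption \<open>z \<ge> 2^15\<close> comes from
        \<open>512 * 64 = 2^15\<close>; it uses up one of the five powers of \<open>z\<close> in the
        noise hypothesis.\<close>
      have "512 * (64 * real z ^ 4 * ?N) = 2 ^ 15 * (real z ^ 4 * ?N)" by simp
      also have "\<dots> \<le> real z * (real z ^ 4 * ?N)"
        using zr by (intro mult_right_mono mult_nonneg_nonneg sum_nonneg) auto
      also have "\<dots> = ?N * real z ^ 5" by (simp add: power_numeral_reduce)
      also have "\<dots> \<le> (x i)\<^sup>2" using noise heavy by simp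
      finally show ?thesis using xi by (simp add: field_simps)
    qed
    finally show "noise_weight z 0 / (x i)\<^sup>2 * ?N \<le> 1 / 512" .
    have "K 0 \<le> 1 / real (alphabet z (4 * m))"
    proof -
      have ge1: "1 \<le> real (alphabet z j)" for j using zr by (simp add: alphabet_def one_le_power)
      have "{0..<?L} = insert (4 * m) {0..<4 * m}" by auto
      then have "(\<Prod>j\<in>{0..<?L}. real (alphabet z j)) = real (alphabet z (4 * m)) * (\<Prod>j\<in>{0..<4 * m}. real (alphabet z j))"
        by (simp add: mult.commute)
      moreover have "1 \<le> (\<Prod>j\<in>{0..<4 * m}. real (alphabet z j))" using ge1 by (intro prod_ge_1) auto
      ultimately have "real (alphabet z (4 * m)) \<le> (\<Prod>j\<in>{0..<?L}. real (alphabet z j))"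
        using mult_left_mono[of 1 "\<Prod>j\<in>{0..<4 * m}. real (alphabet z j)" "real (alphabet z (4 * m))"] by (simp add: mult.commute)
      then show ?thesis unfolding K_def using ge1[of "4 * m"] by (intro divide_left_mono) (auto intro!: mult_pos_pos)
    qed
    also have "real (alphabet z (4 * m)) = real z ^ (2 * 2 ^ m)" by (simp add: alphabet_def)
    finally have K0: "K 0 \<le> 1 / real z ^ (2 * 2 ^ m)" .
    have "K 0 * real (card (A - {i})) \<le> 1 / real z ^ (2 * 2 ^ m) * (real z ^ (2 * 2 ^ m) / 512)"
      using K0 size \<Lambda> zr by (intro mult_mono) auto
    then show "K 0 * real (card (A - {i})) \<le> 1 / 512" using zr by simp
  qed
  finally show ?thesis by simp
qed

section \<open>Failure probability of a stage and of the whole run\<close>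

context schedule
begin

definition stage_pmf :: "(nat \<Rightarrow> nat) \<Rightarrow> nat \<Rightarrow> (nat \<Rightarrow> rep_seed) pmf" where
  "stage_pmf z s = Pi_pmf {..<R s} undefined (\<lambda>_. rep_pmf n (B s) (cell_pmf n (alphabet (z s)) {0..<L}))"

lemma finite_stage_pmf [simp]: "B s > 0 \<Longrightarrow> z s > 0 \<Longrightarrow> finite (set_pmf (stage_pmf z s))"
  unfolding stage_pmf_def by (intro finite_set_Pi_pmf finite_rep_pmf finite_cell_pmf) (auto simp: alphabet_def)

lemma prob_stage_fails:
  fixes t T \<epsilon> :: real
  assumes L: "L = 4 * m + 1" and z: "z s \<ge> 2 ^ 19" and t: "t > 0" and \<epsilon>: "0 < \<epsilon>" "\<epsilon> \<le> 1" and T: "0 \<le> T"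
    and Rs: "R s > 0" and Bs: "B s = nat \<lceil>t * real (z s) ^ 7 / \<epsilon>\<rceil>"
    and lab: "2 ^ 26 * real n * \<epsilon> \<le> t * real (z s) ^ 7 * real (z s) ^ (2 * 2 ^ m)"
    and U: "U \<subseteq> {..<n} - S" "real (card U) \<le> t" "\<And>i. i \<in> U \<Longrightarrow> \<epsilon> * T / (t * real (z s)) < (x i)\<^sup>2"
    and rest: "(\<Sum>j\<in>{..<n} - S - U. (x j)\<^sup>2) \<le> 2 * T"
    and m': "m' > 0" "t * exp (- real (R s)) \<le> real m'"
  shows "measure_pmf.prob (stage_pmf z s) {\<rho>. m' \<le> card (U - stage_found x s \<rho> S)}
     \<le> exp (- 2 * real m' * real (R s))"
proof -
  define y where "y = real (z s)"
  define b where "b = real (B s)"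
  define \<theta> where "\<theta> = \<epsilon> * T / (t * y)"
  \<comment> \<open>Chosen so that at most \<open>b / 2^17\<close> buckets hold more than \<Lambda>
    candidates.\<close>
  define \<Lambda> where "\<Lambda> = 2 ^ 17 * real n / b"
  have y: "y \<ge> 2 ^ 19" "y > 0" "y \<ge> 1" using z unfolding y_def
    by (simp_all add: numeral_power_le_of_nat_cancel_iff)
  have bge: "t * y ^ 7 / \<epsilon> \<le> b" unfolding b_def Bs y_def using real_nat_ceiling_ge by blast
  have "0 < t * y ^ 7 / \<epsilon>" using t y \<epsilon> by simp
  then have b: "b > 0" using bge by linarith
  then have Bpos: "B s > 0" by (simp add: b_def)
  have \<theta>: "0 \<le> \<theta>" using \<epsilon> T t y by (simp add: \<theta>_def)
  have finU: "finite U" using U(1) finite_subset by auto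
  have cell: "measure_pmf.prob (cell_pmf n (alphabet (z s)) {0..<L}) {c. cell_run x c [0..<L] A \<noteq> {i}} \<le> 1 / 256"
    if "A \<subseteq> {..<n}" "i \<in> A" "i \<in> U" "(\<Sum>j\<in>A - {i}. (x j)\<^sup>2) * y ^ 5 \<le> \<theta>" "real (card (A - {i})) \<le> \<Lambda>" for A i
    unfolding L
  proof (rule prob_cell_fails)
    show "z s \<ge> 2 ^ 15" using z by simp
    have "512 * \<Lambda> = 2 ^ 26 * real n / b" by (simp add: \<Lambda>_def)
    also have "\<dots> \<le> 2 ^ 26 * real n / (t * y ^ 7 / \<epsilon>)"
      using bge b t y \<epsilon> by (intro divide_left_mono) auto
    also have "\<dots> = 2 ^ 26 * real n * \<epsilon> / (t * y ^ 7)" by simp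
    also have "\<dots> \<le> y ^ (2 * 2 ^ m)"
      using lab t y by (simp add: y_def pos_divide_le_eq mult_ac)
    finally show "512 * \<Lambda> \<le> real (z s) ^ (2 * 2 ^ m)" by (simp add: y_def)
    show "\<theta> < (x i)\<^sup>2" using U(3) that by (simp add: \<theta>_def y_def)
  qed (use that \<theta> in \<open>auto simp: y_def\<close>)
  have rep: "measure_pmf.prob (rep_pmf n (B s) (cell_pmf n (alphabet (z s)) {0..<L}))
      {\<rho>. W \<inter> rep_found (\<lambda>c. cell_run x c [0..<L]) n (B s) S \<rho> = {}} \<le> (1 / 128) ^ card W" if W: "W \<subseteq> U" for W
  proof -
    have "measure_pmf.prob (rep_pmf n (B s) (cell_pmf n (alphabet (z s)) {0..<L}))
      {\<rho>. W \<inter> rep_found (\<lambda>c. cell_run x c [0..<L]) n (B s) S \<rho> = {}} \<le> (2 * (1 / 256)) ^ card W"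
    \<comment> \<open>Of the allowance \<open>p^2 * B = b / 2^16\<close> one half goes to overfull
      buckets. At most \<open>2 * t * y^6 / \<epsilon>\<close> buckets have noise above
      \<open>\<theta> / y^5\<close>; these and the buckets of \<open>U\<close> fit into the other
      half because \<open>y \<ge> 2^19 = 4 * 2^17\<close>.\<close>
    proof (rule prob_rep_misses_all[where x=x and r="y ^ 5" and \<theta>=\<theta> and \<Lambda>=\<Lambda> and M="2 * t * y ^ 6 / \<epsilon>" and M'="b / 2 ^ 17"])
      show "finite (set_pmf (cell_pmf n (alphabet (z s)) {0..<L}))"
        using y by (intro finite_cell_pmf) (auto simp: alphabet_def y_def)
      have "(\<Sum>j\<in>{..<n} - S - U. (x j)\<^sup>2) * y ^ 5 \<le> 2 * T * y ^ 5"
        using rest y by (intro mult_right_mono) auto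
      also have "\<dots> = 2 * t * y ^ 6 / \<epsilon> * \<theta>"
        using t y \<epsilon> by (simp add: \<theta>_def field_simps power_numeral_reduce)
      finally show "(\<Sum>j\<in>{..<n} - S - U. (x j)\<^sup>2) * y ^ 5 \<le> 2 * t * y ^ 6 / \<epsilon> * \<theta>" .
      show "real n \<le> b / 2 ^ 17 * \<Lambda>" using b by (simp add: \<Lambda>_def)
      have "2 * real (card U) \<le> 2 * t" using U(2) by simp
      also have "\<dots> \<le> 2 * t * (y ^ 6 / \<epsilon>)"
      proof -
        have "\<epsilon> \<le> y ^ 6" using \<epsilon>(2) one_le_power[OF y(3), of 6] by linarith
        then have "1 \<le> y ^ 6 / \<epsilon>" using \<epsilon>(1) by simp
        then have "2 * t * 1 \<le> 2 * t * (y ^ 6 / \<epsilon>)" using t by (intro mult_left_mono) auto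
        then show ?thesis by simp
      qed
      also have "\<dots> = 2 * (t * y ^ 6 / \<epsilon>)" by simp
      finally have cU: "2 * real (card U) \<le> 2 * (t * y ^ 6 / \<epsilon>)" .
      have "2 * t * y ^ 6 / \<epsilon> + 2 * real (card U) \<le> 2 * (t * y ^ 6 / \<epsilon>) + 2 * (t * y ^ 6 / \<epsilon>)"
        using cU by (intro add_mono) simp_all
      also have "\<dots> = 4 * (t * y ^ 6 / \<epsilon>)" by simp
      also have "\<dots> \<le> y / 2 ^ 17 * (t * y ^ 6 / \<epsilon>)"
        using y t \<epsilon> by (intro mult_right_mono) (simp_all add: field_simps)
      also have "\<dots> = (t * y ^ 7 / \<epsilon>) / 2 ^ 17" by (simp add: power_numeral_reduce mult_ac)
      also have "\<dots> \<le> b / 2 ^ 17" using bge by (rule divide_right_mono) simp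
      finally show "2 * t * y ^ 6 / \<epsilon> + b / 2 ^ 17 + 2 * real (card U) \<le> (1 / 256)\<^sup>2 * real (B s)"
        by (simp add: b_def power2_eq_square)
    qed (use Bpos U W cell \<theta> t y \<epsilon> b in \<open>auto simp: \<Lambda>_def\<close>)
    then show ?thesis by simp
  qed
  show ?thesis
    unfolding stage_pmf_def stage_found_def
    by (rule prob_stage_misses_many[OF finU U(2) m' Rs rep])
qed

lemma found_cong: "(\<And>s'. s' < s \<Longrightarrow> \<omega> s' = \<omega>' s') \<Longrightarrow> found x \<omega> s = found x \<omega>' s"
  by (induction s) auto

text \<open>
  Before stage \<open>s\<close>, all but \<open>t s\<close> of the coordinates in \<open>H\<close> have been found or are so small that
  giving them up is affordable: the error caused by the coordinates given up in stage \<open>s\<close> is at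
  most \<open>\<epsilon> * T / z s\<close>.
\<close>

definition invariant ::
  "(nat \<Rightarrow> nat) \<Rightarrow> (nat \<Rightarrow> real) \<Rightarrow> real \<Rightarrow> (nat \<Rightarrow> real) \<Rightarrow> nat set \<Rightarrow> nat \<Rightarrow> nat set \<Rightarrow> bool" where
  "invariant z t \<epsilon> x H s S \<longleftrightarrow> (\<exists>U \<subseteq> H. real (card U) \<le> t s \<and>
     (\<Sum>i\<in>H - S - U. (x i)\<^sup>2) \<le> \<epsilon> * (\<Sum>i\<in>{..<n} - H. (x i)\<^sup>2) * (\<Sum>r<s. 1 / real (z r)))"

text \<open>The unfound part of \<open>U\<close> is split at the threshold \<theta>. The light part
  \<open>U0\<close> is given up, at a price of at most
  \<open>t s * \<theta> = \<epsilon> * T / z s\<close>. The heavy part \<open>U1\<close> is what the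
  stage searches for, so the invariant can break only if too many elements of \<open>U1\<close> are
  missed.\<close>

lemma prob_invariant_fails_step:
  fixes t :: "nat \<Rightarrow> real" and \<epsilon> :: real
  assumes L: "L = 4 * m + 1" and z: "z s \<ge> 2 ^ 19" and t: "t s > 0" "t (Suc s) \<ge> 0" and \<epsilon>: "0 < \<epsilon>" "\<epsilon> \<le> 1"
    and Rs: "R s > 0" and Bs: "B s = nat \<lceil>t s * real (z s) ^ 7 / \<epsilon>\<rceil>"
    and lab: "2 ^ 26 * real n * \<epsilon> \<le> t s * real (z s) ^ 7 * real (z s) ^ (2 * 2 ^ m)"
    and decay: "t s * exp (- real (R s)) \<le> t (Suc s)"
    and H: "H \<subseteq> {..<n}" and sum1: "(\<Sum>r<Suc s. 1 / real (z r)) \<le> 1"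
    and inv: "invariant z t \<epsilon> x H s S"
  shows "measure_pmf.prob (stage_pmf z s) {\<rho>. \<not> invariant z t \<epsilon> x H (Suc s) (S \<union> stage_found x s \<rho> S)}
     \<le> exp (- 2 * real (nat \<lfloor>t (Suc s)\<rfloor> + 1) * real (R s))"
proof -
  define T where "T = (\<Sum>i\<in>{..<n} - H. (x i)\<^sup>2)"
  define \<theta> where "\<theta> = \<epsilon> * T / (t s * real (z s))"
  \<comment> \<open>The least natural number above \<open>t (Suc s)\<close>: missing fewer than
    \<open>m'\<close> elements means missing at most \<open>t (Suc s)\<close>.\<close>
  define m' where "m' = nat \<lfloor>t (Suc s)\<rfloor> + 1"
  have T: "0 \<le> T" by (simp add: T_def sum_nonneg)
  have zp: "real (z s) > 0" using z by simp
  have \<theta>: "0 \<le> \<theta>" using \<epsilon> T t zp by (simp add: \<theta>_def)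
  obtain U where U: "U \<subseteq> H" "real (card U) \<le> t s"
    "(\<Sum>i\<in>H - S - U. (x i)\<^sup>2) \<le> \<epsilon> * T * (\<Sum>r<s. 1 / real (z r))"
    using inv by (auto simp: invariant_def T_def)
  define U1 where "U1 = {i \<in> U - S. \<theta> < (x i)\<^sup>2}"
  define U0 where "U0 = {i \<in> U - S. (x i)\<^sup>2 \<le> \<theta>}"
  have finH: "finite H" using H by (rule finite_subset) simp
  have finU: "finite U" using U(1) finH by (rule finite_subset)
  note fin = finH finU
  have "(\<Sum>i\<in>U0. (x i)\<^sup>2) \<le> real (card U0) * \<theta>"
    using sum_bounded_above[of U0 "\<lambda>i. (x i)\<^sup>2" \<theta>] by (simp add: U0_def)
  also have "\<dots> \<le> t s * \<theta>"
  proof (intro mult_right_mono \<theta>)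
    have "card U0 \<le> card U" using fin by (intro card_mono) (auto simp: U0_def)
    then show "real (card U0) \<le> t s" using U(2) by simp
  qed
  also have "\<dots> = \<epsilon> * T * (1 / real (z s))" using t zp by (simp add: \<theta>_def)
  finally have U0: "(\<Sum>i\<in>U0. (x i)\<^sup>2) \<le> \<epsilon> * T * (1 / real (z s))" .
  have drop: "(\<Sum>i\<in>(H - S - U) \<union> U0. (x i)\<^sup>2) \<le> \<epsilon> * T * (\<Sum>r<Suc s. 1 / real (z r))"
  proof -
    have "(\<Sum>i\<in>(H - S - U) \<union> U0. (x i)\<^sup>2) = (\<Sum>i\<in>H - S - U. (x i)\<^sup>2) + (\<Sum>i\<in>U0. (x i)\<^sup>2)"
      using fin by (intro sum.union_disjoint) (auto simp: U0_def)
    then show ?thesis using U(3) U0 by (simp add: distrib_left)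
  qed
  \<comment> \<open>The noise consists of the tail and of everything given up so far, and the latter
    has energy at most \<open>\<epsilon> * T \<le> T\<close>.\<close>
  have rest: "(\<Sum>j\<in>{..<n} - S - U1. (x j)\<^sup>2) \<le> 2 * T"
  proof -
    have "(\<Sum>j\<in>{..<n} - S - U1. (x j)\<^sup>2) \<le> (\<Sum>j\<in>({..<n} - H) \<union> ((H - S - U) \<union> U0). (x j)\<^sup>2)"
      using fin by (intro sum_mono2) (auto simp: U1_def U0_def)
    also have "\<dots> = T + (\<Sum>j\<in>(H - S - U) \<union> U0. (x j)\<^sup>2)"
      unfolding T_def using fin U(1) by (intro sum.union_disjoint) (auto simp: U0_def)
    also have "\<dots> \<le> T + \<epsilon> * T * 1"
    proof -
      have "\<epsilon> * T * (\<Sum>r<Suc s. 1 / real (z r)) \<le> \<epsilon> * T * 1"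
        using \<epsilon> T by (intro mult_left_mono[OF sum1]) simp
      then show ?thesis using drop by linarith
    qed
    also have "\<dots> \<le> 2 * T" using \<epsilon> T mult_right_mono[of \<epsilon> 1 T] by simp
    finally show ?thesis .
  qed
  have "{\<rho>. \<not> invariant z t \<epsilon> x H (Suc s) (S \<union> stage_found x s \<rho> S)}
      \<subseteq> {\<rho>. m' \<le> card (U1 - stage_found x s \<rho> S)}"
  proof (intro subsetI, rule ccontr)
    fix \<rho> assume "\<rho> \<in> {\<rho>. \<not> invariant z t \<epsilon> x H (Suc s) (S \<union> stage_found x s \<rho> S)}"
      and "\<rho> \<notin> {\<rho>. m' \<le> card (U1 - stage_found x s \<rho> S)}"
    then have bad: "\<not> invariant z t \<epsilon> x H (Suc s) (S \<union> stage_found x s \<rho> S)"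
      and few: "card (U1 - stage_found x s \<rho> S) < m'" by auto
    let ?U = "U1 - stage_found x s \<rho> S"
    have "real (card ?U) \<le> real (nat \<lfloor>t (Suc s)\<rfloor>)" using few by (simp add: m'_def)
    also have "\<dots> \<le> t (Suc s)" using t by simp
    finally have "real (card ?U) \<le> t (Suc s)" .
    moreover have "?U \<subseteq> H" using U(1) by (auto simp: U1_def)
    moreover have "(\<Sum>i\<in>H - (S \<union> stage_found x s \<rho> S) - ?U. (x i)\<^sup>2) \<le> \<epsilon> * T * (\<Sum>r<Suc s. 1 / real (z r))"
    proof (rule order_trans[OF _ drop], rule sum_mono2)
      show "H - (S \<union> stage_found x s \<rho> S) - ?U \<subseteq> (H - S - U) \<union> U0"
        by (auto simp: U1_def U0_def)
    qed (use fin in \<open>auto simp: U0_def\<close>)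
    ultimately show False using bad unfolding invariant_def T_def by blast
  qed
  then have "measure_pmf.prob (stage_pmf z s) {\<rho>. \<not> invariant z t \<epsilon> x H (Suc s) (S \<union> stage_found x s \<rho> S)}
     \<le> measure_pmf.prob (stage_pmf z s) {\<rho>. m' \<le> card (U1 - stage_found x s \<rho> S)}"
    by (intro measure_pmf.finite_measure_mono) auto
  also have "\<dots> \<le> exp (- 2 * real m' * real (R s))"
  proof (rule prob_stage_fails[where z=z and S=S, OF L z t(1) \<epsilon> T Rs Bs lab _ _ _ rest])
    show "U1 \<subseteq> {..<n} - S" using U(1) H by (auto simp: U1_def)
    have "card U1 \<le> card U" using fin by (intro card_mono) (auto simp: U1_def)
    then show "real (card U1) \<le> t s" using U(2) by simp
    show "\<epsilon> * T / (t s * real (z s)) < (x i)\<^sup>2" if "i \<in> U1" for i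
      using that by (simp add: U1_def \<theta>_def)
    show "m' > 0" by (simp add: m'_def)
    have "t (Suc s) \<le> real m'" using t(2) unfolding m'_def by linarith
    then show "t s * exp (- real (R s)) \<le> real m'" using decay by linarith
  qed
  finally show ?thesis by (simp add: m'_def)
qed

text \<open>The failure probabilities of the stages add up, each stage being judged conditionally on
  the earlier ones. At the end \<open>t J < 1\<close> leaves no room for an outstanding coordinate,
  so the top coordinates that are missing have all been given up, with energy at most \<epsilon>
  times the tail.\<close>

lemma prob_recovery_fails:
  fixes t \<delta> :: "nat \<Rightarrow> real" and \<epsilon> :: real
  assumes L: "L = 4 * m + 1" and \<epsilon>: "0 < \<epsilon>" "\<epsilon> \<le> 1" and H: "H \<subseteq> {..<n}" "real (card H) \<le> t 0"
    and tpos: "\<And>s. t s > 0" and tJ: "t J < 1" and sum1: "\<And>s. (\<Sum>r<s. 1 / real (z r)) \<le> 1"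
    and z: "\<And>s. z s \<ge> 2 ^ 19" and Rs: "\<And>s. R s > 0"
    and Bs: "\<And>s. B s = nat \<lceil>t s * real (z s) ^ 7 / \<epsilon>\<rceil>"
    and lab: "\<And>s. 2 ^ 26 * real n * \<epsilon> \<le> t s * real (z s) ^ 7 * real (z s) ^ (2 * 2 ^ m)"
    and decay: "\<And>s. t s * exp (- real (R s)) \<le> t (Suc s)"
    and \<delta>: "\<And>s. s < J \<Longrightarrow> exp (- 2 * real (nat \<lfloor>t (Suc s)\<rfloor> + 1) * real (R s)) \<le> \<delta> s"
  shows "measure_pmf.prob (Pi_pmf {..<J} undefined (stage_pmf z))
    {\<omega>. \<not> (\<Sum>i\<in>{..<n} - found x \<omega> J. (x i)\<^sup>2) \<le> (1 + \<epsilon>) * (\<Sum>i\<in>{..<n} - H. (x i)\<^sup>2)} \<le> (\<Sum>s<J. \<delta> s)"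
proof -
  let ?I = "\<lambda>s S. invariant z t \<epsilon> x H s S"
  let ?T = "\<Sum>i\<in>{..<n} - H. (x i)\<^sup>2"
  have fin_stage: "finite (set_pmf (stage_pmf z s))" for s
  proof (rule finite_stage_pmf)
    show z0: "z s > 0" using z[of s] by simp
    show "B s > 0" unfolding Bs using tpos[of s] \<epsilon> z0 by simp
  qed
  have inv: "measure_pmf.prob (Pi_pmf {..<s} undefined (stage_pmf z)) {\<omega>. \<not> ?I s (found x \<omega> s)} \<le> (\<Sum>r<s. \<delta> r)"
    if "s \<le> J" for s
    using that
  proof (induction s)
    case 0
    have "?I 0 {}" using H by (auto simp: invariant_def intro!: exI[of _ H])
    then show ?case by simp
  next
    case (Suc s)
    let ?P = "Pi_pmf {..<s} undefined (stage_pmf z)"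
    have finP: "finite (set_pmf ?P)" using fin_stage by (intro finite_set_Pi_pmf) auto
    have found_upd: "found x (f(s := y)) (Suc s) = found x f s \<union> stage_found x s y (found x f s)" for f y
    proof -
      have "found x (f(s := y)) s = found x f s" by (rule found_cong) auto
      then show ?thesis by simp
    qed
    have "measure_pmf.prob (Pi_pmf {..<Suc s} undefined (stage_pmf z)) {\<omega>. \<not> ?I (Suc s) (found x \<omega> (Suc s))}
      = measure_pmf.expectation ?P (\<lambda>f. measure_pmf.prob (stage_pmf z s)
          {y. \<not> ?I (Suc s) (found x f s \<union> stage_found x s y (found x f s))})"
      unfolding lessThan_Suc using fin_stage
      by (subst prob_Pi_pmf_insert_last) (simp_all add: found_upd del: found.simps)
    \<comment> \<open>Either the invariant was already violated, which the indicator pays for, or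
      this stage breaks it, with probability at most \<open>\<delta> s\<close>.\<close>
    also have "\<dots> \<le> measure_pmf.expectation ?P (\<lambda>f. indicator {\<omega>. \<not> ?I s (found x \<omega> s)} f + \<delta> s)"
    proof (rule expectation_pmf_mono[OF finP])
      fix f
      show "measure_pmf.prob (stage_pmf z s) {y. \<not> ?I (Suc s) (found x f s \<union> stage_found x s y (found x f s))}
          \<le> indicator {\<omega>. \<not> ?I s (found x \<omega> s)} f + \<delta> s"
      proof (cases "?I s (found x f s)")
        case True
        have "measure_pmf.prob (stage_pmf z s) {y. \<not> ?I (Suc s) (found x f s \<union> stage_found x s y (found x f s))}
          \<le> exp (- 2 * real (nat \<lfloor>t (Suc s)\<rfloor> + 1) * real (R s))"
          using tpos[of "Suc s"]
          by (intro prob_invariant_fails_step[OF L z tpos _ \<epsilon> Rs Bs lab decay H(1) sum1 True]) auto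
        also have "\<dots> \<le> \<delta> s" using Suc.prems by (intro \<delta>) auto
        finally show ?thesis using True by simp
      next
        case False
        have "0 \<le> \<delta> s" using \<delta>[of s] Suc.prems by (intro order_trans[OF exp_ge_zero]) auto
        then show ?thesis using False by (simp add: add_increasing2)
      qed
    qed
    also have "\<dots> = measure_pmf.prob ?P {\<omega>. \<not> ?I s (found x \<omega> s)} + \<delta> s"
      using finP by (simp add: integrable_measure_pmf_finite)
    finally show ?case using Suc by simp
  qed
  have "{\<omega>. \<not> (\<Sum>i\<in>{..<n} - found x \<omega> J. (x i)\<^sup>2) \<le> (1 + \<epsilon>) * ?T} \<subseteq> {\<omega>. \<not> ?I J (found x \<omega> J)}"
  proof (intro subsetI CollectI notI)
    fix \<omega> assume bad: "\<omega> \<in> {\<omega>. \<not> (\<Sum>i\<in>{..<n} - found x \<omega> J. (x i)\<^sup>2) \<le> (1 + \<epsilon>) * ?T}"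
      and "?I J (found x \<omega> J)"
    then obtain U where U: "U \<subseteq> H" "real (card U) \<le> t J"
      "(\<Sum>i\<in>H - found x \<omega> J - U. (x i)\<^sup>2) \<le> \<epsilon> * ?T * (\<Sum>r<J. 1 / real (z r))"
      by (auto simp: invariant_def)
    have finH: "finite H" using H(1) by (rule finite_subset) simp
    have "card U = 0" using U(2) tJ by linarith
    then have "U = {}" using U(1) finH finite_subset by fastforce
    have T: "0 \<le> ?T" by (simp add: sum_nonneg)
    have "(\<Sum>i\<in>{..<n} - found x \<omega> J. (x i)\<^sup>2) \<le> (\<Sum>i\<in>({..<n} - H) \<union> (H - found x \<omega> J). (x i)\<^sup>2)"
      using finH by (intro sum_mono2) auto
    also have "\<dots> = ?T + (\<Sum>i\<in>H - found x \<omega> J. (x i)\<^sup>2)"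
      using finH by (intro sum.union_disjoint) auto
    also have "\<dots> \<le> ?T + \<epsilon> * ?T * 1"
    proof -
      have "\<epsilon> * ?T * (\<Sum>r<J. 1 / real (z r)) \<le> \<epsilon> * ?T * 1"
        using \<epsilon> T by (intro mult_left_mono[OF sum1]) simp
      then show ?thesis using U(3) \<open>U = {}\<close> by simp
    qed
    finally show False using bad by (simp add: algebra_simps)
  qed
  then have "measure_pmf.prob (Pi_pmf {..<J} undefined (stage_pmf z))
      {\<omega>. \<not> (\<Sum>i\<in>{..<n} - found x \<omega> J. (x i)\<^sup>2) \<le> (1 + \<epsilon>) * ?T}
    \<le> measure_pmf.prob (Pi_pmf {..<J} undefined (stage_pmf z)) {\<omega>. \<not> ?I J (found x \<omega> J)}"
    by (rule measure_pmf.finite_measure_mono) simp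
  also have "\<dots> \<le> (\<Sum>s<J. \<delta> s)" by (rule inv) simp
  finally show ?thesis .
qed

end

section \<open>The sequence of stage parameters\<close>

text \<open>Above 2 a binary logarithm lowers its argument by at least 1. This guarantees that the
  minimum in \<open>log_star\<close> is attained.\<close>

lemma log_iterates_le_1: "t \<le> real N + 1 \<Longrightarrow> \<exists>i. (log 2 ^^ i) t \<le> 1"
proof (induction N arbitrary: t)
  case 0
  then have "(log 2 ^^ 0) t \<le> 1" by simp
  then show ?case by blast
next
  case (Suc N)
  consider "t \<le> 1" | "1 < t" "t \<le> 2" | "2 < t" by linarith
  then show ?case
  proof cases
    case 1
    then have "(log 2 ^^ 0) t \<le> 1" by simp
    then show ?thesis by blast
  next
    case 2
    then have "(log 2 ^^ 1) t \<le> 1" by simp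
    then show ?thesis by blast
  next
    case 3
    have "ln t = ln 2 + ln (t / 2)" using 3 by (simp add: ln_div)
    also have "\<dots> \<le> ln 2 + (t / 2 - 1)" using 3 by (intro add_left_mono ln_le_minus_one) auto
    also have "t / 2 - 1 = (t - 2) * (1 / 2)" by simp
    also have "\<dots> \<le> (t - 2) * ln 2"
    proof (rule mult_left_mono)
      show "1 / 2 \<le> ln (2::real)" using ln_le_minus_one[of "1 / 2 :: real"] by (simp add: ln_div)
    qed (use 3 in simp)
    finally have "ln t \<le> (t - 1) * ln 2" by (simp add: algebra_simps)
    then have "log 2 t \<le> t - 1" unfolding log_def by (subst pos_divide_le_eq) simp_all
    then have "log 2 t \<le> real N + 1" using Suc.prems by simp
    then obtain i where "(log 2 ^^ i) (log 2 t) \<le> 1" using Suc.IH by blast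
    then have "(log 2 ^^ Suc i) t \<le> 1" by (simp add: funpow_swap1)
    then show ?thesis by blast
  qed
qed

text \<open>A function growing at least like a tower undoes one logarithm per step. All iterates
  before the last exceed 1, so each logarithm has a positive argument and can be inverted.\<close>

lemma le_tower_log_star:
  fixes f :: "nat \<Rightarrow> real"
  assumes "1 \<le> f 0" and tower: "\<And>j. j < log_star t \<Longrightarrow> 2 powr f j \<le> f (Suc j)"
  shows "t \<le> f (log_star t)"
proof -
  define i where "i = log_star t"
  obtain N :: nat where "t \<le> real N" using real_arch_simple by blast
  then have "\<exists>i. (log 2 ^^ i) t \<le> 1" by (intro log_iterates_le_1[of t N]) simp
  then have end_le: "(log 2 ^^ i) t \<le> 1" unfolding i_def log_star_def by (rule LeastI_ex)
  have before: "1 < (log 2 ^^ j) t" if "j < i" for j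
    using not_less_Least[of j "\<lambda>i. (log 2 ^^ i) t \<le> 1"] that unfolding i_def log_star_def by simp
  have "(log 2 ^^ (i - j)) t \<le> f j" if "j \<le> i" for j
    using that
  proof (induction j)
    case 0
    then show ?case using end_le assms(1) by simp
  next
    case (Suc j)
    define u where "u = (log 2 ^^ (i - Suc j)) t"
    have "i - j = Suc (i - Suc j)" using Suc.prems by simp
    then have "log 2 u \<le> f j" using Suc by (simp add: u_def)
    moreover have "1 < u" unfolding u_def using Suc.prems by (intro before) simp
    ultimately have "u \<le> 2 powr f j" by (simp add: log_le_iff)
    also have "\<dots> \<le> f (Suc j)" using Suc.prems by (intro tower) (simp add: i_def)
    finally show ?case by (simp add: u_def)
  qed
  from this[of i] show ?thesis by (simp add: i_def)
qed

text \<open>The exponential bound is the progress that the repetitions of one stage allow; the cap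
  by the factor \<open>Q\<close> keeps the failure probability small.\<close>

primrec growth :: "nat \<Rightarrow> nat \<Rightarrow> nat \<Rightarrow> nat" where
  "growth z\<^sub>0 Q 0 = z\<^sub>0"
| "growth z\<^sub>0 Q (Suc s) = min (2 ^ growth z\<^sub>0 Q s) (growth z\<^sub>0 Q s * Q)"

lemma double_le_two_power: "u \<ge> 1 \<Longrightarrow> 2 * u \<le> 2 ^ (u::nat)"
  by (induction u rule: nat_induct_at_least) auto

lemma growth_double:
  assumes "Q \<ge> 2" "z\<^sub>0 \<ge> 1"
  shows "growth z\<^sub>0 Q s \<ge> 1 \<and> 2 * growth z\<^sub>0 Q s \<le> growth z\<^sub>0 Q (Suc s)"
proof (induction s)
  case 0
  show ?case using assms double_le_two_power[of z\<^sub>0] by (simp add: mult.commute)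
  case (Suc s)
  then have ge: "growth z\<^sub>0 Q (Suc s) \<ge> 1" by linarith
  then show ?case
    using assms double_le_two_power[OF ge] unfolding growth.simps(2)[of z\<^sub>0 Q "Suc s"] by (simp add: mult.commute)
qed

lemma growth_ge:
  assumes "Q \<ge> 2" "z\<^sub>0 \<ge> 1"
  shows "z\<^sub>0 * 2 ^ s \<le> growth z\<^sub>0 Q s"
proof (induction s)
  case (Suc s)
  then show ?case using growth_double[OF assms, of s] by (simp del: growth.simps)
qed simp

lemma growth_ge_start:
  assumes "Q \<ge> 2" "z\<^sub>0 \<ge> 1"
  shows "z\<^sub>0 \<le> growth z\<^sub>0 Q s"
proof -
  have "z\<^sub>0 * 1 \<le> z\<^sub>0 * 2 ^ s" by (intro mult_le_mono) auto
  also have "\<dots> \<le> growth z\<^sub>0 Q s" by (rule growth_ge[OF assms])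
  finally show ?thesis by (simp only: mult_1_right)
qed

text \<open>This sum controls both the energy given up over all stages and the total number of
  cells.\<close>

lemma sum_inverse_growth_le_1:
  assumes "Q \<ge> 2" "z\<^sub>0 \<ge> 2"
  shows "(\<Sum>r<s. 1 / real (growth z\<^sub>0 Q r)) \<le> 1"
proof -
  have "(\<Sum>r<s. 1 / real (growth z\<^sub>0 Q r)) \<le> (\<Sum>r<s. (1 / 2) ^ Suc r)"
  proof (rule sum_mono)
    fix r
    have "2 * 2 ^ r \<le> z\<^sub>0 * 2 ^ r" using assms by simp
    also have "\<dots> \<le> growth z\<^sub>0 Q r" using assms by (intro growth_ge) auto
    finally have "2 ^ Suc r \<le> growth z\<^sub>0 Q r" by simp
    then have "(2::real) ^ Suc r \<le> real (growth z\<^sub>0 Q r)" by (metis of_nat_le_iff of_nat_numeral of_nat_power)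
    then have "1 / real (growth z\<^sub>0 Q r) \<le> 1 / 2 ^ Suc r" by (intro frac_le) auto
    then show "1 / real (growth z\<^sub>0 Q r) \<le> (1 / 2) ^ Suc r" by (simp add: power_one_over)
  qed
  also have "\<dots> = 1 - (1 / 2) ^ s" by (induction s) auto
  also have "\<dots> \<le> 1" by simp
  finally show ?thesis .
qed

text \<open>Once the cap \<open>Q\<close> is the smaller bound it remains so: multiplying
  \<open>z\<close> by \<open>Q\<close> squeezes in a factor \<open>2^(z * (Q - 1)) \<ge> Q\<close>
  on the exponential side.\<close>

lemma growth_fast:
  assumes "Q \<ge> 2" "z\<^sub>0 \<ge> 1" and slow: "growth z\<^sub>0 Q s * Q \<le> 2 ^ growth z\<^sub>0 Q s"
  shows "growth z\<^sub>0 Q (s + j) = growth z\<^sub>0 Q s * Q ^ j \<and> growth z\<^sub>0 Q (s + j) * Q \<le> 2 ^ growth z\<^sub>0 Q (s + j)"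
proof (induction j)
  case 0
  then show ?case using slow by simp
next
  case (Suc j)
  define z where "z = growth z\<^sub>0 Q (s + j)"
  have z: "z \<ge> 1" "z * Q \<le> 2 ^ z" using Suc growth_double[OF assms(1,2), of "s + j"] by (auto simp: z_def)
  then have eq: "growth z\<^sub>0 Q (s + Suc j) = z * Q" by (simp add: z_def)
  have "Q \<le> 2 ^ (Q - 1)" using less_exp[of "Q - 1"] assms(1) by linarith
  also have "\<dots> \<le> 2 ^ (z * (Q - 1))" using z by (intro power_increasing) auto
  finally have "z * Q * Q \<le> 2 ^ z * 2 ^ (z * (Q - 1))" using z by (intro mult_mono) auto
  also have "\<dots> = 2 ^ (z * Q)" using assms(1) by (simp add: algebra_simps flip: power_add)
  finally show ?case using eq Suc by (simp add: z_def)
qed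

text \<open>If the cap takes effect within the first \<open>log_star k + 2\<close> steps, then
  \<open>j\<close> further steps gain the factor \<open>k\<close> and one more makes the inequality
  strict. Otherwise all these steps are exponential and the tower is high enough.\<close>

lemma growth_exceeds:
  assumes Q: "Q \<ge> 2" and z\<^sub>0: "z\<^sub>0 \<ge> 1" and k: "k \<ge> 1" and a: "a \<ge> 1" and j: "real k \<le> (real Q ^ a) ^ j"
  shows "\<exists>s \<le> log_star (real k) + j + 2. real k * real z\<^sub>0 ^ a < real (growth z\<^sub>0 Q s) ^ a"
proof (cases "\<exists>s < log_star (real k) + 2. growth z\<^sub>0 Q s * Q \<le> 2 ^ growth z\<^sub>0 Q s")
  case True
  then obtain s where s: "s < log_star (real k) + 2" "growth z\<^sub>0 Q s * Q \<le> 2 ^ growth z\<^sub>0 Q s" by blast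
  have "z\<^sub>0 \<le> growth z\<^sub>0 Q s" by (rule growth_ge_start[OF Q z\<^sub>0])
  then have "z\<^sub>0 * Q ^ Suc j \<le> growth z\<^sub>0 Q (s + Suc j)"
    using conjunct1[OF growth_fast[OF Q z\<^sub>0 s(2), of "Suc j"]] by simp
  then have "real z\<^sub>0 * real Q ^ Suc j \<le> real (growth z\<^sub>0 Q (s + Suc j))"
    by (metis of_nat_le_iff of_nat_mult of_nat_power)
  then have "(real z\<^sub>0 * real Q ^ Suc j) ^ a \<le> real (growth z\<^sub>0 Q (s + Suc j)) ^ a"
    by (intro power_mono) auto
  moreover have "(real z\<^sub>0 * real Q ^ Suc j) ^ a = real z\<^sub>0 ^ a * (real Q ^ a * (real Q ^ a) ^ j)"
    by (simp add: power_mult_distrib mult.commute flip: power_mult)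
  moreover have "real z\<^sub>0 ^ a * real k < real z\<^sub>0 ^ a * (real Q ^ a * (real Q ^ a) ^ j)"
  proof (rule mult_strict_left_mono)
    have "1 < real Q ^ a" using Q a by (intro one_less_power) auto
    then have "1 * (real Q ^ a) ^ j < real Q ^ a * (real Q ^ a) ^ j"
      using Q by (intro mult_strict_right_mono) auto
    then show "real k < real Q ^ a * (real Q ^ a) ^ j" using j by simp
  qed (use z\<^sub>0 in auto)
  ultimately have "real k * real z\<^sub>0 ^ a < real (growth z\<^sub>0 Q (s + Suc j)) ^ a" by (simp add: mult.commute)
  moreover have "s + Suc j \<le> log_star (real k) + j + 2" using s by simp
  ultimately show ?thesis by blast
next
  case False
  define i where "i = log_star (real k)"
  have step: "growth z\<^sub>0 Q (Suc s) = 2 ^ growth z\<^sub>0 Q s" if "s < i + 2" for s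
    using False that by (auto simp: i_def not_le min_def)
  \<comment> \<open>Here \<open>y\<close> is at least \<open>k\<close> and at least
    \<open>z\<^sub>0\<close>, so \<open>k * z\<^sub>0 \<le> y^2 < 4^y \<le> 2^(2^y)\<close>, the
    value two steps later.\<close>
  define y where "y = growth z\<^sub>0 Q i"
  have "real k \<le> real y"
    unfolding y_def i_def
  proof (rule le_tower_log_star)
    show "1 \<le> real (growth z\<^sub>0 Q 0)" using z\<^sub>0 by simp
    fix j assume "j < log_star (real k)"
    then show "2 powr real (growth z\<^sub>0 Q j) \<le> real (growth z\<^sub>0 Q (Suc j))"
      using step[of j] by (simp add: i_def powr_realpow)
  qed
  have "z\<^sub>0 \<le> y" unfolding y_def by (rule growth_ge_start[OF Q z\<^sub>0])
  have y1: "y \<ge> 1" using \<open>z\<^sub>0 \<le> y\<close> z\<^sub>0 by simp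
  have "k * z\<^sub>0 \<le> y * y" using \<open>real k \<le> real y\<close> \<open>z\<^sub>0 \<le> y\<close> by (intro mult_le_mono) auto
  also have "\<dots> < 2 ^ y * 2 ^ y" by (intro mult_strict_mono) auto
  also have "\<dots> = 2 ^ (2 * y)" by (simp add: mult_2 power_add)
  also have "\<dots> \<le> 2 ^ (2 ^ y)"
    by (intro power_increasing double_le_two_power y1) simp
  also have "\<dots> = growth z\<^sub>0 Q (i + 2)" using step[of i] step[of "Suc i"] by (simp add: y_def del: growth.simps)
  finally have "k * z\<^sub>0 < growth z\<^sub>0 Q (i + 2)" .
  then have "real k * real z\<^sub>0 < real (growth z\<^sub>0 Q (i + 2))" by (metis of_nat_less_iff of_nat_mult)
  then have "(real k * real z\<^sub>0) ^ a < real (growth z\<^sub>0 Q (i + 2)) ^ a"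
    using a by (intro power_strict_mono) auto
  moreover have "real k * real z\<^sub>0 ^ a \<le> (real k * real z\<^sub>0) ^ a"
    using k a self_le_power[of "real k" a] by (simp add: power_mult_distrib mult_right_mono)
  ultimately have "real k * real z\<^sub>0 ^ a < real (growth z\<^sub>0 Q (i + 2)) ^ a" by linarith
  moreover have "i + 2 \<le> log_star (real k) + j + 2" by (simp add: i_def)
  ultimately show ?thesis by blast
qed

text \<open>The loss \<open>k^g\<close> in the failure exponent is split evenly. The choice
  \<open>a \<ge> 20 / g\<close> gives \<open>8 / a \<le> g / 2\<close>, covering the factor
  \<open>z^8\<close> missing from the repetitions; \<open>Q^a\<close> is about
  \<open>k^(g/2)\<close>. Doubling before rounding down gives both \<open>Q \<ge> 2\<close> and
  \<open>Q^a \<ge> k^(g/2)\<close>.\<close>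

locale stage_parameters =
  fixes g :: real and a z\<^sub>0 k Q :: nat
  assumes g: "0 < g" "g \<le> 1" and a_ge: "20 / g \<le> real a" and z\<^sub>0: "z\<^sub>0 = 2 ^ 19 * a" and k: "1 \<le> k"
    and Q: "Q = nat \<lfloor>2 * real k powr (g / (2 * real a))\<rfloor>"
begin

definition z :: "nat \<Rightarrow> nat" where "z = growth z\<^sub>0 Q"

definition t :: "nat \<Rightarrow> real" where "t s = real k * (real z\<^sub>0 / real (z s)) ^ a"

definition R :: "nat \<Rightarrow> nat" where "R s = z s ^ (a - 8)"

lemma a20: "a \<ge> 20"
proof -
  have "20 \<le> 20 / g" using g by (simp add: pos_le_divide_eq)
  then have "20 \<le> real a" using a_ge by linarith
  then show ?thesis by simp
qed

lemma Q_bounds: "Q \<ge> 2" "real k powr (g / (2 * real a)) \<le> real Q" "real Q \<le> 2 * real k powr (g / (2 * real a))"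
proof -
  define q where "q = real k powr (g / (2 * real a))"
  have q: "1 \<le> q" unfolding q_def using k g by (intro ge_one_powr_ge_zero) auto
  have Qr: "real Q = of_int \<lfloor>2 * q\<rfloor>" using q by (simp add: Q q_def)
  have "2 \<le> \<lfloor>2 * q\<rfloor>" using q by (simp add: le_floor_iff)
  then show "Q \<ge> 2" by (simp add: Q q_def nat_le_iff le_nat_iff)
  show "real k powr (g / (2 * real a)) \<le> real Q" unfolding Qr q_def[symmetric] using q by linarith
  show "real Q \<le> 2 * real k powr (g / (2 * real a))" unfolding Qr q_def[symmetric] by linarith
qed

lemma k_powr_power: "(real k powr (g / (2 * real a))) ^ a = real k powr (g / 2)"
  using k a20 by (simp add: powr_powr flip: powr_realpow)

lemma Q_power_ge: "real k powr (g / 2) \<le> real Q ^ a"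
  using power_mono[OF Q_bounds(2), of a] by (simp add: k_powr_power)

lemma Q_power_le: "real Q ^ a \<le> 2 ^ a * real k powr (g / 2)"
  using power_mono[OF Q_bounds(3), of a] by (simp add: k_powr_power power_mult_distrib)

lemma z_ge: "z\<^sub>0 \<le> z s"
  unfolding z_def using Q_bounds(1) z\<^sub>0 a20 by (intro growth_ge_start) auto

lemma z_ge_pow: "z s \<ge> 2 ^ 19"
proof -
  have "2 ^ 19 * 1 \<le> 2 ^ 19 * a" using a20 by (intro mult_le_mono) auto
  then show ?thesis using z_ge[of s] z\<^sub>0 by linarith
qed

lemma z_ge_a: "a \<le> z s"
  using z_ge[of s] z\<^sub>0 by simp

lemma z_pos: "real (z s) > 0" "real (z s) \<ge> 1"
  using z_ge_a[of s] a20 by auto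

lemma base_pos [simp]: "0 < z\<^sub>0" "1 \<le> real z\<^sub>0"
  using a20 z\<^sub>0 by auto

lemma z_ge_index: "s + 1 \<le> z s"
proof -
  have "s + 1 \<le> 2 ^ s" using less_exp[of s] by (simp add: Suc_le_eq)
  also have "\<dots> \<le> z\<^sub>0 * 2 ^ s" using z\<^sub>0 a20 by simp
  also have "\<dots> \<le> z s" unfolding z_def using Q_bounds(1) z\<^sub>0 a20 by (intro growth_ge) auto
  finally show ?thesis .
qed

lemma sum_inverse_z: "(\<Sum>r<s. 1 / real (z r)) \<le> 1"
  unfolding z_def using Q_bounds(1) z\<^sub>0 a20 by (intro sum_inverse_growth_le_1) auto

lemma t_pos: "t s > 0"
  using z_pos[of s] k by (simp add: t_def)

lemma R_ge: "real a * real (z s) \<le> real (R s)"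
proof -
  have "a * z s \<le> z s * z s" using z_ge_a by simp
  also have "\<dots> = z s ^ 2" by (simp add: power2_eq_square)
  also have "\<dots> \<le> R s" unfolding R_def using a20 z_pos[of s] by (intro power_increasing) auto
  finally show ?thesis by (metis of_nat_le_iff of_nat_mult)
qed

lemma R_pos: "R s > 0"
  using z_pos[of s] by (simp add: R_def)

text \<open>Uses the exponential bound on growth: \<open>t\<close> shrinks by at most
  \<open>2^(a * z s) \<le> exp (a * z s)\<close>, and \<open>R s\<close> is at least
  \<open>a * z s\<close>.\<close>

lemma t_decay: "t s * exp (- real (R s)) \<le> t (Suc s)"
proof -
  let ?r = "real (z s) / real (z (Suc s))"
  have "z (Suc s) \<le> 2 ^ z s" by (simp add: z_def)
  then have "real (z (Suc s)) \<le> 2 ^ z s" by (metis of_nat_le_iff of_nat_numeral of_nat_power)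
  also have "\<dots> \<le> exp 1 ^ z s" using exp_ge_add_one_self[of 1] by (intro power_mono) auto
  also have "\<dots> = exp (real (z s))" by (simp flip: exp_of_nat_mult)
  finally have "1 / exp (real (z s)) \<le> 1 / real (z (Suc s))"
    using z_pos[of "Suc s"] by (intro frac_le) auto
  also have "\<dots> \<le> ?r" using z_pos[of s] by (intro divide_right_mono) auto
  finally have "exp (- real (z s)) \<le> ?r" by (simp add: exp_minus inverse_eq_divide)
  then have "exp (- real (z s)) ^ a \<le> ?r ^ a" by (intro power_mono) auto
  moreover have "exp (- real (R s)) \<le> exp (- real (z s)) ^ a"
    using R_ge[of s] by (simp flip: exp_of_nat_mult)
  ultimately have "t s * exp (- real (R s)) \<le> t s * ?r ^ a"
    using t_pos[of s] by (intro mult_left_mono) auto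
  also have "\<dots> = t (Suc s)" using z_pos[of s] by (simp add: t_def power_divide)
  finally show ?thesis .
qed

text \<open>Uses the cap \<open>Q\<close>: the right-hand side is at least
  \<open>k * z\<^sub>0^a / (Q^a * z s^8)\<close>. With \<open>w = z s / z\<^sub>0\<close> the
  assumption gives \<open>w^a \<le> k\<close>, hence \<open>w^8 \<le> k^(g/2)\<close>;
  \<open>Q^a\<close> costs another \<open>k^(g/2)\<close>, and the constants
  \<open>2^a * z\<^sub>0^8\<close> are absorbed by \<open>z\<^sub>0^a\<close>.\<close>

lemma t_R_ge:
  assumes "1 \<le> t s"
  shows "real k powr (1 - g) \<le> t (Suc s) * real (R s)"
proof -
  define w where "w = real (z s) / real z\<^sub>0"
  have w1: "1 \<le> w" using z_ge[of s] by (simp add: w_def)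
  have "w ^ a \<le> real k" using assms z_pos[of s] by (simp add: t_def w_def field_simps)
  then have "(w ^ a) powr (8 / real a) \<le> real k powr (8 / real a)"
    using w1 by (intro powr_mono2) auto
  moreover have "(w ^ a) powr (8 / real a) = w ^ 8"
  proof -
    have "(w ^ a) powr (8 / real a) = (w powr real a) powr (8 / real a)"
      using w1 by (simp add: powr_realpow)
    also have "\<dots> = w powr 8" using a20 by (simp add: powr_powr)
    also have "\<dots> = w ^ 8" using w1 by simp
    finally show ?thesis .
  qed
  moreover have "real k powr (8 / real a) \<le> real k powr (g / 2)"
  proof (rule powr_mono)
    have "20 \<le> g * real a" using a_ge g by (simp add: pos_divide_le_eq mult.commute)
    then show "8 / real a \<le> g / 2" using a20 by (simp add: field_simps)
  qed (use k in simp)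
  ultimately have w8: "w ^ 8 \<le> real k powr (g / 2)" by linarith
  have "z (Suc s) \<le> z s * Q" by (simp add: z_def)
  then have "real (z (Suc s)) \<le> real (z s) * real Q" by (metis of_nat_le_iff of_nat_mult)
  then have "real (z (Suc s)) ^ a \<le> real (z s) ^ a * real Q ^ a"
    by (simp add: power_mono flip: power_mult_distrib)
  also have "\<dots> \<le> real (z s) ^ a * (2 ^ a * real k powr (g / 2))"
    using Q_power_le by (intro mult_left_mono) auto
  also have "real (z s) ^ a = real (R s) * (w ^ 8 * real z\<^sub>0 ^ 8)"
  proof -
    have "real (z s) ^ a = real (z s) ^ (a - 8) * real (z s) ^ 8"
      using a20 by (simp flip: power_add)
    then show ?thesis using z_pos by (simp add: R_def w_def power_divide)
  qed
  also have "\<dots> * (2 ^ a * real k powr (g / 2)) \<le> real (R s) * (real k powr (g / 2) * real z\<^sub>0 ^ 8) * (2 ^ a * real k powr (g / 2))"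
    using w8 by (intro mult_right_mono mult_left_mono) auto
  also have "\<dots> = real (R s) * real k powr g * (2 ^ a * real z\<^sub>0 ^ 8)"
  proof -
    have "real k powr (g / 2) * real k powr (g / 2) = real k powr g"
      by (simp flip: powr_add)
    then show ?thesis by (simp add: mult_ac)
  qed
  also have "\<dots> \<le> real (R s) * real k powr g * real z\<^sub>0 ^ a"
  proof (rule mult_left_mono)
    have "2 ^ a \<le> (4::real) ^ (a - 8)"
    proof -
      have "(4::real) ^ (a - 8) = 2 ^ (2 * (a - 8))" by (simp add: power_mult)
      then show ?thesis using a20 by (simp add: power_increasing)
    qed
    also have "\<dots> \<le> real z\<^sub>0 ^ (a - 8)" using z\<^sub>0 a20 by (intro power_mono) auto
    finally have "2 ^ a * real z\<^sub>0 ^ 8 \<le> real z\<^sub>0 ^ (a - 8) * real z\<^sub>0 ^ 8" by (rule mult_right_mono) simp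
    then show "2 ^ a * real z\<^sub>0 ^ 8 \<le> real z\<^sub>0 ^ a" using a20 by (simp flip: power_add)
  qed simp
  finally have main: "real (z (Suc s)) ^ a \<le> real (R s) * real k powr g * real z\<^sub>0 ^ a" .
  have kg: "real k powr (1 - g) = real k / real k powr g" using k by (simp add: powr_diff)
  have "real k powr (1 - g) * real (z (Suc s)) ^ a \<le> real k powr (1 - g) * (real (R s) * real k powr g * real z\<^sub>0 ^ a)"
    using main by (rule mult_left_mono) simp
  also have "\<dots> = real k * real z\<^sub>0 ^ a * real (R s)" using k by (simp add: kg)
  finally show ?thesis using z_pos[of "Suc s"] by (simp add: t_def power_divide field_simps)
qed

text \<open>The factor 2 in the exponent is shared: one half yields the target probability, the
  other at least \<open>s + 1\<close>, which makes the bounds summable over the stages.\<close>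

lemma stage_failure_le:
  assumes "1 \<le> t s"
  shows "exp (- 2 * real (nat \<lfloor>t (Suc s)\<rfloor> + 1) * real (R s)) \<le> exp (- (real k powr (1 - g))) * (1 / 2) ^ Suc s"
proof -
  define m where "m = real (nat \<lfloor>t (Suc s)\<rfloor> + 1)"
  have m: "t (Suc s) \<le> m" "1 \<le> m" using t_pos[of "Suc s"] unfolding m_def by linarith+
  have "t (Suc s) * real (R s) \<le> m * real (R s)" using m by (intro mult_right_mono) auto
  then have 1: "real k powr (1 - g) \<le> m * real (R s)" using t_R_ge[OF assms] by linarith
  have "1 * real (R s) \<le> m * real (R s)" using m by (intro mult_right_mono) auto
  moreover have "1 * real (z s) \<le> real a * real (z s)" using a20 by (intro mult_right_mono) auto
  ultimately have 2: "real (Suc s) \<le> m * real (R s)" using z_ge_index[of s] R_ge[of s] by linarith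
  have "exp (- 2 * m * real (R s)) \<le> exp (- (real k powr (1 - g)) + - real (Suc s))"
    using 1 2 by simp
  also have "\<dots> = exp (- (real k powr (1 - g))) * exp (- real (Suc s))" by (rule exp_add)
  also have "exp (- real (Suc s)) = exp (- 1) ^ Suc s" by (simp only: flip: exp_of_nat_mult) simp
  also have "exp (- 1) ^ Suc s \<le> (1 / 2 :: real) ^ Suc s"
  proof (rule power_mono)
    show "exp (- 1) \<le> (1 / 2 :: real)"
      using exp_ge_add_one_self[of 1] by (simp add: exp_minus inverse_eq_divide field_simps)
  qed simp
  finally show ?thesis by (simp add: m_def)
qed

text \<open>The powers of \<open>z s\<close> are distributed: \<open>z^7\<close> covers
  \<open>2^26\<close>, one \<open>z^(2^m)\<close> covers \<open>N'\<close>, and the other, being at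
  least \<open>z^a\<close>, turns \<open>t s\<close> back into at least \<open>k\<close>.\<close>

lemma alphabet_large:
  assumes N: "N \<le> N' * real k" "0 < N'" and m: "real a \<le> 2 ^ m" "N' \<le> 2 ^ (2 ^ m)"
  shows "2 ^ 26 * N \<le> t s * real (z s) ^ 7 * real (z s) ^ (2 * 2 ^ m)"
proof -
  have am: "a \<le> 2 ^ m" using m(1) by (metis of_nat_le_iff of_nat_numeral of_nat_power)
  have z2: "real (z s) \<ge> 2 ^ 19" using z_ge_pow[of s] by (simp add: numeral_power_le_of_nat_cancel_iff)
  have "real k \<le> real k * real z\<^sub>0 ^ a" using base_pos(2) by (simp add: one_le_power mult_le_cancel_left1)
  also have "\<dots> = t s * real (z s) ^ a" using z_pos[of s] by (simp add: t_def power_divide)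
  finally have k: "real k \<le> t s * real (z s) ^ a" .
  have "2 ^ 26 * N \<le> 2 ^ 26 * (N' * real k)" using N by simp
  also have "\<dots> \<le> real (z s) ^ 7 * (real (z s) ^ (2 ^ m) * (t s * real (z s) ^ (2 ^ m)))"
  proof (intro mult_mono)
    have "(2::real) ^ 26 \<le> (2 ^ 19) ^ 7" by simp
    also have "\<dots> \<le> real (z s) ^ 7" using z2 by (intro power_mono) auto
    finally show "2 ^ 26 \<le> real (z s) ^ 7" .
    have "N' \<le> 2 ^ (2 ^ m)" by fact
    also have "\<dots> \<le> real (z s) ^ (2 ^ m)" using z2 by (intro power_mono) auto
    finally show "N' \<le> real (z s) ^ (2 ^ m)" .
    have "t s * real (z s) ^ a \<le> t s * real (z s) ^ (2 ^ m)"
      using t_pos[of s] z_pos[of s] am by (intro mult_left_mono power_increasing) auto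
    then show "real k \<le> t s * real (z s) ^ (2 ^ m)" using k by linarith
  qed (use N t_pos[of s] in auto)
  also have "\<dots> = t s * real (z s) ^ 7 * real (z s) ^ (2 * 2 ^ m)"
    by (simp add: mult_2 power_add mult_ac)
  finally show ?thesis .
qed

text \<open>The exponents \<open>a - 8\<close> and \<open>7\<close> add up to \<open>a - 1\<close>,
  while \<open>t s\<close> carries \<open>z^(-a)\<close>; what remains is one factor
  \<open>1 / z s\<close>. Rounding up at most doubles the number of buckets, which is at least 1
  because \<open>t s \<ge> 1\<close>.\<close>

lemma stage_cost:
  assumes t1: "1 \<le> t s" and \<epsilon>: "0 < \<epsilon>" "\<epsilon> \<le> 1"
  shows "real (R s * nat \<lceil>t s * real (z s) ^ 7 / \<epsilon>\<rceil>) \<le> 2 * real z\<^sub>0 ^ a * (real k / \<epsilon>) * (1 / real (z s))"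
proof -
  define b where "b = t s * real (z s) ^ 7 / \<epsilon>"
  have "1 * 1 \<le> t s * real (z s) ^ 7" using t1 z_pos[of s] by (intro mult_mono one_le_power) auto
  then have "\<epsilon> \<le> t s * real (z s) ^ 7" using \<epsilon> by linarith
  then have b1: "1 \<le> b" using \<epsilon> by (simp add: b_def)
  then have "real (nat \<lceil>b\<rceil>) \<le> 2 * b" by linarith
  then have "real (R s) * real (nat \<lceil>b\<rceil>) \<le> real (R s) * (2 * b)" by (rule mult_left_mono) simp
  also have "\<dots> = 2 / \<epsilon> * (t s * (real (z s) ^ (a - 8) * real (z s) ^ 7))" by (simp add: R_def b_def)
  also have "real (z s) ^ (a - 8) * real (z s) ^ 7 = real (z s) ^ a * (1 / real (z s))"
  proof -
    have "a = Suc (a - 8 + 7)" using a20 by simp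
    then have "real (z s) ^ a = real (z s) * (real (z s) ^ (a - 8) * real (z s) ^ 7)"
      by (metis power_Suc power_add)
    then show ?thesis using z_pos[of s] by simp
  qed
  also have "t s * (real (z s) ^ a * (1 / real (z s))) = real k * real z\<^sub>0 ^ a * (1 / real (z s))"
    using z_pos[of s] by (simp add: t_def power_divide)
  finally show ?thesis by (simp add: b_def mult_ac)
qed

text \<open>Each capped step gains a factor of at least \<open>k^(g/2)\<close> in
  \<open>z^a\<close>, so \<open>2 / g\<close> of them gain the factor \<open>k\<close>.\<close>

lemma stages_finish:
  assumes j: "2 / g \<le> real j"
  shows "\<exists>s \<le> log_star (real k) + j + 2. t s < 1"
proof -
  have "real k = real k powr 1" using k by simp
  also have "\<dots> \<le> real k powr (g / 2 * real j)"
    using k g j by (intro powr_mono) (auto simp: field_simps)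
  also have "\<dots> = (real k powr (g / 2)) ^ j" using k by (simp add: powr_powr flip: powr_realpow)
  also have "\<dots> \<le> (real Q ^ a) ^ j" using Q_power_ge by (intro power_mono) auto
  finally have "\<exists>s \<le> log_star (real k) + j + 2. real k * real z\<^sub>0 ^ a < real (growth z\<^sub>0 Q s) ^ a"
    using Q_bounds(1) z\<^sub>0 a20 k by (intro growth_exceeds) auto
  then show ?thesis
    using z_pos by (auto simp: t_def power_divide z_def[symmetric] divide_less_eq)
qed

end

section \<open>Number of rounds per stage and choice of the constants\<close>

lemma alphabet_rounds:
  fixes y :: real and a :: nat
  assumes "a \<ge> 1"
  obtains m :: nat where "real a \<le> 2 ^ m" "max 4 y \<le> 2 ^ (2 ^ m)" "real (4 * m + 1) \<le> (4 * log 2 (real a) + 9) * loglog y"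
proof -
  define l where "l = log 2 (max 4 y)"
  have l2: "2 \<le> l" unfolding l_def by (simp add: le_log_iff powr_numeral)
  have ll: "loglog y = log 2 l" by (simp add: loglog_def l_def)
  have ll1: "1 \<le> loglog y" unfolding ll using l2 by (simp add: le_log_iff)
  have loga: "0 \<le> log 2 (real a)" using assms by simp
  \<comment> \<open>One exponent serves both requirements: \<open>2^m\<close> exceeds
    \<open>a * l\<close>, hence both \<open>a\<close> and
    \<open>l = log 2 (max 4 y)\<close>.\<close>
  define m where "m = nat \<lceil>log 2 (real a * l)\<rceil>"
  have al: "1 \<le> real a * l" using assms l2 mult_mono[of 1 "real a" 1 l] by simp
  have "log 2 (real a * l) \<le> real m" unfolding m_def by (rule real_nat_ceiling_ge)
  then have "real a * l \<le> 2 powr real m" using al by (simp add: log_le_iff)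
  then have pm: "real a * l \<le> 2 ^ m" by (simp add: powr_realpow)
  show ?thesis
  proof (rule that[of m])
    have "real a * 1 \<le> real a * l" using l2 by (intro mult_left_mono) auto
    then show "real a \<le> 2 ^ m" using pm by linarith
    have "1 * l \<le> real a * l" using l2 assms by (intro mult_right_mono) auto
    then have "l \<le> real (2 ^ m)" using pm by simp
    then have "max 4 y \<le> 2 powr real (2 ^ m)" unfolding l_def by (subst (asm) log_le_iff) auto
    then show "max 4 y \<le> 2 ^ (2 ^ m)" by (simp only: powr_realpow zero_less_numeral)
    have "0 \<le> log 2 (real a * l)" using al by simp
    then have "real m \<le> log 2 (real a * l) + 1" unfolding m_def by linarith
    also have "\<dots> = log 2 (real a) + loglog y + 1"
      unfolding ll using assms l2 by (simp add: log_mult)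
    finally have "real (4 * m + 1) \<le> 4 * log 2 (real a) + 4 * loglog y + 5" by simp
    also have "\<dots> \<le> (4 * log 2 (real a)) * loglog y + 4 * loglog y + 5 * loglog y"
      using ll1 loga mult_left_mono[OF ll1, of "4 * log 2 (real a)"] by simp
    finally show "real (4 * m + 1) \<le> (4 * log 2 (real a) + 9) * loglog y" by (simp add: algebra_simps)
  qed
qed

theorem theorem11:
  fixes \<gamma> :: real
  assumes "\<gamma> > 0"
  shows "\<exists>C > 0. \<forall>(n::nat) (k::nat) (\<epsilon>::real).
    1 \<le> k \<and> k \<le> n \<and> 0 < \<epsilon> \<and> \<epsilon> \<le> 1 \<longrightarrow>
    (\<exists>A :: (nat \<Rightarrow> real) adaptive_algorithm.
       randomized_algorithm n A \<and>
       real (num_rounds A) \<le> C * (real (max 1 (log_star (real k))) * loglog (\<epsilon> * real n / real k)) \<and>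
       (\<forall>x. \<forall>\<omega> \<in> space (seed_space A).
          real (num_measurements n A x \<omega>) \<le> C * ((real k / \<epsilon>) * loglog (\<epsilon> * real n / real k))) \<and>
       (\<forall>x z. is_tail n k x z \<longrightarrow>
          measure (seed_space A) (failure_event n A \<epsilon> x z) \<le> exp (- (real k powr (1 - \<gamma>)))))"
proof -
  \<comment> \<open>For \<gamma> above 1 the stronger bound with exponent \<open>1 - 1 = 0\<close>
    is proved.\<close>
  define g where "g = min \<gamma> 1"
  define a where "a = nat \<lceil>20 / g\<rceil>"
  define z\<^sub>0 where "z\<^sub>0 = 2 ^ 19 * a"
  define j where "j = nat \<lceil>2 / g\<rceil>"
  define c where "c = 4 * log 2 (real a) + 9"
  \<comment> \<open>The first two summands serve the rounds, the last one the measurements.\<close>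
  define C where "C = real (j + 3) * c + 1 + 6 * real z\<^sub>0 ^ a * c"
  have g: "0 < g" "g \<le> 1" and g_le: "g \<le> \<gamma>" using assms by (auto simp: g_def)
  have a_ge: "20 / g \<le> real a" unfolding a_def by (rule real_nat_ceiling_ge)
  have "0 < 20 / g" using g by simp
  then have a1: "a \<ge> 1" using a_ge by (metis One_nat_def Suc_leI of_nat_0_less_iff order_less_le_trans)
  have c9: "9 \<le> c" using a1 by (simp add: c_def)
  have C: "C \<ge> real (j + 3) * c + 1" "C \<ge> 6 * real z\<^sub>0 ^ a * c" "C > 0"
    using c9 by (auto simp: C_def add_nonneg_pos add_pos_nonneg)
  show ?thesis
  proof (intro exI[of _ C] conjI C(3) allI impI)
    fix n k :: nat and \<epsilon> :: real
    assume asm: "1 \<le> k \<and> k \<le> n \<and> 0 < \<epsilon> \<and> \<epsilon> \<le> 1"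
    then have k: "1 \<le> k" and \<epsilon>: "0 < \<epsilon>" "\<epsilon> \<le> 1" by auto
    define Q where "Q = nat \<lfloor>2 * real k powr (g / (2 * real a))\<rfloor>"
    interpret stage_parameters g a z\<^sub>0 k Q
      by unfold_locales (use g a_ge k in \<open>auto simp: z\<^sub>0_def Q_def\<close>)
    define y where "y = \<epsilon> * real n / real k"
    obtain m where m: "real a \<le> 2 ^ m" "max 4 y \<le> 2 ^ (2 ^ m)" "real (4 * m + 1) \<le> c * loglog y"
      using alphabet_rounds[OF a1, of y] unfolding c_def by blast
    define L where "L = 4 * m + 1"
    define B where "B = (\<lambda>s. nat \<lceil>t s * real (z s) ^ 7 / \<epsilon>\<rceil>)"
    interpret schedule n L R B by unfold_locales (simp add: L_def)
    \<comment> \<open>Stopping at the first \<open>s\<close> with \<open>t s < 1\<close> ensures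
      \<open>t s \<ge> 1\<close> in every stage performed, as the bounds on cost and failure
      require.\<close>
    define J where "J = (LEAST s. t s < 1)"
    obtain s where s: "s \<le> log_star (real k) + j + 2" "t s < 1"
      using stages_finish[of j] real_nat_ceiling_ge[of "2 / g"] unfolding j_def by blast
    have tJ: "t J < 1" unfolding J_def using s(2) by (rule LeastI)
    have J: "J \<le> log_star (real k) + j + 2" using Least_le[of "\<lambda>s. t s < 1" s] s by (simp add: J_def)
    have before: "1 \<le> t s" if "s < J" for s
      using not_less_Least[of s "\<lambda>s. t s < 1"] that by (simp add: J_def)
    have ll1: "1 \<le> loglog y"
    proof -
      have "2 \<le> log 2 (max 4 y)" by (simp add: le_log_iff powr_numeral)
      then show ?thesis by (simp add: loglog_def le_log_iff)
    qed
    have lab: "2 ^ 26 * real n * \<epsilon> \<le> t s * real (z s) ^ 7 * real (z s) ^ (2 * 2 ^ m)" for s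
    proof -
      have "real n * \<epsilon> = y * real k" using k by (simp add: y_def)
      also have "\<dots> \<le> max 4 y * real k" by (intro mult_right_mono) auto
      finally have "2 ^ 26 * (real n * \<epsilon>) \<le> t s * real (z s) ^ 7 * real (z s) ^ (2 * 2 ^ m)"
        by (intro alphabet_large[OF _ _ m(1,2)]) auto
      then show ?thesis by (simp only: mult.assoc)
    qed
    obtain A :: "(nat \<Rightarrow> real) adaptive_algorithm" where A:
      "randomized_algorithm n A" "num_rounds A = Suc (J * L)"
      "\<And>x \<omega>. \<omega> \<in> space (seed_space A) \<Longrightarrow> num_measurements n A x \<omega> \<le> (2 * L + 1) * (\<Sum>s<J. R s * B s)"
      "\<And>\<epsilon> x z'. measure (seed_space A) (failure_event n A \<epsilon> x z') =
         measure_pmf.prob (Pi_pmf {..<J} undefined (stage_pmf z))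
         {\<omega>. \<not> (\<Sum>i\<in>{..<n} - found x \<omega> J. (x i)\<^sup>2) \<le> (1 + \<epsilon>) * (norm2 n z')\<^sup>2}"
      using algorithm_exists[of J "Pi_pmf {..<J} undefined (stage_pmf z)"] by blast
    show "\<exists>A :: (nat \<Rightarrow> real) adaptive_algorithm.
       randomized_algorithm n A \<and>
       real (num_rounds A) \<le> C * (real (max 1 (log_star (real k))) * loglog (\<epsilon> * real n / real k)) \<and>
       (\<forall>x. \<forall>\<omega> \<in> space (seed_space A).
          real (num_measurements n A x \<omega>) \<le> C * ((real k / \<epsilon>) * loglog (\<epsilon> * real n / real k))) \<and>
       (\<forall>x z. is_tail n k x z \<longrightarrow>
          measure (seed_space A) (failure_event n A \<epsilon> x z) \<le> exp (- (real k powr (1 - \<gamma>))))"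
      unfolding y_def[symmetric]
    proof (intro exI[of _ A] conjI allI ballI impI A(1))
      \<comment> \<open>\<open>log_star 1\<close> is 0; the maximum with 1 absorbs the additive
        constant \<open>j + 2\<close> in the number of stages.\<close>
      define ls where "ls = real (max 1 (log_star (real k)))"
      have ls: "1 \<le> ls" "real (log_star (real k)) \<le> ls" by (auto simp: ls_def)
      have "real J \<le> real (log_star (real k) + j + 2)" using J by (simp only: of_nat_le_iff)
      then have "real J \<le> ls + real (j + 2) * 1" using ls(2) by simp
      also have "\<dots> \<le> ls + real (j + 2) * ls" using ls by (intro add_left_mono mult_left_mono) auto
      also have "\<dots> = real (j + 3) * ls" by (simp add: algebra_simps)
      finally have "real J * real L \<le> (real (j + 3) * ls) * (c * loglog y)"
        using m(3) by (intro mult_mono) (auto simp: L_def ls_def)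
      moreover have "1 * 1 \<le> ls * loglog y" using ls ll1 by (intro mult_mono) auto
      ultimately have "real (num_rounds A) \<le> (real (j + 3) * c + 1) * (ls * loglog y)"
        by (simp add: A(2) algebra_simps)
      also have "\<dots> \<le> C * (ls * loglog y)" using C(1) ls ll1 by (intro mult_right_mono) auto
      finally show "real (num_rounds A) \<le> C * (real (max 1 (log_star (real k))) * loglog y)" by (simp add: ls_def)
    next
      fix x \<omega> assume \<omega>: "\<omega> \<in> space (seed_space A)"
      have "real (\<Sum>s<J. R s * B s) \<le> (\<Sum>s<J. 2 * real z\<^sub>0 ^ a * (real k / \<epsilon>) * (1 / real (z s)))"
        unfolding of_nat_sum B_def using before \<epsilon> by (intro sum_mono stage_cost) auto
      also have "\<dots> = 2 * real z\<^sub>0 ^ a * (real k / \<epsilon>) * (\<Sum>s<J. 1 / real (z s))"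
        by (simp only: sum_distrib_left)
      also have "\<dots> \<le> 2 * real z\<^sub>0 ^ a * (real k / \<epsilon>) * 1"
        using \<epsilon> by (intro mult_left_mono sum_inverse_z) auto
      finally have cost: "real (\<Sum>s<J. R s * B s) \<le> 2 * real z\<^sub>0 ^ a * (real k / \<epsilon>)" by simp
      have "real (num_measurements n A x \<omega>) \<le> real ((2 * L + 1) * (\<Sum>s<J. R s * B s))"
        using A(3)[OF \<omega>, of x] by (simp only: of_nat_le_iff)
      also have "\<dots> = real (2 * L + 1) * real (\<Sum>s<J. R s * B s)" by (rule of_nat_mult)
      \<comment> \<open>\<open>2 * L + 1 \<le> 3 * L\<close>, and the total number of cells is
        bounded independently of the number of stages.\<close>
      also have "\<dots> \<le> (3 * (c * loglog y)) * (2 * real z\<^sub>0 ^ a * (real k / \<epsilon>))"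
        using m(3) cost c9 ll1 by (intro mult_mono of_nat_0_le_iff) (auto simp: L_def)
      also have "\<dots> = (6 * real z\<^sub>0 ^ a * c) * ((real k / \<epsilon>) * loglog y)" by simp
      also have "\<dots> \<le> C * ((real k / \<epsilon>) * loglog y)" using C(2) \<epsilon> ll1 by (intro mult_right_mono) auto
      finally show "real (num_measurements n A x \<omega>) \<le> C * ((real k / \<epsilon>) * loglog y)" .
    next
      fix x z' assume "is_tail n k x z'"
      then obtain H where H: "H \<subseteq> {..<n}" "card H = k" "z' = (\<lambda>i. if i \<in> H then 0 else x i)"
        by (auto simp: is_tail_def)
      have "(norm2 n z')\<^sup>2 = (\<Sum>i<n. if i \<in> H then 0 else (x i)\<^sup>2)"
        by (auto simp: L2_set_def sum_nonneg H(3) intro!: sum.cong)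
      also have "\<dots> = (\<Sum>i\<in>{..<n} - H. (x i)\<^sup>2)" by (simp add: sum.If_cases Diff_eq)
      finally have tail: "(norm2 n z')\<^sup>2 = (\<Sum>i\<in>{..<n} - H. (x i)\<^sup>2)" .
      have "measure (seed_space A) (failure_event n A \<epsilon> x z')
          \<le> (\<Sum>s<J. exp (- (real k powr (1 - g))) * (1 / 2) ^ Suc s)"
        unfolding A(4) tail
      proof (rule prob_recovery_fails[OF L_def \<epsilon> H(1) _ t_pos tJ sum_inverse_z z_ge_pow R_pos _ lab t_decay])
        show "real (card H) \<le> t 0" using H(2) base_pos(1) by (simp add: t_def z_def del: base_pos)
        show "B s = nat \<lceil>t s * real (z s) ^ 7 / \<epsilon>\<rceil>" for s by (simp add: B_def)
        show "exp (- 2 * real (nat \<lfloor>t (Suc s)\<rfloor> + 1) * real (R s)) \<le> exp (- (real k powr (1 - g))) * (1 / 2) ^ Suc s"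
          if "s < J" for s by (rule stage_failure_le[OF before[OF that]])
      qed
      also have "\<dots> = exp (- (real k powr (1 - g))) * (\<Sum>s<J. (1 / 2) ^ Suc s)" by (simp only: sum_distrib_left)
      also have "(\<Sum>s<J. (1 / 2) ^ Suc s) = 1 - (1 / 2 :: real) ^ J" by (induction J) auto
      also have "exp (- (real k powr (1 - g))) * (1 - (1 / 2) ^ J) \<le> exp (- (real k powr (1 - g))) * 1"
        by (intro mult_left_mono) auto
      also have "\<dots> \<le> exp (- (real k powr (1 - \<gamma>)))"
        using k g_le by (simp add: powr_mono)
      finally show "measure (seed_space A) (failure_event n A \<epsilon> x z') \<le> exp (- (real k powr (1 - \<gamma>)))" .
    qed
  qed
qed

end
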